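(* Let $G$ be a connected $d$-regular multigraph without loops on vertex set $[g]$, with $d\ge 3$. With the notation in the context, suppose that $\phi$ has a unique maximum on $K\cap W$ at $x^0=(1/d^2,\dots,1/d^2)$. Then, as $n\to\infty$ (along integers $n$ for which $G$ has a fractional perfect matching $f$ with $nf$ integer-valued), \[\mathbb{E}(X_G^2)\sim\frac{\big((d-1)d^{d-2}\big)^{dg}}{\mathrm{Vol}(\mathcal{L}^{(2)}_G)\det(-H|_V)^{1/2}}(2\pi n)^{r/2+g/2+3dg/4-d^2g/2}\Big(\frac{(d-1)^{d-1}}{d^{d-2}}\Big)^{gn},\] where $r$ is the rank of $\mathcal{L}^{(2)}_G$ and $H=D^2\phi(x^0)$, provided the determinant $\det(-H|_V)$ is non-zero. In particular this holds for all connected 3-regular $G$ (loopless multigraphs), provided $\det(-H|_V)\neq 0$.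
   Context: Random $n$-lift $L_n(G)$: vertex set $V_1\cup\dots\cup V_g$ of disjoint $n$-sets; for each edge $e$ of $G$ with endpoints $i,j$, an independent uniformly random perfect matching between $V_i$ and $V_j$; $X_G$ is the number of perfect matchings in $L_n(G)$. A fractional perfect matching of $G$ is $f:E(G)\to[0,1]$ with $\sum_{e\ni v}f(e)=1$ for all $v$. Variables $x=(x_{ief})\in\mathbb{R}^{gd^2}$ are indexed by $i\in[g]$ and ordered pairs $(e,f)$ of (possibly equal) edges incident to $i$. Define $\sigma_{ie}=\sum_{f\ni i,f\ne e}x_{ief}$, $\tau_{ie}=\sum_{f\ni i,f\ne e}x_{ife}$, $\gamma_{ie}=\sum_{f,f'\ni i;f,f'\ne e}x_{iff'}$ and $\phi(x)=\frac12\sum_{i}\sum_{e\ni i}\big(\sigma_{ie}\ln\sigma_{ie}+\tau_{ie}\ln\tau_{ie}+\gamma_{ie}\ln\gamma_{ie}-x_{iee}\ln x_{iee}-2\sum_{f\ni i,f\ne e}x_{ief}\ln x_{ief}\big)$ (with $0\ln0=0$). $V^*$ is the set of $x$ with, for every edge $e$ with endpoints $i,j$: $x_{iee}=x_{jee}$, $\sum_{f\ni i}x_{ief}=\sum_{f\ni j}x_{jef}$, $\sum_{f\ni i}x_{ife}=\sum_{f\ni j}x_{jfe}$. $W=\{x\in V^*:\sum_{e,f\ni i}x_{ief}=1\ \forall i\}$, $K=[0,1]^{gd^2}$, $V=\{x\in V^*:\sum_{e,f\ni i}x_{ief}=0\ \forall i\}$, $\mathcal{L}^{(2)}_G=V\cap\mathbb{Z}^{gd^2}$.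 $\mathrm{Vol}$ of a lattice is the volume of a unit cell (square root of the Gram determinant of a basis). $H$ is the Hessian of $\phi$ (as a function on $\mathbb{R}^{gd^2}$) at $x^0$, and $\det(-H|_V)=\det(-H(z_i,z_j))/\det(\langle z_i,z_j\rangle)$ for any basis $(z_i)$ of $V$. *)

theory Defs
  imports
    "HOL-Analysis.Analysis"
    "HOL-Probability.Probability"
    "HOL-Library.Landau_Symbols"
    "Jordan_Normal_Form.Determinant"
begin

no_notation vec_index (infixl "$" 100)

section \<open>Multigraphs\<close>

text \<open>
  A multigraph has a set of vertices, a set of edges and a map from edges to their sets of
  endpoints, so that parallel edges are distinct objects. The base graph has the finite type
  \<open>'v\<close> as its vertex set (so \<open>g = CARD('v)\<close>) and the finite type \<open>'e\<close> as its edge set; it is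
  then given by its endpoint map alone.
\<close>

definition loopless :: "('e::finite \<Rightarrow> 'v::finite set) \<Rightarrow> bool" where
  "loopless ends \<longleftrightarrow> (\<forall>e. card (ends e) = 2)"

definition incident :: "('e::finite \<Rightarrow> 'v::finite set) \<Rightarrow> 'v \<Rightarrow> 'e set" where
  "incident ends i = {e. i \<in> ends e}"

definition regular :: "('e::finite \<Rightarrow> 'v::finite set) \<Rightarrow> nat \<Rightarrow> bool" where
  "regular ends d \<longleftrightarrow> (\<forall>i. card (incident ends i) = d)"

definition connected_multigraph :: "('e::finite \<Rightarrow> 'v::finite set) \<Rightarrow> bool" where
  "connected_multigraph ends \<longleftrightarrow> {(i, j). \<exists>e. i \<in> ends e \<and> j \<in> ends e}\<^sup>* = UNIV"

definition perfect_matchings :: "'a set \<Rightarrow> 'b set \<Rightarrow> ('b \<Rightarrow> 'a set) \<Rightarrow> 'b set set" where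
  "perfect_matchings Vs Es en = {M. M \<subseteq> Es \<and> (\<forall>v\<in>Vs. \<exists>!e. e \<in> M \<and> v \<in> en e)}"

definition fractional_pm :: "('e::finite \<Rightarrow> 'v::finite set) \<Rightarrow> ('e \<Rightarrow> real) \<Rightarrow> bool" where
  "fractional_pm ends f \<longleftrightarrow>
     (\<forall>e. 0 \<le> f e \<and> f e \<le> 1) \<and> (\<forall>i. (\<Sum>e\<in>incident ends i. f e) = 1)"

definition admissible :: "('e::finite \<Rightarrow> 'v::finite set) \<Rightarrow> nat set" where
  "admissible ends = {n. \<exists>f. fractional_pm ends f \<and> (\<forall>e. real n * f e \<in> \<int>)}"

section \<open>Random lifts\<close>

definition fibre :: "nat \<Rightarrow> 'v \<Rightarrow> ('v \<times> nat) set" where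
  "fibre n i = {i} \<times> {..<n}"

text \<open>
  The perfect matchings between \<open>fibre n i\<close> and \<open>fibre n j\<close>, where \<open>i\<close> and \<open>j\<close> are the
  endpoints of \<open>e\<close>: the perfect matchings of the complete bipartite graph on these two sets.
\<close>

definition fibre_matchings ::
  "('e::finite \<Rightarrow> 'v::finite set) \<Rightarrow> nat \<Rightarrow> 'e \<Rightarrow> ('v \<times> nat) set set set" where
  "fibre_matchings ends n e =
     perfect_matchings (\<Union>i\<in>ends e. fibre n i)
       {{a, b} | a b. \<exists>i\<in>ends e. \<exists>j\<in>ends e. i \<noteq> j \<and> a \<in> fibre n i \<and> b \<in> fibre n j}
       (\<lambda>p. p)"

text \<open>
  The default value \<open>{}\<close> is immaterial, since the product is over all edges.
\<close>

definition random_lift ::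
  "('e::finite \<Rightarrow> 'v::finite set) \<Rightarrow> nat \<Rightarrow> ('e \<Rightarrow> ('v \<times> nat) set set) pmf" where
  "random_lift ends n = Pi_pmf UNIV {} (\<lambda>e. pmf_of_set (fibre_matchings ends n e))"

text \<open>
  An edge of the lift is a pair \<open>(e, {a, b})\<close> with \<open>{a, b}\<close> in the matching chosen for \<open>e\<close>.
  Thus the lift is again a multigraph: parallel edges of the base graph may lift to parallel
  edges, and perfect matchings that differ in which of these they use are counted separately.
\<close>

definition num_pm_lift :: "nat \<Rightarrow> ('e::finite \<Rightarrow> ('v::finite \<times> nat) set set) \<Rightarrow> nat" where
  "num_pm_lift n \<omega> = card (perfect_matchings (\<Union>i. fibre n i) (SIGMA e:UNIV. \<omega> e) snd)"

definition second_moment :: "('e::finite \<Rightarrow> 'v::finite set) \<Rightarrow> nat \<Rightarrow> real" where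
  "second_moment ends n =
     measure_pmf.expectation (random_lift ends n) (\<lambda>\<omega>. (real (num_pm_lift n \<omega>))\<^sup>2)"

section \<open>The variables and the function to be maximised\<close>

text \<open>
  The space of the vectors \<open>(x\<^sub>i\<^sub>e\<^sub>f)\<close> with \<open>e\<close> and \<open>f\<close> incident to \<open>i\<close>, of dimension \<open>g d\<^sup>2\<close> for
  a \<open>d\<close>-regular multigraph, is isometrically embedded in \<open>real ^ 'e ^ 'e ^ 'v\<close>: \<open>x\<^sub>i\<^sub>e\<^sub>f\<close> is
  \<open>x $ i $ e $ f\<close>, and the components that are not indexed by incident edges are \<open>0\<close>.
\<close>

definition var_space :: "('e::finite \<Rightarrow> 'v::finite set) \<Rightarrow> (real ^ 'e ^ 'e ^ 'v) set" where
  "var_space ends =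
     {x. \<forall>i e f. \<not> (e \<in> incident ends i \<and> f \<in> incident ends i) \<longrightarrow> x $ i $ e $ f = 0}"

definition sigma_var :: "('e::finite \<Rightarrow> 'v::finite set) \<Rightarrow> real ^ 'e ^ 'e ^ 'v \<Rightarrow> 'v \<Rightarrow> 'e \<Rightarrow> real" where
  "sigma_var ends x i e = (\<Sum>f\<in>incident ends i - {e}. x $ i $ e $ f)"

definition tau_var :: "('e::finite \<Rightarrow> 'v::finite set) \<Rightarrow> real ^ 'e ^ 'e ^ 'v \<Rightarrow> 'v \<Rightarrow> 'e \<Rightarrow> real" where
  "tau_var ends x i e = (\<Sum>f\<in>incident ends i - {e}. x $ i $ f $ e)"

definition gamma_var :: "('e::finite \<Rightarrow> 'v::finite set) \<Rightarrow> real ^ 'e ^ 'e ^ 'v \<Rightarrow> 'v \<Rightarrow> 'e \<Rightarrow> real" where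
  "gamma_var ends x i e =
     (\<Sum>f\<in>incident ends i - {e}. \<Sum>f'\<in>incident ends i - {e}. x $ i $ f $ f')"

text \<open>The convention \<open>0 ln 0 = 0\<close> holds automatically.\<close>

definition xlnx :: "real \<Rightarrow> real" where
  "xlnx t = t * ln t"

definition phi :: "('e::finite \<Rightarrow> 'v::finite set) \<Rightarrow> real ^ 'e ^ 'e ^ 'v \<Rightarrow> real" where
  "phi ends x = 1/2 * (\<Sum>i\<in>UNIV. \<Sum>e\<in>incident ends i.
     xlnx (sigma_var ends x i e) + xlnx (tau_var ends x i e) + xlnx (gamma_var ends x i e)
     - xlnx (x $ i $ e $ e)
     - 2 * (\<Sum>f\<in>incident ends i - {e}. xlnx (x $ i $ e $ f)))"

definition V_star :: "('e::finite \<Rightarrow> 'v::finite set) \<Rightarrow> (real ^ 'e ^ 'e ^ 'v) set" where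
  "V_star ends = {x \<in> var_space ends. \<forall>e. \<forall>i\<in>ends e. \<forall>j\<in>ends e.
     x $ i $ e $ e = x $ j $ e $ e \<and>
     (\<Sum>f\<in>incident ends i. x $ i $ e $ f) = (\<Sum>f\<in>incident ends j. x $ j $ e $ f) \<and>
     (\<Sum>f\<in>incident ends i. x $ i $ f $ e) = (\<Sum>f\<in>incident ends j. x $ j $ f $ e)}"

definition W_set :: "('e::finite \<Rightarrow> 'v::finite set) \<Rightarrow> (real ^ 'e ^ 'e ^ 'v) set" where
  "W_set ends = {x \<in> V_star ends.
     \<forall>i. (\<Sum>e\<in>incident ends i. \<Sum>f\<in>incident ends i. x $ i $ e $ f) = 1}"

definition K_set :: "('e::finite \<Rightarrow> 'v::finite set) \<Rightarrow> (real ^ 'e ^ 'e ^ 'v) set" where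
  "K_set ends = {x \<in> var_space ends. \<forall>i e f. 0 \<le> x $ i $ e $ f \<and> x $ i $ e $ f \<le> 1}"

definition V_set :: "('e::finite \<Rightarrow> 'v::finite set) \<Rightarrow> (real ^ 'e ^ 'e ^ 'v) set" where
  "V_set ends = {x \<in> V_star ends.
     \<forall>i. (\<Sum>e\<in>incident ends i. \<Sum>f\<in>incident ends i. x $ i $ e $ f) = 0}"

definition L2_lattice :: "('e::finite \<Rightarrow> 'v::finite set) \<Rightarrow> (real ^ 'e ^ 'e ^ 'v) set" where
  "L2_lattice ends = {x \<in> V_set ends. \<forall>i e f. x $ i $ e $ f \<in> \<int>}"

definition x0 :: "('e::finite \<Rightarrow> 'v::finite set) \<Rightarrow> nat \<Rightarrow> real ^ 'e ^ 'e ^ 'v" where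
  "x0 ends d = (\<chi> i e f. if e \<in> incident ends i \<and> f \<in> incident ends i then 1 / (real d)\<^sup>2 else 0)"

definition unique_max_on :: "('a \<Rightarrow> real) \<Rightarrow> 'a set \<Rightarrow> 'a \<Rightarrow> bool" where
  "unique_max_on F S y \<longleftrightarrow> y \<in> S \<and> (\<forall>x\<in>S. x \<noteq> y \<longrightarrow> F x < F y)"

section \<open>Lattices and determinants of bilinear forms\<close>

definition form_det :: "('a \<Rightarrow> 'a \<Rightarrow> real) \<Rightarrow> 'a list \<Rightarrow> real" where
  "form_det B zs =
     Determinant.det (mat (length zs) (length zs) (\<lambda>(k, l). B (zs ! k) (zs ! l)))"

definition lattice_basis :: "'a::real_vector set \<Rightarrow> 'a list \<Rightarrow> bool" where
  "lattice_basis L bs \<longleftrightarrow> distinct bs \<and> independent (set bs) \<and>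
     L = {\<Sum>k<length bs. of_int (c k) *\<^sub>R bs ! k | c :: nat \<Rightarrow> int. True}"

text \<open>
  The rank and the volume of a lattice, and the determinant of a bilinear form on a subspace,
  do not depend on the basis chosen.
\<close>

definition lattice_rank :: "'a::real_vector set \<Rightarrow> nat" where
  "lattice_rank L = length (SOME bs. lattice_basis L bs)"

definition lattice_vol :: "'a::real_inner set \<Rightarrow> real" where
  "lattice_vol L = sqrt (form_det inner (SOME bs. lattice_basis L bs))"

definition subspace_basis :: "'a::real_vector set \<Rightarrow> 'a list \<Rightarrow> bool" where
  "subspace_basis S zs \<longleftrightarrow> distinct zs \<and> independent (set zs) \<and> span (set zs) = S"

definition det_on :: "('a::real_inner \<Rightarrow> 'a \<Rightarrow> real) \<Rightarrow> 'a set \<Rightarrow> real" where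
  "det_on B S = (let zs = SOME zs. subspace_basis S zs in form_det B zs / form_det inner zs)"

text \<open>The Hessian \<open>D\<^sup>2F(x)\<close> as a bilinear form.\<close>

definition hessian :: "('a::real_normed_vector \<Rightarrow> real) \<Rightarrow> 'a \<Rightarrow> 'a \<Rightarrow> 'a \<Rightarrow> real" where
  "hessian F x z w =
     frechet_derivative (\<lambda>y. frechet_derivative F (at y) w) (at x) z"

definition neg_hessian_det :: "('e::finite \<Rightarrow> 'v::finite set) \<Rightarrow> nat \<Rightarrow> real" where
  "neg_hessian_det ends d = det_on (\<lambda>z w. - hessian (phi ends) (x0 ends d) z w) (V_set ends)"

end

(*
  Grouping the pairs of perfect matchings of the lift by the numbers x_ief of vertices over i that
  are matched over e by the first and over f by the second matching, E(X^2) is a sum, over the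
  integer points x of n (K Int W), of products of factorials. By Stirling's formula the term at x
  is exp (n phi(x/n)) up to a polynomial factor. The points x lie in a translate of the lattice
  L2, which spans V, and near n x0 the terms are Gaussian with quadratic form -H: at a maximum
  the gradient vanishes and H is negative semidefinite on V, hence definite if det(-H|V) is not 0.
  Away from n x0 the uniqueness of the maximum makes the terms negligible, and the sum over the
  lattice is evaluated by peeling off basis vectors one at a time.

  For d = 3 the maximum is unique because phi is a sum of contributions of the single vertices. Each
  is bounded, by Gibbs' inequality, by the logarithm of the tensor square of the form
  s1 c2 c3 + c1 s2 c3 + c1 c2 s3 at unit vectors. The form is at most 2 / sqrt 3 at unit vectors
  (s_k, c_k), and its tensor square is at most the square 4/3 of this bound.
*)

theory Submission
  imports Defs "HOL-Real_Asymp.Real_Asymp"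
begin

section \<open>Stirling's formula\<close>

text \<open>One finite family of linear forms l_t with coefficients c_t governs everything:
  \<open>phi\<close> is \<Sum> c_t xlnx (l_t), and the term of a count vector is \<Prod> (l_t!)^c_t
  up to a power of n!. The locale \<open>entropy_sum\<close> does the analysis for any such family.
  Stirling's formula enters as an exact identity whose error factor, \<open>stirling_weight\<close>,
  is estimated separately. Two obstacles shape the estimates. The coset n x0 + v_n + L2 moves with n
  and v_n is not controlled, so the Gaussian sums are evaluated with errors uniform in the shift. At
  the boundary of the feasible set some forms vanish and Stirling's asymptotics fails; there a
  polynomial bound on the error factor is enough, because the exponential loss away from the maximum
  absorbs it. The determinants are never computed. Since L2 spans V, one lattice basis serves for
  all of them: Vol(L2)^2 is its Gram determinant, det(-H|V) is the determinant of -H in this basis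
  divided by the Gram determinant, and only the determinant of -H in this basis survives in Vol(L2)
  det(-H|V)^(1/2), as it does in the Laplace sum.\<close>

definition stirling_quot :: "nat \<Rightarrow> real" where
  "stirling_quot m = fact m / exp (real m * ln (real m) - real m)"

lemma stirling_quot_pos [simp]: "stirling_quot m > 0"
  by (simp add: stirling_quot_def)

lemma fact_eq_stirling_quot:
  "fact m = stirling_quot m * exp (real m * ln (real m) - real m)"
  by (simp add: stirling_quot_def)

text \<open>The midpoint rule for the convex function 1/s on [1, 1 + t]. At t = 1/x it equals 1 / (x
  + 1/2), which is what makes \<open>stirling_log\<close> decrease.\<close>

lemma ln_one_plus_lower:
  fixes t :: real assumes "t \<ge> 0" shows "2 * t / (2 + t) \<le> ln (1 + t)"
proof -
  define f where "f = (\<lambda>t::real. ln (1 + t) - 2 * t / (2 + t))"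
  have "f 0 \<le> f t"
  proof (rule DERIV_nonneg_imp_nondecreasing[OF assms])
    fix x :: real assume x: "0 \<le> x" "x \<le> t"
    have "(f has_real_derivative (1 / (1 + x) - 4 / (2 + x)\<^sup>2)) (at x)"
      unfolding f_def using x
      by (auto intro!: derivative_eq_intros) (simp add: power2_eq_square field_simps)
    moreover have "1 / (1 + x) - 4 / (2 + x)\<^sup>2 \<ge> 0"
      using x by (simp add: divide_simps power2_eq_square) (simp add: algebra_simps)
    ultimately show "\<exists>y. (f has_real_derivative y) (at x) \<and> 0 \<le> y" by blast
  qed
  then show ?thesis by (simp add: f_def)
qed

text \<open>The trapezoidal rule for 1/s on [1, 1 + t]. At t = 1/x and multiplied by x + 1/2 it
  becomes 1 + 1 / (4 x (x + 1)), and the excess over 1 telescopes.\<close>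

lemma ln_one_plus_upper:
  fixes t :: real assumes "t \<ge> 0" shows "ln (1 + t) \<le> t * (2 + t) / (2 * (1 + t))"
proof -
  define f where "f = (\<lambda>t::real. t * (2 + t) / (2 * (1 + t)) - ln (1 + t))"
  have "f 0 \<le> f t"
  proof (rule DERIV_nonneg_imp_nondecreasing[OF assms])
    fix x :: real assume x: "0 \<le> x" "x \<le> t"
    have "(f has_real_derivative (x\<^sup>2 / (2 * (1 + x)\<^sup>2))) (at x)"
      unfolding f_def using x
      by (auto intro!: derivative_eq_intros simp: add_nonneg_eq_0_iff) (simp add: power2_eq_square divide_simps, simp add: algebra_simps)
    then show "\<exists>y. (f has_real_derivative y) (at x) \<and> 0 \<le> y" by force
  qed
  then show ?thesis by (simp add: f_def)
qed

text \<open>The logarithm of m! / (m^m e^(-m) sqrt m) at m = n + 1; the shift keeps the square root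
  away from 0.\<close>

definition stirling_log :: "nat \<Rightarrow> real" where
  "stirling_log n = ln (stirling_quot (Suc n)) - ln (real (Suc n)) / 2"

lemma stirling_log_diff:
  "stirling_log n - stirling_log (Suc n) = (real (Suc n) + 1/2) * ln (1 + 1 / real (Suc n)) - 1"
proof -
  have q: "ln (stirling_quot m) = ln (fact m) - (real m * ln (real m) - real m)" for m
    by (simp add: stirling_quot_def ln_div)
  have "ln (fact (Suc (Suc n)) :: real) = ln (real (Suc (Suc n))) + ln (fact (Suc n))"
    by (subst fact_Suc) (simp add: ln_mult del: fact_Suc of_nat_Suc)
  moreover have "ln (1 + 1 / real (Suc n)) = ln (real (Suc (Suc n))) - ln (real (Suc n))"
  proof -
    have "1 + 1 / real (Suc n) = real (Suc (Suc n)) / real (Suc n)" by (simp add: field_simps)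
    then show ?thesis by (simp add: ln_div del: of_nat_Suc)
  qed
  moreover have "real (Suc (Suc n)) = real (Suc n) + 1" by simp
  ultimately show ?thesis
    unfolding stirling_log_def q by (simp only:) (simp add: algebra_simps add_divide_distrib del: of_nat_Suc fact_Suc)
qed

lemma stirling_log_step:
  "0 \<le> stirling_log n - stirling_log (Suc n)"
  "stirling_log n - stirling_log (Suc n) \<le> (1 / real (Suc n) - 1 / real (Suc (Suc n))) / 4"
proof -
  define x where "x = real (Suc n)"
  have x: "x > 0" by (simp add: x_def)
  have "1 \<le> (x + 1/2) * (2 * (1/x) / (2 + 1/x))" using x by (simp add: field_simps)
  also have "\<dots> \<le> (x + 1/2) * ln (1 + 1/x)"
    using x by (intro mult_left_mono ln_one_plus_lower) auto
  finally show "0 \<le> stirling_log n - stirling_log (Suc n)"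
    unfolding stirling_log_diff x_def[symmetric] by simp
  have "(x + 1/2) * ln (1 + 1/x) \<le> (x + 1/2) * ((1/x) * (2 + 1/x) / (2 * (1 + 1/x)))"
    using x by (intro mult_left_mono ln_one_plus_upper) auto
  also have "\<dots> = 1 + (1 / x - 1 / (x + 1)) / 4"
    using x by (simp add: divide_simps) (simp add: algebra_simps)
  finally show "stirling_log n - stirling_log (Suc n) \<le> (1 / real (Suc n) - 1 / real (Suc (Suc n))) / 4"
    unfolding stirling_log_diff x_def[symmetric] of_nat_Suc[of "Suc n"] add.commute[of 1 x]
    by linarith
qed

text \<open>The sequence starts at 1 and its total decrease telescopes to at most 1/4. Besides
  convergence this gives two-sided bounds on m! for every m > 0, which the domination argument needs
  in addition to the limit.\<close>

lemma stirling_log_bounds: "3/4 \<le> stirling_log n" "stirling_log n \<le> 1"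
proof -
  have 0: "stirling_log 0 = 1" by (simp add: stirling_log_def stirling_quot_def ln_div)
  have "3/4 + 1 / real (Suc n) / 4 \<le> stirling_log n \<and> stirling_log n \<le> 1"
  proof (induction n)
    case (Suc n)
    then show ?case using stirling_log_step[of n] unfolding diff_divide_distrib by linarith
  qed (simp add: 0)
  moreover have "1 / real (Suc n) / 4 \<ge> 0" by simp
  ultimately show "3/4 \<le> stirling_log n" "stirling_log n \<le> 1" by linarith+
qed

lemma stirling_quot_eq_exp:
  assumes "m > 0" shows "stirling_quot m = exp (stirling_log (m - 1)) * sqrt (real m)"
proof -
  have "exp (ln (real m) / 2) = sqrt (real m)"
    using assms by (simp add: powr_half_sqrt[symmetric] powr_def)
  then show ?thesis using assms by (simp add: stirling_log_def exp_diff)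
qed

lemma stirling_quot_lower:
  assumes "m > 0" shows "sqrt (real m) \<le> stirling_quot m"
proof -
  have "1 \<le> exp (stirling_log (m - 1))" using stirling_log_bounds(1)[of "m - 1"] by simp
  from mult_right_mono[OF this, of "sqrt (real m)"] show ?thesis
    unfolding stirling_quot_eq_exp[OF assms] by simp
qed

lemma stirling_quot_ge_1: "1 \<le> stirling_quot m"
proof (cases "m = 0")
  case False
  then have "1 \<le> sqrt (real m)" by simp
  also have "\<dots> \<le> stirling_quot m" using stirling_quot_lower[of m] False by simp
  finally show ?thesis .
qed (simp add: stirling_quot_def)

lemma stirling_quot_upper:
  assumes "m > 0" shows "stirling_quot m \<le> exp 1 * sqrt (real m)"
  unfolding stirling_quot_eq_exp[OF assms]
  using stirling_log_bounds(2)[of "m - 1"] by (intro mult_right_mono) auto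

text \<open>A cruder bound than the square root, but valid at m = 0 too, where a form may vanish on
  the boundary of the feasible set.\<close>

lemma stirling_quot_le_Suc: "stirling_quot m \<le> exp 1 * real (Suc m)"
proof (cases "m = 0")
  case False
  have "sqrt (real m) \<le> real (Suc m)" by (rule real_le_lsqrt) (auto simp: power2_eq_square algebra_simps)
  then show ?thesis using stirling_quot_upper[of m] False
    by (smt (verit) exp_gt_zero gr0I mult_left_mono)
qed (simp add: stirling_quot_def)

lemma wallis_product_eq:
  "(\<Prod>k=1..n. (4*real k^2) / (4*real k^2 - 1)) = 2 ^ (4 * n) * fact n ^ 4 / (fact (2 * n) ^ 2 * real (2 * n + 1))"
proof (induction n)
  case (Suc n)
  have nz: "4 * (real (Suc n))\<^sup>2 - 1 = real (2 * n + 1) * real (2 * n + 3)"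
    by (simp add: power2_eq_square algebra_simps)
  have f: "(fact (2 * Suc n) :: real) = 2 * real (Suc n) * real (2 * n + 1) * fact (2 * n)"
    by (simp add: algebra_simps)
  have g: "(fact (Suc n) :: real) = real (Suc n) * fact n" by simp
  have e: "real (2 * Suc n + 1) = real (2 * n + 3)" by simp
  have h: "A * (4 * x^2 / (o1 * o3)) = 16 * P * (x * F) ^ 4 / ((2 * x * o1 * G)^2 * o3)"
    if "A = P * F ^ 4 / (G ^ 2 * o1)" "x > 0" "o1 > 0" "o3 > 0" "G > 0" for A P x o1 o3 F G :: real
  proof -
    have "A * (4 * x^2 / (o1 * o3)) = 4 * P * F ^ 4 * x^2 / (G^2 * o1^2 * o3)"
      using that by (simp add: power2_eq_square mult_ac)
    also have "\<dots> = 16 * P * (x * F) ^ 4 / ((2 * x * o1 * G)^2 * o3)"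
      using that by (simp add: power_mult_distrib divide_simps power2_eq_square power4_eq_xxxx)
    finally show ?thesis .
  qed
  have p: "2 ^ (4 * Suc n) = 16 * (2 ^ (4 * n) :: real)" by (simp add: power_add)
  have s: "(\<Prod>k=1..Suc n. u k) = (\<Prod>k=1..n. u k) * u (Suc n)" for u :: "nat \<Rightarrow> real" by simp
  show ?case unfolding s f g e nz p by (rule h[OF Suc.IH]) auto
qed simp

text \<open>Monotonicity gives a limit B of \<open>stirling_quot m\<close> / sqrt m. Wallis's
  product expressed through the quotients at n and 2 n has the surviving factor n / (2 (2 n + 1)),
  so in the limit B^2 / 4 = pi / 2.\<close>

theorem stirling: "(\<lambda>m. stirling_quot m / sqrt (2 * pi * real m)) \<longlonglongrightarrow> 1"
proof -
  have "decseq stirling_log" using stirling_log_step(1) by (intro decseq_SucI) (simp add: algebra_simps)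
  then obtain c where c: "stirling_log \<longlonglongrightarrow> c"
    using decseq_convergent stirling_log_bounds(1) by blast
  define b where "b m = stirling_quot m / sqrt (real m)" for m
  define B where "B = exp c"
  have "(\<lambda>m. exp (stirling_log m)) \<longlonglongrightarrow> B" unfolding B_def by (intro tendsto_intros c)
  then have "(\<lambda>m. b (Suc m)) \<longlonglongrightarrow> B" by (simp add: b_def stirling_quot_eq_exp)
  then have b: "b \<longlonglongrightarrow> B" by (rule LIMSEQ_imp_Suc)
  have b2: "(\<lambda>n. b (2 * n)) \<longlonglongrightarrow> B"
    by (rule filterlim_compose[OF b]) (simp add: filterlim_subseq strict_mono_def)
  have B0: "B ^ 2 \<noteq> 0" by (simp add: B_def)
  have w: "(\<lambda>n. real n / (2 * real (2 * n + 1))) \<longlonglongrightarrow> 1 / 4" by real_asymp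
  note lim = tendsto_mult[OF tendsto_divide[OF tendsto_power[OF b, of 4] tendsto_power[OF b2, of 2] B0] w]
  have ev: "\<forall>\<^sub>F n in sequentially. b n ^ 4 / b (2 * n) ^ 2 * (real n / (2 * real (2 * n + 1)))
      = (\<Prod>k=1..n. (4*real k^2) / (4*real k^2 - 1))"
    using eventually_gt_at_top[of 0]
  proof eventually_elim
    case (elim n)
    define E where "E = exp (real n * ln (real n) - real n)"
    have "real (2 * n) * ln (real (2 * n)) - real (2 * n)
      = 2 * real n * ln 2 + 2 * (real n * ln (real n) - real n)"
      using elim by (simp add: ln_mult algebra_simps)
    then have "exp (real (2 * n) * ln (real (2 * n)) - real (2 * n)) = exp (ln 2 * real (2 * n)) * E ^ 2"
      unfolding E_def by (simp only: exp_add exp_double of_nat_mult of_nat_numeral mult_ac)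
    also have "exp (ln 2 * real (2 * n)) = 2 ^ (2 * n)"
      using exp_of_nat_mult[of "2 * n" "ln 2 :: real"] by (simp only: mult.commute exp_ln zero_less_numeral)
    finally have E2: "exp (real (2 * n) * ln (real (2 * n)) - real (2 * n)) = 2 ^ (2 * n) * E ^ 2" .
    have Epos: "E > 0" by (simp add: E_def)
    have s4: "sqrt (real n) ^ 4 = real n ^ 2" 
by (simp add: eval_nat_numeral)
    have b1: "b n ^ 4 = fact n ^ 4 / (E ^ 4 * real n ^ 2)"
      by (simp add: b_def stirling_quot_def E_def[symmetric] power_divide s4 power_mult_distrib)
    have b2: "b (2 * n) ^ 2 = fact (2 * n) ^ 2 / ((2 ^ (2 * n) * E ^ 2) ^ 2 * (2 * real n))"
      unfolding b_def stirling_quot_def E2 by (simp add: power_divide power_mult_distrib)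
    have p: "2 ^ (4 * n) = ((2::real) ^ (2 * n))\<^sup>2" by (simp flip: power_mult)
    have alg: "F ^ 4 / (E ^ 4 * x\<^sup>2) / (G\<^sup>2 / ((P * E\<^sup>2)\<^sup>2 * (2 * x))) * (x / (2 * (2 * x + 1)))
        = P\<^sup>2 * F ^ 4 / (G\<^sup>2 * (2 * x + 1))"
      if "x > 0" "G > 0" for F G P x :: real
    proof -
      have "2 * x + 1 > 0" using that by simp
      then show ?thesis using that Epos
        by (simp add: divide_simps power2_eq_square power4_eq_xxxx)
    qed
    have o: "real (2 * n + 1) = 2 * real n + 1" by simp
    show ?case unfolding b1 b2 wallis_product_eq p o by (rule alg) (use elim in auto)
  qed
  have "B ^ 4 / B ^ 2 * (1/4) = pi / 2"
    by (rule LIMSEQ_unique[OF Lim_transform_eventually[OF lim ev] wallis])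
  then have "B ^ 2 = 2 * pi" by (simp add: B_def field_simps power4_eq_xxxx power2_eq_square)
  then have B: "B = sqrt (2 * pi)" by (metis B_def exp_ge_zero real_sqrt_unique)
  have "(\<lambda>m. b m / B) \<longlonglongrightarrow> B / B" by (intro tendsto_intros b) (simp add: B_def)
  moreover have "b m / B = stirling_quot m / sqrt (2 * pi * real m)" for m
    unfolding b_def B real_sqrt_mult by (simp only: divide_divide_eq_left mult.commute)
  ultimately show ?thesis by (simp add: B_def)
qed

section \<open>Gaussian sums over lattices\<close>

text \<open>The integral of exp (- x^2) from 0 to y. The two indicators are kept apart so that its
  limit follows from \<open>gaussian_moment_0\<close> by
  \<open>tendsto_integral_at_top\<close>.\<close>

definition gauss_int :: "real \<Rightarrow> real" where
  "gauss_int y = (\<integral>x. indicator {..y} x *\<^sub>R (indicator {0..} x *\<^sub>R exp (- x\<^sup>2)) \<partial>lborel)"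

lemma gauss_int_integrable: "integrable lborel (\<lambda>x::real. indicator {..y} x *\<^sub>R (indicator {0..} x *\<^sub>R exp (- x\<^sup>2)))"
proof -
  have "integrable lborel (\<lambda>x::real. indicator {0..} x *\<^sub>R exp (- x\<^sup>2))"
    using gaussian_moment_0 by (rule integrable.intros)
  from integrable_mult_indicator[OF _ this, of "{..y}"] show ?thesis by simp
qed

lemma gauss_int_tendsto: "(gauss_int \<longlongrightarrow> sqrt pi / 2) at_top"
proof -
  have "(gauss_int \<longlongrightarrow> (\<integral>x. indicator {0..} x *\<^sub>R exp (- x\<^sup>2) \<partial>lborel)) at_top"
    unfolding gauss_int_def
    by (rule tendsto_integral_at_top) (use gaussian_moment_0 in \<open>auto intro: integrable.intros\<close>)
  then show ?thesis using gaussian_moment_0 by (simp add: has_bochner_integral_integral_eq)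
qed

lemma gauss_int_diff_bounds:
  assumes "0 \<le> a" "a \<le> b"
  shows "(b - a) * exp (- b\<^sup>2) \<le> gauss_int b - gauss_int a"
    and "gauss_int b - gauss_int a \<le> (b - a) * exp (- a\<^sup>2)"
proof -
  have eq: "gauss_int b - gauss_int a
      = (\<integral>x. indicator {..b} x *\<^sub>R (indicator {0..} x *\<^sub>R exp (- x\<^sup>2)) - indicator {..a} x *\<^sub>R (indicator {0..} x *\<^sub>R exp (- x\<^sup>2)) \<partial>lborel)"
    unfolding gauss_int_def by (subst Bochner_Integration.integral_diff) (auto intro!: gauss_int_integrable simp del: scaleR_scaleR real_scaleR_def)
  have c: "(\<integral>x. indicator {a<..b} x *\<^sub>R c \<partial>lborel) = (b - a) * c" "integrable lborel (\<lambda>x. indicator {a<..b} x *\<^sub>R c)" for c :: real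
    using assms by auto
  have int: "integrable lborel (\<lambda>x::real. indicator {..b} x *\<^sub>R (indicator {0..} x *\<^sub>R exp (- x\<^sup>2)) - indicator {..a} x *\<^sub>R (indicator {0..} x *\<^sub>R exp (- x\<^sup>2)))"
    by (intro Bochner_Integration.integrable_diff gauss_int_integrable)
  show "(b - a) * exp (- b\<^sup>2) \<le> gauss_int b - gauss_int a"
    unfolding eq c(1)[symmetric] using assms
    by (intro integral_mono c(2) int) (auto simp: indicator_def power_mono)
  show "gauss_int b - gauss_int a \<le> (b - a) * exp (- a\<^sup>2)"
    unfolding eq c(1)[symmetric] using assms
    by (intro integral_mono c(2) int) (auto simp: indicator_def power_mono)
qed

lemma gauss_int_0: "gauss_int 0 = 0"
proof -
  have "AE x in lborel. x \<noteq> (0::real)" by (rule AE_lborel_singleton)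
  then have "AE x in lborel. indicator {..0} x *\<^sub>R (indicator {0..} x *\<^sub>R exp (- x\<^sup>2)) = (0::real)"
    by eventually_elim (auto simp: indicator_def)
  then show ?thesis unfolding gauss_int_def by (rule integral_eq_zero_AE)
qed

text \<open>Comparison of the decreasing summand with the integral over cells of length h. The lower
  error u is the missing piece from 0 to u h, the upper error 1 is the first term; neither depends
  on h.\<close>

lemma gauss_half_sum:
  fixes h u :: real
  assumes h: "h > 0" and u: "0 \<le> u" "u \<le> 1"
  defines "f \<equiv> \<lambda>m::nat. exp (- ((real m + u) * h)\<^sup>2)"
  shows "summable f" and "sqrt pi / 2 / h - u \<le> suminf f" and "suminf f \<le> sqrt pi / 2 / h + 1"
proof -
  define F where "F m = gauss_int ((real m + u) * h) / h" for m :: nat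
  have st: "f (Suc m) \<le> F (Suc m) - F m" "F (Suc m) - F m \<le> f m" for m
    using gauss_int_diff_bounds[of "(real m + u) * h" "(real (Suc m) + u) * h"] h u
    by (auto simp: F_def f_def field_simps)
  have "filterlim (\<lambda>m. (real m + u) * h) at_top sequentially"
    using h by real_asymp
  from filterlim_compose[OF gauss_int_tendsto this]
  have F: "F \<longlonglongrightarrow> sqrt pi / 2 / h" unfolding F_def using h by (intro tendsto_divide tendsto_const) auto
  have tel: "(\<lambda>m. F (Suc m) - F m) sums (sqrt pi / 2 / h - F 0)" by (rule telescope_sums[OF F])
  have f0: "0 \<le> f m" "f m \<le> 1" for m by (auto simp: f_def)
  have s1: "summable (\<lambda>m. f (Suc m))"
    by (rule summable_comparison_test'[OF sums_summable[OF tel], of 0]) (use st f0 in auto)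
  then show s: "summable f" by (simp only: summable_Suc_iff)
  have F0: "0 \<le> F 0" "F 0 \<le> u" 
  proof -
    have "0 \<le> gauss_int (u * h)" 
      using gauss_int_diff_bounds(1)[of 0 "u * h"] h u by (auto simp: gauss_int_0 intro: order_trans[rotated])
    then show "0 \<le> F 0" using h by (simp add: F_def)
    have "gauss_int (u * h) \<le> u * h"
      using gauss_int_diff_bounds(2)[of 0 "u * h"] h u by (auto simp: gauss_int_0)
    then show "F 0 \<le> u" using h by (simp add: F_def field_simps)
  qed
  have "suminf (\<lambda>m. f (Suc m)) \<le> sqrt pi / 2 / h - F 0"
    using suminf_le[OF st(1) s1 sums_summable[OF tel]] sums_unique[OF tel] by simp
  then show "suminf f \<le> sqrt pi / 2 / h + 1"
    using suminf_split_head[OF s] f0(2)[of 0] F0 by simp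
  show "sqrt pi / 2 / h - u \<le> suminf f"
    using suminf_le[OF st(2) sums_summable[OF tel] s] sums_unique[OF tel] F0 by simp
qed

lemma int_UNIV_split: "(UNIV :: int set) = range int \<union> range (\<lambda>m. - 1 - int m)"
proof -
  have "k \<in> range int \<union> range (\<lambda>m. - 1 - int m)" for k
  proof (cases "k \<ge> 0")
    case True then show ?thesis by (auto intro: range_eqI[of _ _ "nat k"])
  next
    case False then show ?thesis by (auto intro!: range_eqI[of _ _ "nat (- k - 1)"])
  qed
  then show ?thesis by blast
qed

text \<open>The negative integers k = - 1 - m form a half sum with offset 1 - v in place of v. The
  two lower errors v and 1 - v add up to 1, the two upper errors to 2.\<close>

lemma gauss_int_sum_frac:
  fixes h v :: real
  assumes h: "h > 0" and v: "0 \<le> v" "v \<le> 1"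
  defines "f \<equiv> \<lambda>k::int. exp (- ((of_int k + v) * h)\<^sup>2)"
  shows "f summable_on UNIV" and "sqrt pi / h - 1 \<le> infsum f UNIV" and "infsum f UNIV \<le> sqrt pi / h + 2"
proof -
  have A: "(f \<circ> int) = (\<lambda>m. exp (- ((real m + v) * h)\<^sup>2))" by (auto simp: f_def fun_eq_iff)
  have "((of_int (- 1 - int m) + v) * h)\<^sup>2 = ((real m + (1 - v)) * h)\<^sup>2" for m
    by (simp add: power2_eq_square algebra_simps)
  then have B: "(f \<circ> (\<lambda>m. - 1 - int m)) = (\<lambda>m. exp (- ((real m + (1 - v)) * h)\<^sup>2))"
    by (auto simp: f_def fun_eq_iff)
  note a = gauss_half_sum[OF h v]
  have v': "0 \<le> 1 - v" "1 - v \<le> 1" using v by auto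
  note b = gauss_half_sum[OF h v']
  have hs: "(f has_sum suminf (f \<circ> int)) (range int)"
    using sums_nonneg_imp_has_sum[OF summable_sums[OF a(1)]] A
    by (subst has_sum_reindex) (auto simp: inj_on_def)
  have hs2: "(f has_sum suminf (f \<circ> (\<lambda>m. - 1 - int m))) (range (\<lambda>m. - 1 - int m))"
    using sums_nonneg_imp_has_sum[OF summable_sums[OF b(1)]] B
    by (subst has_sum_reindex) (auto simp: inj_on_def)
  have hs3: "(f has_sum (suminf (f \<circ> int) + suminf (f \<circ> (\<lambda>m. - 1 - int m)))) UNIV"
    unfolding int_UNIV_split by (rule has_sum_Un_disjoint[OF hs hs2]) auto
  then show "f summable_on UNIV" by (auto simp: summable_on_def)
  have i: "infsum f UNIV = suminf (f \<circ> int) + suminf (f \<circ> (\<lambda>m. - 1 - int m))" using hs3 by (rule infsumI)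
  have d: "sqrt pi / h = sqrt pi / 2 / h + sqrt pi / 2 / h" by simp
  show "sqrt pi / h - 1 \<le> infsum f UNIV" "infsum f UNIV \<le> sqrt pi / h + 2"
    using a(2,3) b(2,3) unfolding i A B d by linarith+
qed

text \<open>Shifting the index by the integer part of \<open>v\<close> replaces \<open>v\<close> by
  its fractional part, so the errors - 1 and 2 hold for every real shift. The step length is h =
  sqrt (a / (2 s)).\<close>

lemma gauss_int_sum:
  fixes a s v :: real
  assumes a: "a > 0" and s: "s > 0"
  defines "f \<equiv> \<lambda>k::int. exp (- (a * (of_int k + v)\<^sup>2) / (2 * s))"
  shows "f summable_on UNIV" and "sqrt (2 * pi * s / a) - 1 \<le> infsum f UNIV"
    and "infsum f UNIV \<le> sqrt (2 * pi * s / a) + 2"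
proof -
  define h where "h = sqrt (a / (2 * s))"
  have h: "h > 0" using a s by (simp add: h_def)
  define g where "g = (\<lambda>k::int. exp (- ((of_int k + frac v) * h)\<^sup>2))"
  have fg: "f = g \<circ> (\<lambda>k. k + \<lfloor>v\<rfloor>)"
  proof
    fix k
    have "h\<^sup>2 = a / (2 * s)" using a s by (simp add: h_def)
    moreover have "of_int (k + \<lfloor>v\<rfloor>) + frac v = of_int k + v" by (simp add: frac_def)
    ultimately show "f k = (g \<circ> (\<lambda>k. k + \<lfloor>v\<rfloor>)) k"
      unfolding f_def g_def o_def by (simp only: power_mult_distrib) simp
  qed
  have inj: "inj (\<lambda>k::int. k + \<lfloor>v\<rfloor>)" by (auto simp: inj_on_def)
  have rg: "range (\<lambda>k::int. k + \<lfloor>v\<rfloor>) = UNIV" by (rule surjI[of _ "\<lambda>k. k - \<lfloor>v\<rfloor>"]) auto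
  have d: "sqrt (2 * pi * s / a) = sqrt pi / h" using a s unfolding h_def by (simp add: real_sqrt_divide[symmetric] flip: real_sqrt_mult)
  note fr = gauss_int_sum_frac[OF h frac_ge_0 less_imp_le[OF frac_lt_1], of v, folded g_def]
  have i: "infsum f UNIV = infsum g UNIV" using infsum_reindex[OF inj, of g] unfolding fg rg by simp
  show "f summable_on UNIV" using summable_on_reindex[OF inj, of g] fr(1) unfolding fg rg by simp
  show "sqrt (2 * pi * s / a) - 1 \<le> infsum f UNIV" "infsum f UNIV \<le> sqrt (2 * pi * s / a) + 2"
    unfolding i d using fr(2,3) by auto
qed

section \<open>Determinants of bilinear forms and orthogonalisation\<close>

lemma bilinear_sum_sum:
  fixes B :: "'a::real_vector \<Rightarrow> 'a \<Rightarrow> real"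
  assumes "bilinear B"
  shows "B (\<Sum>i\<in>I. c i *\<^sub>R x i) (\<Sum>j\<in>J. d j *\<^sub>R y j) = (\<Sum>i\<in>I. \<Sum>j\<in>J. c i * d j * B (x i) (y j))"
proof -
  have l: "linear (\<lambda>x. B x z)" and r: "linear (B z)" for z using assms by (auto simp: bilinear_def)
  show ?thesis
    by (subst sum.swap)
      (simp add: linear_sum[OF l] linear_cmul[OF l] linear_sum[OF r] linear_cmul[OF r] sum_distrib_left mult_ac)
qed

text \<open>The matrix of a form transforms as P G P^T. All forms pick up the same factor det(P)^2,
  so the quotient in \<open>det_on\<close> is independent of the basis.\<close>

lemma form_det_change_basis:
  fixes B :: "'a::real_vector \<Rightarrow> 'a \<Rightarrow> real"
  assumes B: "bilinear B" and len: "length zs = m" "length ws = m"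
    and zs: "\<And>k. k < m \<Longrightarrow> zs ! k = (\<Sum>l<m. P k l *\<^sub>R ws ! l)"
  shows "form_det B zs = (Determinant.det (mat m m (\<lambda>(k, l). P k l)))\<^sup>2 * form_det B ws"
proof -
  define Q where "Q = mat m m (\<lambda>(k, l). P k l)"
  define G where "G = mat m m (\<lambda>(k, l). B (ws ! k) (ws ! l))"
  have c: "Q \<in> carrier_mat m m" "G \<in> carrier_mat m m" by (auto simp: Q_def G_def)
  have "mat m m (\<lambda>(k, l). B (zs ! k) (zs ! l)) = Q * G * Q\<^sup>T"
  proof (rule eq_matI)
    fix k l assume "k < dim_row (Q * G * Q\<^sup>T)" "l < dim_col (Q * G * Q\<^sup>T)"
    then have kl: "k < m" "l < m" by (auto simp: Q_def)
    have "(Q * G * Q\<^sup>T) $$ (k, l) = (\<Sum>j<m. (\<Sum>i<m. P k i * B (ws ! i) (ws ! j)) * P l j)"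
      using kl by (simp add: scalar_prod_def Q_def G_def atLeast0LessThan)
    also have "\<dots> = (\<Sum>i<m. \<Sum>j<m. P k i * P l j * B (ws ! i) (ws ! j))"
      by (subst sum.swap) (simp add: sum_distrib_right sum_distrib_left mult_ac)
    also have "\<dots> = B (zs ! k) (zs ! l)"
      using kl by (simp add: zs bilinear_sum_sum[OF B])
    finally show "mat m m (\<lambda>(k, l). B (zs ! k) (zs ! l)) $$ (k, l) = (Q * G * Q\<^sup>T) $$ (k, l)"
      using kl by simp
  qed (auto simp: Q_def)
  then have "form_det B zs = Determinant.det (Q * G * Q\<^sup>T)" by (simp add: form_det_def len)
  also have "\<dots> = Determinant.det Q * Determinant.det G * Determinant.det Q"
    using c by (simp add: det_mult[of _ m] det_transpose)
  also have "Determinant.det G = form_det B ws" by (simp add: form_det_def len G_def)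
  finally show ?thesis by (simp add: Q_def power2_eq_square)
qed

lemma form_det_Nil [simp]: "form_det B [] = 1"
  by (simp add: form_det_def)

lemma form_det_Cons_orthogonal:
  assumes "\<And>y. y \<in> set bs \<Longrightarrow> B b y = 0" "\<And>y. y \<in> set bs \<Longrightarrow> B y b = 0"
  shows "form_det B (b # bs) = B b b * form_det B bs"
proof -
  define m where "m = length bs"
  define G where "G = mat m m (\<lambda>(k, l). B (bs ! k) (bs ! l))"
  have "mat (Suc m) (Suc m) (\<lambda>(k, l). B ((b # bs) ! k) ((b # bs) ! l))
     = four_block_mat (mat 1 1 (\<lambda>_. B b b)) (0\<^sub>m 1 m) (0\<^sub>m m 1) G"
    by (rule eq_matI) (auto simp: G_def m_def nth_Cons' assms)
  then have "form_det B (b # bs) = Determinant.det (four_block_mat (mat 1 1 (\<lambda>_. B b b)) (0\<^sub>m 1 m) (0\<^sub>m m 1) G)"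
    by (simp add: form_det_def m_def)
  also have "\<dots> = Determinant.det (mat 1 1 (\<lambda>_. B b b)) * Determinant.det G"
    by (rule det_four_block_mat_lower_left_zero) (auto simp: G_def)
  also have "Determinant.det (mat 1 1 (\<lambda>_. B b b)) = B b b" by (subst det_single) auto
  finally show ?thesis by (simp add: G_def form_det_def m_def)
qed

lemma span_set_sum:
  assumes "p \<in> span (set bs)"
  obtains c where "p = (\<Sum>l<length bs. c l *\<^sub>R bs ! l)"
proof -
  have "\<exists>c. p = (\<Sum>l<length bs. c l *\<^sub>R bs ! l)"
    using assms
  proof (induction bs arbitrary: p)
    case (Cons b bs)
    from Cons.prems obtain k where "p - k *\<^sub>R b \<in> span (set bs)" by (auto simp: span_insert)
    with Cons.IH obtain c where c: "p - k *\<^sub>R b = (\<Sum>l<length bs. c l *\<^sub>R bs ! l)" by blast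
    have "p = (\<Sum>l<length (b # bs). (case l of 0 \<Rightarrow> k | Suc i \<Rightarrow> c i) *\<^sub>R (b # bs) ! l)"
      using c by (simp add: sum.lessThan_Suc_shift algebra_simps del: sum.lessThan_Suc)
    then show ?case by blast
  qed simp
  then show ?thesis using that by blast
qed

text \<open>The passage from b to b - p is unitriangular. With p the projection of b on the span of
  the rest, this and \<open>form_det_Cons_orthogonal\<close> are one step of Gram-Schmidt and split
  off a factor from the determinant.\<close>

lemma form_det_Cons_shift:
  fixes B :: "'a::real_vector \<Rightarrow> 'a \<Rightarrow> real"
  assumes B: "bilinear B" and p: "p \<in> span (set bs)"
  shows "form_det B ((b - p) # bs) = form_det B (b # bs)"
proof -
  from p obtain c where c: "p = (\<Sum>l<length bs. c l *\<^sub>R bs ! l)" by (rule span_set_sum)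
  define m where "m = length bs"
  \<comment> \<open>The identity matrix with first row (1, - c 0, - c 1, ...); the index is l - 1
    because position 0 holds b.\<close>
  define P where "P k l = (if k = l then 1 else if k = 0 then - c (l - 1) else 0 :: real)" for k l :: nat
  have eq: "((b - p) # bs) ! k = (\<Sum>l<Suc m. P k l *\<^sub>R (b # bs) ! l)" if "k < Suc m" for k
  proof (cases k)
    case 0
    then show ?thesis unfolding sum.lessThan_Suc_shift by (simp add: P_def c m_def sum_negf)
  next
    case (Suc i)
    have "(\<Sum>l<Suc m. P k l *\<^sub>R (b # bs) ! l) = (\<Sum>l<Suc m. if l = k then (b # bs) ! l else 0)"
      by (rule sum.cong) (auto simp: P_def Suc)
    also have "\<dots> = (b # bs) ! k" using that by simp
    finally show ?thesis using Suc by simp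
  qed
  have "Determinant.det (mat (Suc m) (Suc m) (\<lambda>(k, l). P k l)) = prod_list (diag_mat (mat (Suc m) (Suc m) (\<lambda>(k, l). P k l)))"
    by (rule det_upper_triangular[of _ "Suc m"]) (auto simp: P_def)
  also have "diag_mat (mat (Suc m) (Suc m) (\<lambda>(k, l). P k l)) = replicate (Suc m) 1"
    by (rule nth_equalityI) (auto simp: diag_mat_def P_def simp del: upt_Suc replicate_Suc)
  finally have d: "Determinant.det (mat (Suc m) (Suc m) (\<lambda>(k, l). P k l)) = 1" by simp
  have l: "length ((b - p) # bs) = Suc m" "length (b # bs) = Suc m" by (auto simp: m_def)
  show ?thesis by (subst form_det_change_basis[OF B l eq]) (simp_all add: d del: sum.lessThan_Suc)
qed

text \<open>Gram-Schmidt with respect to \<open>B\<close>, which is definite on the span only. The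
  new vector b is replaced by its part e orthogonal to the span of \<open>bs\<close>, and the
  component of x along e is added to the projection of x on that span.\<close>

lemma orthogonal_projection_exists:
  fixes B :: "'a::real_vector \<Rightarrow> 'a \<Rightarrow> real"
  assumes B: "bilinear B" and sym: "\<And>x y. B x y = B y x"
    and pd: "\<And>x. x \<in> span (set bs) \<Longrightarrow> x \<noteq> 0 \<Longrightarrow> B x x > 0"
  shows "\<exists>p\<in>span (set bs). \<forall>y\<in>span (set bs). B (x - p) y = 0"
  using pd
proof (induction bs arbitrary: x)
  case Nil
  then show ?case using B by (auto simp: bilinear_rzero)
next
  case (Cons b bs)
  have IH: "\<exists>p\<in>span (set bs). \<forall>y\<in>span (set bs). B (x - p) y = 0" for x
    by (rule Cons.IH) (use Cons.prems span_mono[of "set bs" "set (b # bs)"] in auto)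
  from IH[of b] obtain p where p: "p \<in> span (set bs)" "\<And>y. y \<in> span (set bs) \<Longrightarrow> B (b - p) y = 0" by blast
  from IH[of x] obtain q where q: "q \<in> span (set bs)" "\<And>y. y \<in> span (set bs) \<Longrightarrow> B (x - q) y = 0" by blast
  define e where "e = b - p"
  \<comment> \<open>If b lies in the span of \<open>bs\<close>, then e can be 0; division by zero
    then gives t = 0, which is the right coefficient.\<close>
  define t where "t = B x e / B e e"
  have sub: "span (set bs) \<subseteq> span (set (b # bs))" by (rule span_mono) auto
  have e: "e \<in> span (set (b # bs))" unfolding e_def using p(1) sub by (intro span_diff) (auto simp: span_base)
  have ee: "e \<noteq> 0 \<Longrightarrow> B e e \<noteq> 0" using Cons.prems[OF e] by force
  have l: "B (u + v) w = B u w + B v w" "B (u - v) w = B u w - B v w" "B (c *\<^sub>R u) w = c * B u w"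
    "B w (u + v) = B w u + B w v" "B w (u - v) = B w u - B w v" "B w (c *\<^sub>R u) = c * B w u" for u v w c
    using B by (auto simp: bilinear_ladd bilinear_lsub bilinear_lmul bilinear_radd bilinear_rsub bilinear_rmul)
  show ?case
  proof (intro bexI[of _ "q + t *\<^sub>R e"] ballI)
    show "q + t *\<^sub>R e \<in> span (set (b # bs))" using e q(1) sub by (auto intro!: span_add span_mul)
    fix y assume "y \<in> span (set (b # bs))"
    then obtain k where "y - k *\<^sub>R b \<in> span (set bs)" by (auto simp: span_insert)
    moreover define w where "w = y - k *\<^sub>R b + k *\<^sub>R p"
    ultimately have w: "w \<in> span (set bs)" using p(1) by (auto intro!: span_add span_mul)
    have y: "y = w + k *\<^sub>R e" by (simp add: w_def e_def algebra_simps)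
    have 1: "B (x - q) w = 0" using q w by auto
    have 2: "B e w = 0" using p w by (auto simp: e_def)
    have 3: "B q e = 0" using p q(1) sym[of q] by (auto simp: e_def)
    have "k * B x e - k * t * B e e = 0"
    proof (cases "e = 0")
      case True then show ?thesis using B by (simp add: bilinear_rzero)
    next
      case False then show ?thesis using ee by (simp add: t_def)
    qed
    then show "B (x - (q + t *\<^sub>R e)) y = 0"
      using 1 2 3 sym[of w e] unfolding y l by (simp add: algebra_simps)
  qed
qed

text \<open>The lattice of \<open>lattice_basis\<close> in recursive form, so that a sum over it can
  be unfolded one basis vector at a time.\<close>

primrec lattice_span :: "'a::real_vector list \<Rightarrow> 'a set" where
  "lattice_span [] = {0}"
| "lattice_span (b # bs) = (\<lambda>(k, y). of_int k *\<^sub>R b + y) ` ((UNIV :: int set) \<times> lattice_span bs)"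

lemma lattice_span_eq: "lattice_span bs = {\<Sum>k<length bs. of_int (c k) *\<^sub>R bs ! k | c :: nat \<Rightarrow> int. True}"
proof (induction bs)
  case (Cons b bs)
  show ?case
  proof (intro equalityI subsetI)
    fix x assume "x \<in> lattice_span (b # bs)"
    then obtain k c where x: "x = of_int k *\<^sub>R b + (\<Sum>k<length bs. of_int (c k) *\<^sub>R bs ! k)"
      by (auto simp: Cons.IH)
    show "x \<in> {\<Sum>k<length (b # bs). of_int (c k) *\<^sub>R (b # bs) ! k | c :: nat \<Rightarrow> int. True}"
      by (intro CollectI exI[of _ "\<lambda>l. case l of 0 \<Rightarrow> k | Suc i \<Rightarrow> c i"] conjI TrueI)
        (simp add: x sum.lessThan_Suc_shift del: sum.lessThan_Suc)
  next
    fix x assume "x \<in> {\<Sum>k<length (b # bs). of_int (c k) *\<^sub>R (b # bs) ! k | c :: nat \<Rightarrow> int. True}"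
    then obtain c :: "nat \<Rightarrow> int" where "x = (\<Sum>k<length (b # bs). of_int (c k) *\<^sub>R (b # bs) ! k)" by blast
    then have "x = of_int (c 0) *\<^sub>R b + (\<Sum>k<length bs. of_int (c (Suc k)) *\<^sub>R bs ! k)"
      by (simp add: sum.lessThan_Suc_shift del: sum.lessThan_Suc)
    then show "x \<in> lattice_span (b # bs)" 
      by (auto simp: Cons.IH intro!: image_eqI[of _ _ "(c 0, \<Sum>k<length bs. of_int (c (Suc k)) *\<^sub>R bs ! k)"] exI[of _ "\<lambda>k. c (Suc k)"])
  qed
qed auto

lemma lattice_span_subset_span: "lattice_span bs \<subseteq> span (set bs)"
  unfolding lattice_span_eq by (auto intro!: span_sum span_mul intro: span_base)

lemma set_subset_lattice_span: "set bs \<subseteq> lattice_span bs"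
proof
  fix y assume "y \<in> set bs"
  then obtain l where l: "l < length bs" "y = bs ! l" by (auto simp: in_set_conv_nth)
  have "y = (\<Sum>k<length bs. of_int (if k = l then 1 else 0) *\<^sub>R bs ! k)"
    using l by (simp add: if_distrib[of "\<lambda>c. c *\<^sub>R _"] if_distrib[of of_int] cong: if_cong)
  then show "y \<in> lattice_span bs" unfolding lattice_span_eq
    by (intro CollectI exI[of _ "\<lambda>k. if k = l then 1 else 0 :: int"] conjI TrueI)
qed

text \<open>Each basis vector is split into its \<open>B\<close>-projection on the span of the remaining ones and a
  \<open>B\<close>-orthogonal part of square length \<open>a\<close>. Summing over its multiples contributes a one-dimensional
  Gaussian sum, which differs from \<open>sqrt (2 * pi * s / a)\<close> by a bounded amount.\<close>

theorem gaussian_lattice_sum: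
  fixes B :: "'a::real_vector \<Rightarrow> 'a \<Rightarrow> real"
  assumes B: "bilinear B" and sym: "\<And>x y. B x y = B y x"
    and ind: "distinct bs" "independent (set bs)"
    and pd: "\<And>x. x \<in> span (set bs) \<Longrightarrow> x \<noteq> 0 \<Longrightarrow> B x x > 0"
  defines "f \<equiv> \<lambda>s v y. exp (- B (v + y) (v + y) / (2 * s))"
  shows "\<exists>as. length as = length bs \<and> (\<forall>a\<in>set as. a > 0) \<and> form_det B bs = prod_list as \<and>
    (\<forall>s>0. \<forall>v\<in>span (set bs). f s v summable_on lattice_span bs \<and>
       infsum (f s v) (lattice_span bs) \<le> (\<Prod>a\<leftarrow>as. sqrt (2 * pi * s / a) + 2) \<and>
       (\<Prod>a\<leftarrow>as. max 0 (sqrt (2 * pi * s / a) - 1)) \<le> infsum (f s v) (lattice_span bs))"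
  using ind pd
proof (induction bs)
  case Nil
  then show ?case using B by (auto simp: f_def bilinear_lzero)
next
  case (Cons b bs)
  have sub: "span (set bs) \<subseteq> span (set (b # bs))" by (rule span_mono) auto
  have nb: "b \<notin> span (set bs)" using Cons.prems(1,2) by (simp add: independent_insert)
  have pd': "x \<in> span (set bs) \<Longrightarrow> x \<noteq> 0 \<Longrightarrow> B x x > 0" for x using Cons.prems(3) sub by blast
  have "\<exists>as. length as = length bs \<and> (\<forall>a\<in>set as. a > 0) \<and> form_det B bs = prod_list as \<and>
    (\<forall>s>0. \<forall>v\<in>span (set bs). f s v summable_on lattice_span bs \<and>
       infsum (f s v) (lattice_span bs) \<le> (\<Prod>a\<leftarrow>as. sqrt (2 * pi * s / a) + 2) \<and>
       (\<Prod>a\<leftarrow>as. max 0 (sqrt (2 * pi * s / a) - 1)) \<le> infsum (f s v) (lattice_span bs))"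
    by (rule Cons.IH) (use Cons.prems pd' in \<open>auto simp: independent_insert\<close>)
  then obtain as where as: "length as = length bs" "\<And>a. a\<in>set as \<Longrightarrow> a > 0" "form_det B bs = prod_list as"
    and IH: "\<And>s v. s > 0 \<Longrightarrow> v \<in> span (set bs) \<Longrightarrow> f s v summable_on lattice_span bs"
      "\<And>s v. s > 0 \<Longrightarrow> v \<in> span (set bs) \<Longrightarrow> infsum (f s v) (lattice_span bs) \<le> (\<Prod>a\<leftarrow>as. sqrt (2 * pi * s / a) + 2)"
      "\<And>s v. s > 0 \<Longrightarrow> v \<in> span (set bs) \<Longrightarrow> (\<Prod>a\<leftarrow>as. max 0 (sqrt (2 * pi * s / a) - 1)) \<le> infsum (f s v) (lattice_span bs)"
    by blast
  obtain p where p: "p \<in> span (set bs)" and orth: "\<And>y. y \<in> span (set bs) \<Longrightarrow> B (b - p) y = 0"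
    using orthogonal_projection_exists[of B bs b] B sym pd' by blast
  define e where "e = b - p"
  define a where "a = B e e"
  have "e \<in> span (set (b # bs))" unfolding e_def using p sub by (intro span_diff) (auto simp: span_base)
  moreover have "e \<noteq> 0" using p nb by (auto simp: e_def)
  ultimately have a: "a > 0" using Cons.prems(3) unfolding a_def by blast
  have det: "form_det B (b # bs) = a * prod_list as"
    using form_det_Cons_shift[OF B p, of b] form_det_Cons_orthogonal[of bs B e] orth sym as(3)
    by (simp add: e_def a_def span_base)
  have l: "B (u + v) w = B u w + B v w" "B (c *\<^sub>R u) w = c * B u w"
    "B w (u + v) = B w u + B w v" "B w (c *\<^sub>R u) = c * B w u" for u v w c
    using B by (auto simp: bilinear_ladd bilinear_lmul bilinear_radd bilinear_rmul)
  have inj: "inj_on (\<lambda>(k, y). of_int k *\<^sub>R b + y) ((UNIV :: int set) \<times> lattice_span bs)"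
  proof (rule inj_onI, clarsimp, goal_cases)
    case (1 k y k' y')
    have "of_int (k - k') *\<^sub>R b = y' - y" using 1 by (simp add: algebra_simps)
    moreover have "y' - y \<in> span (set bs)" using 1 lattice_span_subset_span by (blast intro: span_diff)
    ultimately have m: "of_int (k - k') *\<^sub>R b \<in> span (set bs)" by simp
    have "k = k'"
    proof (rule ccontr)
      assume "k \<noteq> k'"
      then have "inverse (of_int (k - k')) *\<^sub>R of_int (k - k') *\<^sub>R b = b"
        by (simp del: of_int_diff)
      with span_mul[OF m, of "inverse (of_int (k - k'))"] nb show False by simp
    qed
    then show ?case using 1 by simp
  qed
  {
    fix s :: real and v assume s: "s > 0" and v: "v \<in> span (set (b # bs))"
    then obtain \<beta> where \<beta>: "v - \<beta> *\<^sub>R b \<in> span (set bs)" by (auto simp: span_insert)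
    \<comment> \<open>Chosen so that v + k b + y = (k + \<beta>) e + (w k + y) with w k + y in the
      span of \<open>bs\<close>, hence orthogonal to e. The shift \<open>w k\<close> depends on k,
      which is why the induction needs bounds uniform in the shift.\<close>
    define w where "w k = v - \<beta> *\<^sub>R b + (of_int k + \<beta>) *\<^sub>R p" for k :: int
    have w: "w k \<in> span (set bs)" for k unfolding w_def using \<beta> p by (intro span_add span_mul)
    define g where "g k = exp (- (a * (of_int k + \<beta>)\<^sup>2) / (2 * s))" for k :: int
    have split: "f s v (of_int k *\<^sub>R b + y) = g k * f s (w k) y" if "y \<in> lattice_span bs" for k y
    proof -
      have y: "y \<in> span (set bs)" using that lattice_span_subset_span by blast
      define t where "t = of_int k + \<beta>"
      define z where "z = w k + y"
      have eq: "v + (of_int k *\<^sub>R b + y) = t *\<^sub>R e + z"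
        by (simp add: w_def t_def e_def z_def algebra_simps)
      have "B e z = 0" using orth w y by (auto simp: e_def z_def intro!: span_add)
      then have "B (v + (of_int k *\<^sub>R b + y)) (v + (of_int k *\<^sub>R b + y)) = a * t\<^sup>2 + B z z"
        using sym[of e z] unfolding eq by (simp add: l a_def power2_eq_square)
      then show ?thesis unfolding f_def g_def t_def[symmetric] z_def
        by (simp add: add_divide_distrib diff_divide_distrib flip: exp_add)
    qed
    note G = gauss_int_sum[OF a s, of \<beta>, folded g_def]
    define I where "I k = infsum (f s (w k)) (lattice_span bs)" for k
    define U where "U = (\<Prod>a\<leftarrow>as. sqrt (2 * pi * s / a) + 2)"
    \<comment> \<open>The truncation at 0 keeps the lower bounds nonnegative, so that they may be
      multiplied.\<close>
    define L where "L = (\<Prod>a\<leftarrow>as. max 0 (sqrt (2 * pi * s / a) - 1))"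
    have L0: "L \<ge> 0" unfolding L_def by (rule prod_list_nonneg) auto
    have I: "L \<le> I k" "I k \<le> U" for k using IH[OF s w] by (auto simp: I_def L_def U_def)
    have U0: "U \<ge> 0" using L0 I(1)[of 0] I(2)[of 0] by linarith
    have g0: "g k \<ge> 0" for k by (simp add: g_def)
    define h where "h = (\<lambda>(k, y). g k * f s (w k) y)"
    have hs: "((\<lambda>y. h (k, y)) has_sum g k * I k) (lattice_span bs)" for k
      unfolding h_def I_def using has_sum_cmult_right[OF has_sum_infsum[OF IH(1)[OF s w]]] by simp
    have gI: "(\<lambda>k. g k * I k) summable_on UNIV"
    proof (rule summable_on_comparison_test)
      show "(\<lambda>k. g k * U) summable_on UNIV" using G(1) by (rule summable_on_cmult_left)
      show "\<And>k. g k * I k \<le> g k * U" using g0 I by (intro mult_left_mono) auto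
      show "\<And>k. 0 \<le> g k * I k" using g0 I(1) L0 by (meson mult_nonneg_nonneg order_trans)
    qed
    have hsum: "h summable_on (UNIV \<times> lattice_span bs)"
      by (rule summable_on_SigmaI[OF hs gI]) (auto simp: h_def g0 f_def)
    have hinf: "infsum h (UNIV \<times> lattice_span bs) = infsum (\<lambda>k. g k * I k) UNIV"
      using has_sum_SigmaI[OF hs has_sum_infsum[OF gI] hsum] by (rule infsumI)
    have fh: "(f s v \<circ> (\<lambda>(k, y). of_int k *\<^sub>R b + y)) x = h x" if "x \<in> UNIV \<times> lattice_span bs" for x
      using that split by (auto simp: h_def)
    have "f s v summable_on lattice_span (b # bs)"
      unfolding lattice_span.simps summable_on_reindex[OF inj]
      by (subst summable_on_cong[OF fh]) (auto intro: hsum)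
    moreover have inf: "infsum (f s v) (lattice_span (b # bs)) = infsum (\<lambda>k. g k * I k) UNIV"
      unfolding lattice_span.simps infsum_reindex[OF inj] hinf[symmetric]
      by (rule infsum_cong) (rule fh)
    moreover have "infsum (\<lambda>k. g k * I k) UNIV \<le> (sqrt (2 * pi * s / a) + 2) * U"
    proof -
      have "infsum (\<lambda>k. g k * I k) UNIV \<le> infsum (\<lambda>k. g k * U) UNIV"
        using G(1) g0 I by (intro infsum_mono gI summable_on_cmult_left mult_left_mono) auto
      also have "\<dots> = infsum g UNIV * U" by (rule infsum_cmult_left) (rule G(1))
      also have "\<dots> \<le> (sqrt (2 * pi * s / a) + 2) * U" using G(3) U0 by (rule mult_right_mono)
      finally show ?thesis .
    qed
    moreover have "max 0 (sqrt (2 * pi * s / a) - 1) * L \<le> infsum (\<lambda>k. g k * I k) UNIV"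
    proof -
      have "max 0 (sqrt (2 * pi * s / a) - 1) \<le> infsum g UNIV"
        using G(2) infsum_nonneg[of UNIV g] g0 by auto
      then have "max 0 (sqrt (2 * pi * s / a) - 1) * L \<le> infsum g UNIV * L" using L0 by (rule mult_right_mono)
      also have "\<dots> = infsum (\<lambda>k. g k * L) UNIV" by (rule infsum_cmult_left[symmetric]) (rule G(1))
      also have "\<dots> \<le> infsum (\<lambda>k. g k * I k) UNIV"
        using G(1) g0 I by (intro infsum_mono gI summable_on_cmult_left mult_left_mono) auto
      finally show ?thesis .
    qed
    ultimately have "f s v summable_on lattice_span (b # bs)"
      "infsum (f s v) (lattice_span (b # bs)) \<le> (\<Prod>a\<leftarrow>a # as. sqrt (2 * pi * s / a) + 2)"
      "(\<Prod>a\<leftarrow>a # as. max 0 (sqrt (2 * pi * s / a) - 1)) \<le> infsum (f s v) (lattice_span (b # bs))"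
      by (simp_all add: U_def L_def)
  }
  then show ?case
    by (intro exI[of _ "a # as"]) (use as a det in auto)
qed

no_notation scalar_prod (infix "\<bullet>" 70)

section \<open>Integer points of rational subspaces\<close>

text \<open>Induction on the number of integer-valued functionals that separate points of L. The
  kernel of one functional in L has a basis by induction; if it is not all of L, an element on which
  the functional takes its least positive value m is adjoined.\<close>

lemma integer_lattice_basis_aux:
  fixes \<phi> :: "'i \<Rightarrow> 'a::real_vector \<Rightarrow> real"
  assumes "finite J" and "\<And>j. linear (\<phi> j)"
    and "0 \<in> L" and "\<And>x y. x \<in> L \<Longrightarrow> y \<in> L \<Longrightarrow> x - y \<in> L"
    and "\<And>x j. x \<in> L \<Longrightarrow> j \<in> J \<Longrightarrow> \<phi> j x \<in> \<int>"
    and "\<And>x. x \<in> L \<Longrightarrow> (\<And>j. j \<in> J \<Longrightarrow> \<phi> j x = 0) \<Longrightarrow> x = 0"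
  shows "\<exists>bs. distinct bs \<and> independent (set bs) \<and> L = lattice_span bs"
  using assms
proof (induction J arbitrary: L rule: finite_induct)
  case empty
  then have "L = {0}" by auto
  then show ?case by (intro exI[of _ "[]"]) (auto simp: independent_empty)
next
  case (insert j J)
  note lin = insert.prems(1)
  have sc: "of_int k *\<^sub>R x \<in> L" if "x \<in> L" for k x
  proof -
    have neg: "- y \<in> L" if "y \<in> L" for y using insert.prems(3)[OF insert.prems(2) that] by simp
    have nat: "of_nat m *\<^sub>R x \<in> L" for m :: nat
    proof (induction m)
      case (Suc m)
      have "of_nat m *\<^sub>R x - (- x) \<in> L" using Suc neg that insert.prems(3) by blast
      then show ?case by (simp add: algebra_simps)
    qed (use insert.prems in simp)
    show ?thesis using nat[of "nat \<bar>k\<bar>"] neg[OF nat[of "nat \<bar>k\<bar>"]] by (cases "k \<ge> 0") auto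
  qed
  define L' where "L' = {x \<in> L. \<phi> j x = 0}"
  have "\<exists>bs. distinct bs \<and> independent (set bs) \<and> L' = lattice_span bs"
  proof (rule insert.IH)
    show "x = 0" if "x \<in> L'" "\<And>j. j \<in> J \<Longrightarrow> \<phi> j x = 0" for x
      using insert.prems(5)[of x] that by (auto simp: L'_def)
  qed (use insert.prems in \<open>auto simp: L'_def linear_0 linear_diff\<close>)
  then obtain bs where bs: "distinct bs" "independent (set bs)" "L' = lattice_span bs" by blast
  show ?case
  proof (cases "L = L'")
    case True then show ?thesis using bs by blast
  next
    case False
    then obtain x0 where x0: "x0 \<in> L" "\<phi> j x0 \<noteq> 0" by (auto simp: L'_def)
    define N where "N = {m::nat. m > 0 \<and> (\<exists>x\<in>L. \<phi> j x = real m)}"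
    have "N \<noteq> {}"
    proof -
      obtain k where k: "\<phi> j x0 = of_int k" using insert.prems(4)[OF x0(1)] by (auto elim: Ints_cases)
      have "\<phi> j (of_int (sgn k) *\<^sub>R x0) = real (nat \<bar>k\<bar>)"
        unfolding linear_cmul[OF lin] k by (cases "k \<ge> 0") (auto simp: sgn_if)
      then have "nat \<bar>k\<bar> \<in> N" using sc[OF x0(1), of "sgn k"] x0(2) k by (auto simp: N_def)
      then show ?thesis by blast
    qed
    define m where "m = (LEAST m. m \<in> N)"
    have mN: "m \<in> N" and mle: "\<And>m'. m' \<in> N \<Longrightarrow> m \<le> m'"
      using \<open>N \<noteq> {}\<close> LeastI_ex[of "\<lambda>m. m \<in> N"] Least_le[of "\<lambda>m. m \<in> N"] by (auto simp: m_def)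
    then obtain b where b: "b \<in> L" "\<phi> j b = real m" "m > 0" by (auto simp: N_def)
    have "\<phi> j y = 0" if "y \<in> span (set bs)" for y
    proof -
      have "set bs \<subseteq> L'" unfolding bs(3) by (rule set_subset_lattice_span)
      then have "set bs \<subseteq> {y. \<phi> j y = 0}" by (auto simp: L'_def)
      moreover have "subspace {y. \<phi> j y = 0}" using lin by (rule linear_subspace_kernel)
      ultimately show ?thesis using that span_minimal by blast
    qed
    then have nb: "b \<notin> span (set bs)" using b by auto
    have "L = lattice_span (b # bs)"
    proof (intro equalityI subsetI)
      fix x assume x: "x \<in> L"
      obtain k where k: "\<phi> j x = of_int k" using insert.prems(4)[OF x] by (auto elim: Ints_cases)
      \<comment> \<open>Division with remainder: the functional takes the value k mod m at
        \<open>y\<close>, and minimality of m forces it to be 0.\<close>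
      define y where "y = x - of_int (k div int m) *\<^sub>R b"
      have y: "y \<in> L" unfolding y_def using x b sc insert.prems(3) by blast
      have "\<phi> j y = \<phi> j x - of_int (k div int m) * \<phi> j b"
        by (simp only: y_def linear_diff[OF lin] linear_cmul[OF lin] real_scaleR_def)
      moreover have "of_int (k div int m * int m + k mod int m) = real_of_int k"
        by (simp only: div_mult_mod_eq)
      then have "of_int (k div int m) * real m + of_int (k mod int m) = real_of_int k"
        by (simp only: of_int_add of_int_mult of_int_of_nat_eq)
      then have "real_of_int k - of_int (k div int m) * real m = of_int (k mod int m)"
        by (simp only: diff_eq_eq add.commute)
      ultimately have py: "\<phi> j y = of_int (k mod int m)" by (simp only: b(2) k)
      have "k mod int m = 0"
      proof (rule ccontr)
        assume "k mod int m \<noteq> 0"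
        moreover define t where "t = k mod int m"
        moreover have t: "0 \<le> t" "t < int m" unfolding t_def using b(3) by (auto intro: pos_mod_sign pos_mod_bound)
        ultimately have "t > 0" by simp
        have "\<phi> j y = real (nat t)" using t(1) py by (simp add: t_def[symmetric])
        with \<open>t > 0\<close> y have "nat t \<in> N" unfolding N_def by (intro CollectI conjI bexI[of _ y]) auto
        from mle[OF this] show False using t by linarith
      qed
      then have "y \<in> lattice_span bs" using y py by (simp add: L'_def flip: bs(3))
      then show "x \<in> lattice_span (b # bs)"
        by (auto simp: y_def intro!: image_eqI[of _ _ "(k div int m, y)"])
    next
      fix x assume "x \<in> lattice_span (b # bs)"
      then obtain k y where x: "x = of_int k *\<^sub>R b + y" "y \<in> L'" by (auto simp: bs(3))
      have "of_int k *\<^sub>R b - of_int (-1) *\<^sub>R y \<in> L"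
        using x by (intro insert.prems(3) sc b) (auto simp: L'_def)
      then show "x \<in> L" using x by simp
    qed
    moreover have "distinct (b # bs)" using bs nb span_base by auto
    moreover have "independent (set (b # bs))" using bs nb by (simp add: independent_insert)
    ultimately show ?thesis by blast
  qed
qed

lemma integer_lattice_basis:
  fixes L :: "'a::euclidean_space set"
  assumes "0 \<in> L" and "\<And>x y. x \<in> L \<Longrightarrow> y \<in> L \<Longrightarrow> x - y \<in> L"
    and "\<And>x b. x \<in> L \<Longrightarrow> b \<in> Basis \<Longrightarrow> x \<bullet> b \<in> \<int>"
  shows "\<exists>bs. lattice_basis L bs"
proof -
  have "\<exists>bs. distinct bs \<and> independent (set bs) \<and> L = lattice_span bs"
  proof (rule integer_lattice_basis_aux[of "Basis :: 'a set" "\<lambda>b x. x \<bullet> b"])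
    show "linear (\<lambda>x. x \<bullet> b)" for b :: 'a by (auto intro!: linearI simp: inner_add)
    show "x = 0" if "\<And>j. j \<in> Basis \<Longrightarrow> x \<bullet> j = 0" for x :: 'a using that euclidean_all_zero_iff[of x] by blast
  qed (use assms in auto)
  then show ?thesis by (auto simp: lattice_basis_def lattice_span_eq)
qed

text \<open>Rounding the multiples of a solution \<open>x\<close> of an integer linear system leaves errors that take
  finitely many values under the system, so two far-apart multiples differ from an integer solution
  by a bounded vector; a component of \<open>x\<close> orthogonal to all integer solutions would then have to
  vanish.\<close>

lemma integer_solutions_span:
  fixes \<Phi> :: "('a::euclidean_space \<Rightarrow> real) set"
  assumes fin: "finite \<Phi>" and lin: "\<And>\<phi>. \<phi> \<in> \<Phi> \<Longrightarrow> linear \<phi>"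
    and int: "\<And>\<phi> x. \<phi> \<in> \<Phi> \<Longrightarrow> (\<And>b. b \<in> Basis \<Longrightarrow> x \<bullet> b \<in> \<int>) \<Longrightarrow> \<phi> x \<in> \<int>"
  defines "V \<equiv> {x. \<forall>\<phi>\<in>\<Phi>. \<phi> x = 0}"
  shows "span {x \<in> V. \<forall>b\<in>Basis. x \<bullet> b \<in> \<int>} = V"
proof
  define L where "L = {x \<in> V. \<forall>b\<in>Basis. x \<bullet> b \<in> \<int>}"
  have "subspace V" unfolding V_def subspace_def
    using lin by (auto simp: linear_0 linear_add linear_cmul)
  then show "span L \<subseteq> V" by (intro span_minimal) (auto simp: L_def)
  show "V \<subseteq> span L"
  proof
    fix x assume x: "x \<in> V"
    obtain p w where pw: "p \<in> span L" "\<And>y. y \<in> span L \<Longrightarrow> real_inner_class.orthogonal w y" "x = p + w"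
      by (rule orthogonal_subspace_decomp_exists[of L x]) auto
    define y where "y t = (\<Sum>b\<in>Basis. of_int \<lfloor>t * (x \<bullet> b)\<rfloor> *\<^sub>R b)" for t :: real
    define r where "r t = t *\<^sub>R x - y t" for t
    have yb: "y t \<bullet> b = of_int \<lfloor>t * (x \<bullet> b)\<rfloor>" if "b \<in> Basis" for t b
      using that by (simp add: y_def inner_sum_left inner_Basis if_distrib cong: if_cong)
    have rn: "norm (r t) \<le> DIM('a)" for t
    proof -
      have "norm (r t) \<le> (\<Sum>b\<in>Basis. \<bar>r t \<bullet> b\<bar>)" by (rule norm_le_l1)
      also have "\<dots> \<le> (\<Sum>b\<in>(Basis::'a set). 1)"
        by (rule sum_mono) (simp add: r_def inner_diff_left yb, linarith)
      finally show ?thesis by simp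
    qed
    have "\<exists>M. \<forall>t. \<bar>\<phi> (y t)\<bar> \<le> M" if \<phi>: "\<phi> \<in> \<Phi>" for \<phi>
    proof -
      note lin = lin[OF \<phi>]
      obtain K where K: "K > 0" "\<And>z. norm (\<phi> z) \<le> K * norm z"
        using linear_bounded_pos[OF lin] by blast
      have "\<bar>\<phi> (y t)\<bar> \<le> K * DIM('a)" for t
      proof -
        have "\<phi> (r t) = t * \<phi> x - \<phi> (y t)" by (simp add: r_def linear_diff[OF lin] linear_cmul[OF lin])
        moreover have "\<phi> x = 0" using x \<phi> unfolding V_def by blast
        ultimately have "\<bar>\<phi> (y t)\<bar> = norm (\<phi> (r t))" by simp
        also have "\<dots> \<le> K * norm (r t)" by (rule K)
        also have "\<dots> \<le> K * DIM('a)" using rn K(1) by (intro mult_left_mono) auto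
        finally show ?thesis .
      qed
      then show ?thesis by blast
    qed
    then obtain M where M: "\<And>\<phi> t. \<phi> \<in> \<Phi> \<Longrightarrow> \<bar>\<phi> (y t)\<bar> \<le> M \<phi>" by metis
    define h where "h t = restrict (\<lambda>\<phi>. \<phi> (y t)) \<Phi>" for t
    have hfin: "finite (range h)"
    proof (rule finite_subset)
      show "range h \<subseteq> PiE \<Phi> (\<lambda>\<phi>. {z \<in> \<int>. \<bar>z\<bar> \<le> M \<phi>})"
        using M int yb by (auto simp: h_def)
      show "finite (PiE \<Phi> (\<lambda>\<phi>. {z \<in> \<int>. \<bar>z\<bar> \<le> M \<phi>}))"
        using fin by (intro finite_PiE finite_abs_int_segment) auto
    qed
    \<comment> \<open>Pigeonhole: \<open>h\<close> has finite range, so two different multiples of N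
      give the same values of all functionals at the rounded vectors. Their difference is an integer
      solution, while the two multipliers are at least N apart.\<close>
    have main: "N * (norm w)\<^sup>2 \<le> 2 * DIM('a) * norm w" if N: "N > 0" for N :: real
    proof -
      have "\<not> inj (\<lambda>m::nat. h (real m * N))"
      proof
        assume "inj (\<lambda>m::nat. h (real m * N))"
        moreover have "finite (range (\<lambda>m::nat. h (real m * N)))" using hfin by (rule finite_subset[rotated]) auto
        ultimately show False using finite_imageD infinite_UNIV_nat by blast
      qed
      then obtain m0 m1 :: nat where mm: "m0 \<noteq> m1" "h (real m0 * N) = h (real m1 * N)" by (auto simp: inj_def)
      define m where "m = min m0 m1"
      define m' where "m' = max m0 m1"
      have m: "m < m'" "h (real m * N) = h (real m' * N)" using mm by (auto simp: m_def m'_def min_def max_def)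
      define k where "k = real m * N"
      define k' where "k' = real m' * N"
      have kk: "k' - k \<ge> N"
      proof -
        have "real m' - real m \<ge> 1" using m by linarith
        then show ?thesis using N by (simp add: k_def k'_def flip: left_diff_distrib)
      qed
      have "y k' - y k \<in> L"
      proof -
        have "\<phi> (y k') = \<phi> (y k)" if "\<phi> \<in> \<Phi>" for \<phi>
          using fun_cong[OF m(2), of \<phi>] that by (simp add: h_def k_def k'_def)
        then show ?thesis by (auto simp: L_def V_def linear_diff[OF lin] inner_diff_left yb)
      qed
      then have "w \<bullet> (y k' - y k) = 0" using pw(2) span_base by (auto simp: real_inner_class.orthogonal_def)
      moreover have "w \<bullet> x = (norm w)\<^sup>2" using pw by (simp add: inner_add_right real_inner_class.orthogonal_def power2_norm_eq_inner)
      moreover have "(k' - k) *\<^sub>R x = (y k' - y k) + (r k' - r k)" by (simp add: r_def algebra_simps)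
      then have "w \<bullet> ((k' - k) *\<^sub>R x) = w \<bullet> (y k' - y k) + w \<bullet> (r k' - r k)" by (simp only: inner_add_right)
      ultimately have "(k' - k) * (norm w)\<^sup>2 = w \<bullet> (r k' - r k)" by simp
      also have "\<dots> \<le> norm w * norm (r k' - r k)" by (rule norm_cauchy_schwarz)
      also have "\<dots> \<le> norm w * (2 * DIM('a))"
        using norm_triangle_ineq4[of "r k'" "r k"] rn[of k] rn[of k'] by (intro mult_left_mono) auto
      finally have "(k' - k) * (norm w)\<^sup>2 \<le> norm w * (2 * DIM('a))" .
      moreover have "N * (norm w)\<^sup>2 \<le> (k' - k) * (norm w)\<^sup>2" using kk by (rule mult_right_mono) auto
      ultimately show ?thesis by (simp add: mult_ac)
    qed
    have "w = 0"
    proof (rule ccontr)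
      assume "w \<noteq> 0"
      then have w: "norm w > 0" by simp
      \<comment> \<open>A value of N just beyond 2 DIM / norm w, the largest that the estimate
        admits when w is not 0.\<close>
      have "(2 * DIM('a) + 1) / norm w * (norm w)\<^sup>2 \<le> 2 * DIM('a) * norm w"
        using w by (intro main) (simp add: add_pos_nonneg)
      moreover have "(2 * DIM('a) + 1) / norm w * (norm w)\<^sup>2 = 2 * DIM('a) * norm w + norm w"
        using w by (simp add: power2_eq_square field_simps)
      ultimately show False using w by linarith
    qed
    then show "x \<in> span L" using pw by simp
  qed
qed

section \<open>Laplace's method on lattices\<close>

text \<open>\<open>h\<close> stands for either bound of a one-dimensional sum, x + 2 or max 0 (x -
  1). Both have the same leading term, so the two products have the same limit.\<close>

lemma prod_list_gauss_tendsto: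
  fixes h :: "real \<Rightarrow> real"
  assumes "\<And>a. a \<in> set as \<Longrightarrow> a > 0"
    and h: "\<And>a. a > 0 \<Longrightarrow> ((\<lambda>s. h (sqrt (2 * pi * s / a)) / sqrt (2 * pi * s)) \<longlongrightarrow> 1 / sqrt a) at_top"
  shows "((\<lambda>s. (\<Prod>a\<leftarrow>as. h (sqrt (2 * pi * s / a))) / (2 * pi * s) powr (real (length as) / 2))
    \<longlongrightarrow> 1 / sqrt (prod_list as)) at_top"
  using assms(1)
proof (induction as)
  case Nil
  have "\<forall>\<^sub>F s in at_top. 1 = 1 / (2 * pi * s) powr (0 / 2)"
    using eventually_gt_at_top[of 0] by eventually_elim auto
  then show ?case using tendsto_eventually[of "\<lambda>s. 1 / (2 * pi * s) powr (0 / 2)" 1 at_top]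
    by (auto simp: eventually_mono)
next
  case (Cons a as)
  have "((\<lambda>s. h (sqrt (2 * pi * s / a)) / sqrt (2 * pi * s) *
     ((\<Prod>a\<leftarrow>as. h (sqrt (2 * pi * s / a))) / (2 * pi * s) powr (real (length as) / 2)))
     \<longlongrightarrow> 1 / sqrt a * (1 / sqrt (prod_list as))) at_top"
    using Cons by (intro tendsto_mult h Cons.IH) auto
  moreover have "\<forall>\<^sub>F s in at_top. h (sqrt (2 * pi * s / a)) / sqrt (2 * pi * s) *
     ((\<Prod>a\<leftarrow>as. h (sqrt (2 * pi * s / a))) / (2 * pi * s) powr (real (length as) / 2))
     = (\<Prod>a\<leftarrow>a # as. h (sqrt (2 * pi * s / a))) / (2 * pi * s) powr (real (length (a # as)) / 2)"
    using eventually_gt_at_top[of 0]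
  proof eventually_elim
    case (elim s)
    have "(2 * pi * s) powr (real (length (a # as)) / 2) = sqrt (2 * pi * s) * (2 * pi * s) powr (real (length as) / 2)"
      using elim by (simp add: powr_half_sqrt[symmetric] add_divide_distrib flip: powr_add)
    then show ?case by simp
  qed
  ultimately have "((\<lambda>s. (\<Prod>a\<leftarrow>a # as. h (sqrt (2 * pi * s / a))) / (2 * pi * s) powr (real (length (a # as)) / 2))
     \<longlongrightarrow> 1 / sqrt a * (1 / sqrt (prod_list as))) at_top"
    by (rule Lim_transform_eventually)
  then show ?case by (simp add: real_sqrt_mult)
qed

lemma sqrt_shift_tendsto:
  fixes a c :: real assumes a: "a > 0"
  shows "((\<lambda>s. (sqrt (2 * pi * s / a) + c) / sqrt (2 * pi * s)) \<longlongrightarrow> 1 / sqrt a) at_top"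
proof -
  have "((\<lambda>s. 1 / sqrt a + c / sqrt (2 * pi * s)) \<longlongrightarrow> 1 / sqrt a + 0) at_top"
    by (intro tendsto_add tendsto_const) real_asymp
  moreover have "\<forall>\<^sub>F s in at_top. 1 / sqrt a + c / sqrt (2 * pi * s) = (sqrt (2 * pi * s / a) + c) / sqrt (2 * pi * s)"
    using eventually_gt_at_top[of 0]
  proof eventually_elim
    case (elim s)
    define w where "w = sqrt (2 * pi * s)"
    have w: "w > 0" using elim by (simp add: w_def)
    have "sqrt (2 * pi * s / a) = w / sqrt a" by (simp add: w_def real_sqrt_divide)
    then show ?case unfolding w_def[symmetric] using w a by (simp add: add_divide_distrib)
  qed
  ultimately show ?thesis by (simp add: Lim_transform_eventually)
qed

text \<open>The bounds on the sum do not involve the shift, so \<open>v n\<close> may vary with n in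
  any way inside the span. The filter F leaves room for restricting n to the admissible
  integers.\<close>

lemma gaussian_lattice_sum_tendsto:
  fixes B :: "'a::real_vector \<Rightarrow> 'a \<Rightarrow> real" and v :: "nat \<Rightarrow> 'a"
  assumes B: "bilinear B" and sym: "\<And>x y. B x y = B y x"
    and ind: "distinct bs" "independent (set bs)"
    and pd: "\<forall>x\<in>span (set bs). x \<noteq> 0 \<longrightarrow> B x x > 0"
    and F: "F \<le> sequentially" and v: "\<forall>\<^sub>F n in F. v n \<in> span (set bs)"
  shows "((\<lambda>n. infsum (\<lambda>y. exp (- B (v n + y) (v n + y) / (2 * real n))) (lattice_span bs)
      / (2 * pi * real n) powr (real (length bs) / 2)) \<longlongrightarrow> 1 / sqrt (form_det B bs)) F"
    and "form_det B bs > 0"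
    and "\<forall>\<^sub>F n in F. (\<lambda>y. exp (- B (v n + y) (v n + y) / (2 * real n))) summable_on lattice_span bs"
proof -
  define I where "I n = infsum (\<lambda>y. exp (- B (v n + y) (v n + y) / (2 * real n))) (lattice_span bs)" for n
  define P where "P s = (2 * pi * s) powr (real (length bs) / 2)" for s :: real
  from gaussian_lattice_sum[OF B sym ind pd[rule_format]] obtain as where
    as: "length as = length bs" "\<And>a. a \<in> set as \<Longrightarrow> a > 0" "form_det B bs = prod_list as"
    and *: "\<And>s v. s > 0 \<Longrightarrow> v \<in> span (set bs) \<Longrightarrow>
        (\<lambda>y. exp (- B (v + y) (v + y) / (2 * s))) summable_on lattice_span bs \<and>
        infsum (\<lambda>y. exp (- B (v + y) (v + y) / (2 * s))) (lattice_span bs) \<le> (\<Prod>a\<leftarrow>as. sqrt (2 * pi * s / a) + 2) \<and>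
        (\<Prod>a\<leftarrow>as. max 0 (sqrt (2 * pi * s / a) - 1)) \<le> infsum (\<lambda>y. exp (- B (v + y) (v + y) / (2 * s))) (lattice_span bs)"
    by blast
  show "form_det B bs > 0" unfolding as(3) using as(2) by (induction as) (auto intro!: mult_pos_pos)
  have pos: "\<forall>\<^sub>F n in F. n > 0" using F eventually_gt_at_top[of "0::nat"] by (rule filter_leD)
  have b: "\<forall>\<^sub>F n in F. (\<lambda>y. exp (- B (v n + y) (v n + y) / (2 * real n))) summable_on lattice_span bs
      \<and> I n \<le> (\<Prod>a\<leftarrow>as. sqrt (2 * pi * real n / a) + 2)
      \<and> (\<Prod>a\<leftarrow>as. max 0 (sqrt (2 * pi * real n / a) - 1)) \<le> I n"
    using pos v by eventually_elim (use * in \<open>auto simp: I_def\<close>)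
  then show "\<forall>\<^sub>F n in F. (\<lambda>y. exp (- B (v n + y) (v n + y) / (2 * real n))) summable_on lattice_span bs"
    by eventually_elim auto
  have lim: "filterlim real at_top F" using F filterlim_real_sequentially by (meson filterlim_mono order_refl)
  have u: "((\<lambda>n. (\<Prod>a\<leftarrow>as. sqrt (2 * pi * real n / a) + 2) / P (real n)) \<longlongrightarrow> 1 / sqrt (prod_list as)) F"
  proof (rule filterlim_compose[OF _ lim])
    from prod_list_gauss_tendsto[where as = as and h = "\<lambda>x. x + 2", OF as(2) sqrt_shift_tendsto]
    show "((\<lambda>n. (\<Prod>a\<leftarrow>as. sqrt (2 * pi * n / a) + 2) / P n) \<longlongrightarrow> 1 / sqrt (prod_list as)) at_top"
      by (simp add: P_def as(1))
  qed
  have l: "((\<lambda>n. (\<Prod>a\<leftarrow>as. max 0 (sqrt (2 * pi * real n / a) - 1)) / P (real n)) \<longlongrightarrow> 1 / sqrt (prod_list as)) F"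
  proof (rule filterlim_compose[OF _ lim])
    have "((\<lambda>s. max 0 (sqrt (2 * pi * s / a) - 1) / sqrt (2 * pi * s)) \<longlongrightarrow> 1 / sqrt a) at_top" if a: "a > 0" for a
    proof -
      have "((\<lambda>s. (sqrt (2 * pi * s / a) - 1) / sqrt (2 * pi * s)) \<longlongrightarrow> 1 / sqrt a) at_top"
        using sqrt_shift_tendsto[OF a, of "- 1"] by simp
      moreover have "\<forall>\<^sub>F s in at_top. (sqrt (2 * pi * s / a) - 1) / sqrt (2 * pi * s) = max 0 (sqrt (2 * pi * s / a) - 1) / sqrt (2 * pi * s)"
      proof -
        have "\<forall>\<^sub>F s in at_top. s \<ge> a / (2 * pi)" by (rule eventually_ge_at_top)
        then show ?thesis by eventually_elim (use a in \<open>simp add: field_simps\<close>)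
      qed
      ultimately show ?thesis by (rule Lim_transform_eventually)
    qed
    from prod_list_gauss_tendsto[where as = as and h = "\<lambda>x. max 0 (x - 1)", OF as(2) this]
    show "((\<lambda>n. (\<Prod>a\<leftarrow>as. max 0 (sqrt (2 * pi * n / a) - 1)) / P n) \<longlongrightarrow> 1 / sqrt (prod_list as)) at_top"
      by (simp add: P_def as(1))
  qed
  have "((\<lambda>n. I n / P (real n)) \<longlongrightarrow> 1 / sqrt (prod_list as)) F"
  proof (rule tendsto_sandwich[OF _ _ l u])
    show "\<forall>\<^sub>F n in F. (\<Prod>a\<leftarrow>as. max 0 (sqrt (2 * pi * real n / a) - 1)) / P (real n) \<le> I n / P (real n)"
      using b by eventually_elim (auto simp: P_def intro!: divide_right_mono)
    show "\<forall>\<^sub>F n in F. I n / P (real n) \<le> (\<Prod>a\<leftarrow>as. sqrt (2 * pi * real n / a) + 2) / P (real n)"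
      using b by eventually_elim (auto simp: P_def intro!: divide_right_mono)
  qed
  then show "((\<lambda>n. infsum (\<lambda>y. exp (- B (v n + y) (v n + y) / (2 * real n))) (lattice_span bs)
      / (2 * pi * real n) powr (real (length bs) / 2)) \<longlongrightarrow> 1 / sqrt (form_det B bs)) F"
    by (simp add: I_def P_def as(3))
qed

text \<open>The minimum over the compact unit sphere of S serves as q, by homogeneity; the zero
  subspace is separate because its sphere is empty.\<close>

lemma bilinear_pos_def_coercive:
  fixes B :: "'a::euclidean_space \<Rightarrow> 'a \<Rightarrow> real"
  assumes B: "bilinear B" and S: "subspace S" and pd: "\<And>x. x \<in> S \<Longrightarrow> x \<noteq> 0 \<Longrightarrow> B x x > 0"
  obtains q where "q > 0" "\<And>x. x \<in> S \<Longrightarrow> q * (norm x)\<^sup>2 \<le> B x x"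
proof (cases "S \<subseteq> {0}")
  case True
  show ?thesis
  proof (rule that[of 1])
    fix x assume "x \<in> S"
    with True have "x = 0" by blast
    then show "1 * (norm x)\<^sup>2 \<le> B x x" using B by (simp add: bilinear_lzero)
  qed simp
next
  case False
  then obtain w where w: "w \<in> S" "w \<noteq> 0" by auto
  interpret B: bounded_bilinear B using B by (simp add: bilinear_conv_bounded_bilinear)
  define K where "K = S \<inter> sphere 0 1"
  have "compact K" unfolding K_def by (intro closed_Int_compact closed_subspace S) simp
  moreover have "(1 / norm w) *\<^sub>R w \<in> K" using w S by (auto simp: K_def subspace_scale)
  moreover have "continuous_on K (\<lambda>x. B x x)" by (intro B.continuous_on continuous_on_id)
  ultimately obtain u where u: "u \<in> K" "\<And>x. x \<in> K \<Longrightarrow> B u u \<le> B x x"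
    using continuous_attains_inf[of K "\<lambda>x. B x x"] by blast
  show ?thesis
  proof (rule that[of "B u u"])
    show "B u u > 0" using u(1) pd[of u] by (force simp: K_def)
    fix x assume x: "x \<in> S"
    show "B u u * (norm x)\<^sup>2 \<le> B x x"
    proof (cases "x = 0")
      case True then show ?thesis by (simp add: B.zero_left)
    next
      case False
      have "(1 / norm x) *\<^sub>R x \<in> K" using x False S by (auto simp: K_def subspace_scale)
      from u(2)[OF this] have "B u u \<le> B x x / (norm x)\<^sup>2"
        by (simp add: B.scaleR_left B.scaleR_right power2_eq_square)
      then show ?thesis using False by (simp add: field_simps)
    qed
  qed
qed

text \<open>Dominated convergence at the scale sqrt n. For each \<eta> the difference between G and
  the Gaussian is at most \<eta> times a wider Gaussian: inside a ball of radius R sqrt n by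
  \<open>loc\<close>, outside it by the decay of both. The wider Gaussian sums to the same power of
  n, so the total error is a multiple of \<eta> after normalisation.\<close>

theorem lattice_laplace:
  fixes B :: "'a::euclidean_space \<Rightarrow> 'a \<Rightarrow> real" and G :: "nat \<Rightarrow> 'a \<Rightarrow> real" and v :: "nat \<Rightarrow> 'a"
  assumes B: "bilinear B" and sym: "\<And>x y. B x y = B y x"
    and ind: "distinct bs" "independent (set bs)"
    and pd: "\<forall>x\<in>span (set bs). x \<noteq> 0 \<longrightarrow> B x x > 0"
    and F: "F \<le> sequentially" and v: "\<forall>\<^sub>F n in F. v n \<in> span (set bs)"
    and c: "c > 0"
    and dom: "\<forall>\<^sub>F n in F. \<forall>y\<in>lattice_span bs. \<bar>G n (v n + y)\<bar> \<le> C * exp (- c * (norm (v n + y))\<^sup>2 / real n)"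
    and loc: "\<And>R e. R > 0 \<Longrightarrow> e > 0 \<Longrightarrow> \<forall>\<^sub>F n in F. \<forall>y\<in>lattice_span bs. norm (v n + y) \<le> R * sqrt (real n) \<longrightarrow>
        \<bar>G n (v n + y) - exp (- B (v n + y) (v n + y) / (2 * real n))\<bar> \<le> e"
  shows "((\<lambda>n. infsum (\<lambda>y. G n (v n + y)) (lattice_span bs) / (2 * pi * real n) powr (real (length bs) / 2))
     \<longlongrightarrow> 1 / sqrt (form_det B bs)) F"
proof -
  obtain q where q: "q > 0" "\<And>x. x \<in> span (set bs) \<Longrightarrow> q * (norm x)\<^sup>2 \<le> B x x"
    using bilinear_pos_def_coercive[OF B subspace_span pd[rule_format]] by blast
  \<comment> \<open>A common decay rate for G, with rate c, and for the Gaussian, with rate at least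
    q / 2. The comparison Gaussian \<open>E\<close> uses only half of it; the other half supplies
    the small factor outside the ball. The constant \<open>C'\<close> adds those of G and of the
    Gaussian.\<close>
  define c' where "c' = min c (q / 2)"
  have c': "c' > 0" "c' \<le> c" "c' \<le> q / 2" using c q(1) by (auto simp: c'_def)
  define C' where "C' = \<bar>C\<bar> + 1"
  have C': "C' > 0" by (simp add: C'_def)
  define B' where "B' x y = c' * inner x y" for x y :: 'a
  have B'b: "bilinear B'" 
    unfolding bilinear_def B'_def by (auto intro!: linearI simp: inner_add algebra_simps)
  have B's: "B' x y = B' y x" for x y by (simp add: B'_def inner_commute)
  have B'p: "\<forall>x\<in>span (set bs). x \<noteq> 0 \<longrightarrow> B' x x > 0" using c' by (simp add: B'_def)
  have B'n: "B' x x = c' * (norm x)\<^sup>2" for x by (simp add: B'_def power2_norm_eq_inner)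
  define D where "D n y = G n (v n + y) - exp (- B (v n + y) (v n + y) / (2 * real n))" for n y
  define E where "E n y = exp (- B' (v n + y) (v n + y) / (2 * real n))" for n y
  define S where "S n = infsum (\<lambda>y. exp (- B (v n + y) (v n + y) / (2 * real n))) (lattice_span bs)" for n
  define P where "P n = (2 * pi * real n) powr (real (length bs) / 2)" for n
  note gB = gaussian_lattice_sum_tendsto[OF B sym ind pd F v, folded S_def P_def]
  note gE = gaussian_lattice_sum_tendsto[OF B'b B's ind B'p F v, folded E_def P_def]
  have pos: "\<forall>\<^sub>F n in F. n > 0" using F eventually_gt_at_top[of "0::nat"] by (rule filter_leD)
  have small: "\<forall>\<^sub>F n in F. \<forall>y\<in>lattice_span bs. \<bar>D n y\<bar> \<le> \<eta> * E n y" if \<eta>: "\<eta> > 0" for \<eta>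
  proof -
    have "((\<lambda>R. C' * exp (- c' * R\<^sup>2 / 2)) \<longlongrightarrow> 0) at_top" using c' by real_asymp
    then have "\<forall>\<^sub>F R in at_top. C' * exp (- c' * R\<^sup>2 / 2) < \<eta>" using \<eta> by (rule order_tendstoD)
    then have "\<forall>\<^sub>F R in at_top. R > 0 \<and> C' * exp (- c' * R\<^sup>2 / 2) < \<eta>"
      using eventually_gt_at_top[of 0] by eventually_elim auto
    then obtain R where R: "R > 0" "C' * exp (- c' * R\<^sup>2 / 2) < \<eta>"
      using eventually_happens'[OF trivial_limit_at_top_linorder] by blast
    define e where "e = \<eta> * exp (- c' * R\<^sup>2 / 2)"
    have e: "e > 0" using \<eta> by (simp add: e_def)
    show ?thesis using loc[OF R(1) e] dom v pos
    proof eventually_elim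
      case (elim n)
      show ?case
      proof
        fix y assume y: "y \<in> lattice_span bs"
        define x where "x = v n + y"
        have x: "x \<in> span (set bs)" unfolding x_def using y elim lattice_span_subset_span by (blast intro: span_add)
        have n: "real n > 0" using elim by simp
        define t where "t = (norm x)\<^sup>2 / real n"
        have t0: "t \<ge> 0" by (simp add: t_def)
        have En: "E n y = exp (- c' * t / 2)" by (simp add: E_def x_def[symmetric] B'n t_def)
        show "\<bar>D n y\<bar> \<le> \<eta> * E n y"
        proof (cases "norm x \<le> R * sqrt (real n)")
          case True
          then have "\<bar>D n y\<bar> \<le> e" using elim(1) y by (auto simp: D_def x_def)
          also have "e \<le> \<eta> * E n y"
          proof -
            have "(norm x)\<^sup>2 \<le> R\<^sup>2 * real n" using power_mono[OF True, of 2] by (simp add: power_mult_distrib)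
            then have "t \<le> R\<^sup>2" using n by (simp add: t_def field_simps)
            then show ?thesis using \<eta> c' by (simp add: e_def En)
          qed
          finally show ?thesis .
        next
          case False
          then have "(R * sqrt (real n))\<^sup>2 \<le> (norm x)\<^sup>2" using R by (intro power_mono) auto
          then have tR: "R\<^sup>2 \<le> t" using n by (simp add: t_def field_simps power_mult_distrib)
          have "\<bar>G n x\<bar> \<le> \<bar>C\<bar> * exp (- c' * t)"
          proof -
            have "\<bar>G n x\<bar> \<le> C * exp (- c * t)" using elim(2) y by (auto simp: x_def t_def)
            also have "\<dots> \<le> \<bar>C\<bar> * exp (- c' * t)" using c' t0 by (intro mult_mono) (auto intro!: mult_right_mono)
            finally show ?thesis .
          qed
          moreover have "exp (- B x x / (2 * real n)) \<le> exp (- c' * t)"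
          proof -
            have "2 * c' * (norm x)\<^sup>2 \<le> q * (norm x)\<^sup>2" using c' by (intro mult_right_mono) auto
            then have "2 * c' * (norm x)\<^sup>2 \<le> B x x" using q(2)[OF x] by linarith
            then have "(2 * c' * (norm x)\<^sup>2) / (2 * real n) \<le> B x x / (2 * real n)"
              using n by (intro divide_right_mono) auto
            moreover have "(2 * c' * (norm x)\<^sup>2) / (2 * real n) = c' * t" by (simp add: t_def)
            ultimately show ?thesis by simp
          qed
          ultimately have "\<bar>D n y\<bar> \<le> C' * exp (- c' * t)"
            unfolding D_def x_def[symmetric] C'_def distrib_right
            using exp_gt_zero[of "- B x x / (2 * real n)"] by linarith
          also have "\<dots> = C' * exp (- c' * t / 2) * E n y" by (simp add: En flip: exp_add)
          also have "\<dots> \<le> C' * exp (- c' * R\<^sup>2 / 2) * E n y"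
            using tR c' C' by (intro mult_right_mono mult_left_mono) (auto simp: En)
          also have "\<dots> \<le> \<eta> * E n y" using R by (intro mult_right_mono) (auto simp: En)
          finally show ?thesis .
        qed
      qed
    qed
  qed
  define T where "T n = infsum (\<lambda>y. G n (v n + y)) (lattice_span bs)" for n
  define U where "U n = infsum (E n) (lattice_span bs)" for n
  have TS: "\<forall>\<^sub>F n in F. \<bar>T n - S n\<bar> \<le> \<eta> * U n" if \<eta>: "\<eta> > 0" for \<eta>
    using small[OF \<eta>] gB(3) gE(3)
  proof eventually_elim
    case (elim n)
    have Es: "(\<lambda>y. \<eta> * E n y) summable_on lattice_span bs" using elim by (intro summable_on_cmult_right)
    have Ds: "D n summable_on lattice_span bs"
      by (rule abs_summable_summable, rule Infinite_Sum.abs_summable_on_comparison_test'[OF Es]) (use elim in auto)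
    have "((\<lambda>y. D n y + exp (- B (v n + y) (v n + y) / (2 * real n))) has_sum (infsum (D n) (lattice_span bs) + S n)) (lattice_span bs)"
      unfolding S_def by (intro has_sum_add has_sum_infsum Ds elim)
    then have "T n = infsum (D n) (lattice_span bs) + S n"
      unfolding T_def D_def by (simp add: infsumI)
    moreover have "norm (infsum (D n) (lattice_span bs)) \<le> \<eta> * U n"
    proof (rule norm_infsum_le[OF has_sum_infsum[OF Ds]])
      show "((\<lambda>y. \<eta> * E n y) has_sum \<eta> * U n) (lattice_span bs)"
        unfolding U_def using elim by (intro has_sum_cmult_right has_sum_infsum)
    qed (use elim in auto)
    ultimately show ?case by simp
  qed
  have "((\<lambda>n. (T n - S n) / P n) \<longlongrightarrow> 0) F"
  proof (rule tendstoI)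
    fix e :: real assume e: "e > 0"
    define L where "L = 1 / sqrt (form_det B' bs)"
    have L: "L > 0" using gE(2) by (simp add: L_def)
    define \<eta> where "\<eta> = e / (2 * (L + 1))"
    have \<eta>: "\<eta> > 0" using e L by (simp add: \<eta>_def)
    have "\<forall>\<^sub>F n in F. U n / P n < L + 1"
      using gE(1) unfolding U_def L_def by (rule order_tendstoD) simp
    then show "\<forall>\<^sub>F n in F. dist ((T n - S n) / P n) 0 < e" using TS[OF \<eta>] pos
    proof eventually_elim
      case (elim n)
      have P: "P n > 0" using elim by (simp add: P_def)
      have "\<bar>T n - S n\<bar> / P n \<le> \<eta> * (U n / P n)" using elim P by (simp add: divide_right_mono)
      also have "\<dots> \<le> \<eta> * (L + 1)" using elim \<eta> by (intro mult_left_mono) auto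
      also have "\<dots> < e" using L e by (simp add: \<eta>_def field_simps add_pos_pos)
      finally show ?case using P by simp
    qed
  qed
  from tendsto_add[OF this gB(1)]
  have "((\<lambda>n. T n / P n) \<longlongrightarrow> 1 / sqrt (form_det B bs)) F"
    by (simp add: diff_divide_distrib)
  then show ?thesis by (simp add: T_def P_def)
qed

section \<open>Counting pairs of perfect matchings\<close>

definition colour_bijections :: "'a set \<Rightarrow> 'b set \<Rightarrow> ('a \<Rightarrow> 'c) \<Rightarrow> ('b \<Rightarrow> 'c) \<Rightarrow> ('a \<Rightarrow> 'b) set" where
  "colour_bijections A B ca cb = {f \<in> A \<rightarrow>\<^sub>E B. bij_betw f A B \<and> (\<forall>a\<in>A. cb (f a) = ca a)}"

lemma colour_bijections_card_eq:
  assumes "f \<in> colour_bijections A B ca cb"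
  shows "card {a \<in> A. ca a = c} = card {b \<in> B. cb b = c}"
proof -
  have f: "bij_betw f A B" "\<And>a. a \<in> A \<Longrightarrow> cb (f a) = ca a" using assms by (auto simp: colour_bijections_def)
  have "bij_betw f {a \<in> A. ca a = c} {b \<in> B. cb b = c}"
    using f unfolding bij_betw_def inj_on_def by (auto simp: image_iff)
  then show ?thesis by (rule bij_betw_same_card)
qed

lemma prod_fact_card_insert:
  fixes ca :: "'a \<Rightarrow> 'c::finite"
  assumes "finite A" "a \<notin> A"
  shows "(\<Prod>c\<in>UNIV. fact (card {x \<in> insert a A. ca x = c}) :: nat)
    = Suc (card {x \<in> A. ca x = ca a}) * (\<Prod>c\<in>UNIV. fact (card {x \<in> A. ca x = c}))"
proof -
  have 1: "{x \<in> insert a A. ca x = c} = (if c = ca a then insert a {x \<in> A. ca x = c} else {x \<in> A. ca x = c})" for c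
    by auto
  have "(\<Prod>c\<in>UNIV. fact (card {x \<in> insert a A. ca x = c}) :: nat)
    = (\<Prod>c\<in>UNIV. (if c = ca a then Suc (card {x \<in> A. ca x = ca a}) else 1) * fact (card {x \<in> A. ca x = c}))"
    unfolding 1 by (rule prod.cong) (use assms in auto)
  then show ?thesis by (simp add: prod.distrib)
qed

text \<open>The image of a new point may be any point of its colour in B, and removing the pair
  leaves equal class sizes. The number of choices is exactly the factor by which the factorial of
  that class grows.\<close>

lemma card_colour_bijections:
  fixes ca :: "'a \<Rightarrow> 'c::finite"
  assumes "finite A" "finite B" "\<And>c. card {a \<in> A. ca a = c} = card {b \<in> B. cb b = c}"
  shows "card (colour_bijections A B ca cb) = (\<Prod>c\<in>UNIV. fact (card {a \<in> A. ca a = c}))"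
  using assms
proof (induction A arbitrary: B rule: finite_induct)
  case empty
  have "B = {}"
  proof (rule ccontr)
    assume "B \<noteq> {}"
    then obtain b where "b \<in> B" by blast
    then have "card {b' \<in> B. cb b' = cb b} > 0" using empty by (auto simp: card_gt_0_iff)
    then show False using empty(2)[of "cb b"] by simp
  qed
  then have "colour_bijections {} B ca cb = {\<lambda>_. undefined}" by (auto simp: colour_bijections_def bij_betw_def)
  then show ?case by simp
next
  case (insert a A)
  define B0 where "B0 = {b \<in> B. cb b = ca a}"
  have B0: "card B0 = Suc (card {x \<in> A. ca x = ca a})"
  proof -
    have "{x \<in> insert a A. ca x = ca a} = insert a {x \<in> A. ca x = ca a}" by auto
    then show ?thesis using insert.prems(2)[of "ca a"] insert.hyps by (simp add: B0_def)
  qed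
  have IH: "card (colour_bijections A (B - {b}) ca cb) = (\<Prod>c\<in>UNIV. fact (card {a \<in> A. ca a = c}))" if b: "b \<in> B0" for b
  proof (rule insert.IH)
    show "finite (B - {b})" using insert.prems by simp
    fix c
    have 1: "{x \<in> insert a A. ca x = c} = (if c = ca a then insert a {x \<in> A. ca x = c} else {x \<in> A. ca x = c})" by auto
    have 2: "{x \<in> B - {b}. cb x = c} = {x \<in> B. cb x = c} - (if c = ca a then {b} else {})" using b by (auto simp: B0_def)
    have "b \<in> {x \<in> B. cb x = ca a}" using b by (simp add: B0_def)
    then show "card {a \<in> A. ca a = c} = card {b' \<in> B - {b}. cb b' = c}"
      using insert.prems(2)[of c] insert.hyps insert.prems(1) unfolding 1 2 by (auto simp: card_Diff_singleton)
  qed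
  have "bij_betw (\<lambda>f. (f a, restrict f A)) (colour_bijections (insert a A) B ca cb)
      (SIGMA b:B0. colour_bijections A (B - {b}) ca cb)"
  proof (rule bij_betw_byWitness[where f' = "\<lambda>(b, g). g(a := b)"])
    show "\<forall>f\<in>colour_bijections (insert a A) B ca cb. (\<lambda>(b, g). g(a := b)) (f a, restrict f A) = f"
      by (auto simp: colour_bijections_def fun_eq_iff PiE_def extensional_def)
    show "\<forall>p\<in>SIGMA b:B0. colour_bijections A (B - {b}) ca cb.
        ((\<lambda>(b, g). g(a := b)) p a, restrict ((\<lambda>(b, g). g(a := b)) p) A) = p"
      using insert.hyps by (auto simp: colour_bijections_def fun_eq_iff PiE_def extensional_def restrict_def)
    show "(\<lambda>f. (f a, restrict f A)) ` colour_bijections (insert a A) B ca cb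
        \<subseteq> (SIGMA b:B0. colour_bijections A (B - {b}) ca cb)"
    proof clarsimp
      fix f assume f: "f \<in> colour_bijections (insert a A) B ca cb"
      then have b: "bij_betw f (insert a A) B" and c: "\<And>x. x \<in> insert a A \<Longrightarrow> cb (f x) = ca x"
        by (auto simp: colour_bijections_def)
      have "bij_betw f A (B - {f a})"
        using bij_betw_DiffI[OF b, of "{a}" "{f a}"] bij_betwE[OF b] insert.hyps by (simp add: bij_betw_def)
      then have "bij_betw (restrict f A) A (B - {f a})" by (simp cong: bij_betw_cong)
      moreover have "f a \<in> B0" using b c[of a] by (auto simp: B0_def bij_betw_def)
      ultimately show "f a \<in> B0 \<and> restrict f A \<in> colour_bijections A (B - {f a}) ca cb"
        using c by (auto simp: colour_bijections_def bij_betw_def)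
    qed
    show "(\<lambda>(b, g). g(a := b)) ` (SIGMA b:B0. colour_bijections A (B - {b}) ca cb) \<subseteq> colour_bijections (insert a A) B ca cb"
    proof clarsimp
      fix b g assume b: "b \<in> B0" and g: "g \<in> colour_bijections A (B - {b}) ca cb"
      have "bij_betw g A (B - {b})" using g by (simp add: colour_bijections_def)
      then have "bij_betw (g(a := b)) A (B - {b})" using insert.hyps by (subst bij_betw_cong[of A _ g]) auto
      then have "bij_betw (g(a := b)) (insert a A) B"
        using b insert.hyps by (auto simp: bij_betw_def B0_def)
      then show "g(a := b) \<in> colour_bijections (insert a A) B ca cb"
        using b g insert.hyps by (auto simp: colour_bijections_def B0_def PiE_def extensional_def Pi_def)
    qed
  qed
  then have "card (colour_bijections (insert a A) B ca cb) = card (SIGMA b:B0. colour_bijections A (B - {b}) ca cb)"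
    by (rule bij_betw_same_card)
  also have "\<dots> = (\<Sum>b\<in>B0. card (colour_bijections A (B - {b}) ca cb))"
  proof (rule card_SigmaI)
    show "finite B0" using insert.prems by (simp add: B0_def)
    have "colour_bijections A (B - {b}) ca cb \<subseteq> A \<rightarrow>\<^sub>E (B - {b})" for b by (auto simp: colour_bijections_def)
    then show "\<forall>b\<in>B0. finite (colour_bijections A (B - {b}) ca cb)"
      using insert.hyps insert.prems by (meson finite_PiE finite_Diff finite_subset)
  qed
  also have "\<dots> = card B0 * (\<Prod>c\<in>UNIV. fact (card {a \<in> A. ca a = c}))" using IH by simp
  also have "\<dots> = (\<Prod>c\<in>UNIV. fact (card {x \<in> insert a A. ca x = c}))"
    by (simp only: B0 prod_fact_card_insert[OF insert.hyps(1,2)])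
  finally show ?case .
qed

text \<open>The multinomial coefficient by recursion: giving the new element the label c lowers N c
  by 1, which multiplies the quotient by N c; the factors N c add up to the new cardinality.\<close>

lemma card_functions_with_counts:
  fixes N :: "'c \<Rightarrow> nat"
  assumes "finite A" "finite C" "(\<Sum>c\<in>C. N c) = card A"
  shows "real (card {l \<in> A \<rightarrow>\<^sub>E C. \<forall>c\<in>C. card {a \<in> A. l a = c} = N c}) = fact (card A) / (\<Prod>c\<in>C. fact (N c))"
  using assms(1,3)
proof (induction A arbitrary: N rule: finite_induct)
  case empty
  then have "{l \<in> {} \<rightarrow>\<^sub>E C. \<forall>c\<in>C. card {a \<in> {}. l a = c} = N c} = {\<lambda>_. undefined}" "\<forall>c\<in>C. N c = 0"
    using assms(2) by auto
  then show ?case by simp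
next
  case (insert a A)
  define X where "X A N = {l \<in> A \<rightarrow>\<^sub>E C. \<forall>c\<in>C. card {a \<in> A. l a = c} = N c}" for A :: "'a set" and N
  \<comment> \<open>Labels that may still be used; for these N c - 1 is a true subtraction.\<close>
  define C0 where "C0 = {c \<in> C. N c > 0}"
  have fin: "finite (X A N)" if "finite A" for A N
    by (rule finite_subset[of _ "A \<rightarrow>\<^sub>E C"]) (use that assms(2) in \<open>auto simp: X_def intro: finite_PiE\<close>)
  have set: "{x \<in> insert a A. l x = c} = (if l a = c then insert a {x \<in> A. l x = c} else {x \<in> A. l x = c})" for l :: "'a \<Rightarrow> 'c" and c
    by auto
  have card: "card {x \<in> insert a A. l x = c} = (if l a = c then Suc (card {x \<in> A. l x = c}) else card {x \<in> A. l x = c})" for l :: "'a \<Rightarrow> 'c" and c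
    unfolding set using insert.hyps by simp
  have restr: "{x \<in> A. (if x \<in> A then l x else u x) = c} = {x \<in> A. l x = c}" for l u :: "'a \<Rightarrow> 'c" and c by auto
  have upd: "{x \<in> A. (l(a := b)) x = c} = {x \<in> A. l x = c}" for l :: "'a \<Rightarrow> 'c" and b c using insert.hyps by auto
  have "bij_betw (\<lambda>l. (l a, restrict l A)) (X (insert a A) N) (SIGMA c:C0. X A (N(c := N c - 1)))"
  proof (rule bij_betw_byWitness[where f' = "\<lambda>(b, g). g(a := b)"])
    show "\<forall>f\<in>X (insert a A) N. (\<lambda>(b, g). g(a := b)) (f a, restrict f A) = f"
      by (auto simp: X_def fun_eq_iff PiE_def extensional_def)
    show "\<forall>p\<in>SIGMA c:C0. X A (N(c := N c - 1)). ((\<lambda>(b, g). g(a := b)) p a, restrict ((\<lambda>(b, g). g(a := b)) p) A) = p"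
      using insert.hyps by (auto simp: X_def fun_eq_iff PiE_def extensional_def restrict_def)
    show "(\<lambda>f. (f a, restrict f A)) ` X (insert a A) N \<subseteq> (SIGMA c:C0. X A (N(c := N c - 1)))"
    proof clarsimp
      fix l assume l: "l \<in> X (insert a A) N"
      then have lC: "l a \<in> C" and cnt: "\<And>c. c \<in> C \<Longrightarrow> card {x \<in> insert a A. l x = c} = N c" by (auto simp: X_def)
      have "N (l a) = Suc (card {x \<in> A. l x = l a})" using cnt[OF lC] unfolding card by simp
      moreover have "card {x \<in> A. l x = c} = N c" if "c \<in> C" "c \<noteq> l a" for c using cnt[OF that(1)] that unfolding card by simp
      ultimately show "l a \<in> C0 \<and> restrict l A \<in> X A (N(l a := N (l a) - Suc 0))"
        using lC l by (auto simp: X_def C0_def restrict_def restr)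
    qed
    show "(\<lambda>(b, g). g(a := b)) ` (SIGMA c:C0. X A (N(c := N c - 1))) \<subseteq> X (insert a A) N"
    proof clarsimp
      fix b g assume b: "b \<in> C0" and g: "g \<in> X A (N(b := N b - Suc 0))"
      have "card {x \<in> insert a A. (g(a := b)) x = c} = N c" if "c \<in> C" for c
        unfolding card upd using that b g by (auto simp: X_def C0_def)
      then show "g(a := b) \<in> X (insert a A) N"
        using b g by (auto simp: X_def C0_def PiE_def extensional_def Pi_def simp del: fun_upd_apply) (auto split: if_splits)
    qed
  qed
  then have "card (X (insert a A) N) = card (SIGMA c:C0. X A (N(c := N c - 1)))"
    by (rule bij_betw_same_card)
  also have "\<dots> = (\<Sum>c\<in>C0. card (X A (N(c := N c - 1))))"
    by (rule card_SigmaI) (use assms(2) fin[OF insert.hyps(1)] in \<open>auto simp: C0_def\<close>)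
  finally have "real (card (X (insert a A) N)) = (\<Sum>c\<in>C0. real (card (X A (N(c := N c - 1)))))" by simp
  also have "\<dots> = (\<Sum>c\<in>C0. real (N c) * (fact (card A) / (\<Prod>c\<in>C. fact (N c))))"
  proof (rule sum.cong[OF refl])
    fix c assume c: "c \<in> C0"
    then have cC: "c \<in> C" and pos: "N c > 0" by (auto simp: C0_def)
    have "sum N C = N c + sum N (C - {c})" using assms(2) cC by (simp add: sum.remove)
    moreover have "sum (N(c := N c - 1)) C = (N c - 1) + sum N (C - {c})"
      using assms(2) cC by (simp add: sum.remove[of _ c])
    ultimately have "sum (N(c := N c - 1)) C = card A" using pos insert by simp
    then have IH: "real (card (X A (N(c := N c - 1)))) = fact (card A) / (\<Prod>x\<in>C. fact ((N(c := N c - 1)) x))"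
      unfolding X_def by (rule insert.IH)
    have "(\<Prod>x\<in>C. fact (N x) :: real) = fact (N c) * (\<Prod>x\<in>C - {c}. fact (N x))"
      using assms(2) cC by (simp add: prod.remove)
    also have "fact (N c) = real (N c) * fact (N c - 1)" using pos by (simp add: fact_reduce)
    finally have rem: "(\<Prod>x\<in>C. fact (N x) :: real) = real (N c) * fact (N c - 1) * (\<Prod>x\<in>C - {c}. fact (N x))" .
    have "(\<Prod>x\<in>C. fact (N x) :: real) = real (N c) * (\<Prod>x\<in>C. fact ((N(c := N c - 1)) x))"
    proof -
      have "(\<Prod>x\<in>C. fact ((N(c := N c - 1)) x) :: real) = fact (N c - 1) * (\<Prod>x\<in>C - {c}. fact ((N(c := N c - 1)) x))"
        using assms(2) cC by (subst prod.remove[of _ c]) auto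
      moreover have "(\<Prod>x\<in>C - {c}. fact ((N(c := N c - 1)) x) :: real) = (\<Prod>x\<in>C - {c}. fact (N x))"
        by (rule prod.cong) auto
      ultimately show ?thesis using rem by simp
    qed
    then show "real (card (X A (N(c := N c - 1)))) = real (N c) * (fact (card A) / (\<Prod>c\<in>C. fact (N c)))"
      unfolding IH using pos by simp
  qed
  also have "\<dots> = real (\<Sum>c\<in>C0. N c) * (fact (card A) / (\<Prod>c\<in>C. fact (N c)))"
    by (simp only: sum_distrib_right of_nat_sum)
  also have "(\<Sum>c\<in>C0. N c) = (\<Sum>c\<in>C. N c)"
    by (rule sum.mono_neutral_left) (use assms(2) in \<open>auto simp: C0_def\<close>)
  also have "\<dots> = Suc (card A)" using insert by simp
  finally show ?case using insert.hyps by (simp add: X_def)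
qed

section \<open>Perfect matchings of the lift as labellings of its vertices\<close>

lemma fibre_matchings_facts:
  assumes "m \<in> fibre_matchings ends n e"
  shows "\<And>p i k. p \<in> m \<Longrightarrow> (i, k) \<in> p \<Longrightarrow> i \<in> ends e \<and> k < n"
    and "\<And>i k. i \<in> ends e \<Longrightarrow> k < n \<Longrightarrow> \<exists>p\<in>m. (i, k) \<in> p"
    and "\<And>p q v. p \<in> m \<Longrightarrow> q \<in> m \<Longrightarrow> v \<in> p \<Longrightarrow> v \<in> q \<Longrightarrow> p = q"
    and "\<And>p. p \<in> m \<Longrightarrow> p \<noteq> {}"
proof -
  have m: "m \<subseteq> {{a, b} | a b. \<exists>i\<in>ends e. \<exists>j\<in>ends e. i \<noteq> j \<and> a \<in> fibre n i \<and> b \<in> fibre n j}"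
    and ex: "\<And>v. v \<in> (\<Union>i\<in>ends e. fibre n i) \<Longrightarrow> \<exists>!p. p \<in> m \<and> v \<in> p"
    using assms unfolding fibre_matchings_def perfect_matchings_def mem_Collect_eq by blast+
  show 1: "i \<in> ends e \<and> k < n" if "p \<in> m" "(i, k) \<in> p" for p i k
    using subsetD[OF m that(1)] that(2) by (auto simp: fibre_def)
  show "\<exists>p\<in>m. (i, k) \<in> p" if "i \<in> ends e" "k < n" for i k
  proof -
    have "(i, k) \<in> (\<Union>i\<in>ends e. fibre n i)" using that by (auto simp: fibre_def)
    from ex[OF this] show ?thesis by blast
  qed
  show "p = q" if "p \<in> m" "q \<in> m" "v \<in> p" "v \<in> q" for p q v
  proof -
    have "v \<in> (\<Union>i\<in>ends e. fibre n i)" using 1[of p "fst v" "snd v"] that by (cases v) (auto simp: fibre_def)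
    from ex[OF this] show ?thesis using that by blast
  qed
  show "p \<noteq> {}" if "p \<in> m" for p using subsetD[OF m that] by auto
qed

text \<open>A perfect matching between two fibres is the graph of a bijection of {..<n}, and its
  edges are monochromatic exactly when the bijection preserves colours. A constant colouring counts
  all matchings.\<close>

lemma card_coloured_fibre_matchings:
  fixes ends :: "'e::finite \<Rightarrow> 'v::finite set" and c :: "'v \<times> nat \<Rightarrow> 'c"
  assumes e: "ends e = {i, j}" and ij: "i \<noteq> j"
  shows "card {m \<in> fibre_matchings ends n e. \<forall>p\<in>m. \<forall>a\<in>p. \<forall>b\<in>p. c a = c b}
    = card (colour_bijections {..<n} {..<n} (\<lambda>k. c (i, k)) (\<lambda>k. c (j, k)))"
proof -
  define M where "M f = (\<lambda>k. {(i, k), (j, f k)}) ` {..<n}" for f :: "nat \<Rightarrow> nat"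
  define Es where "Es = {{a, b} | a b. \<exists>i\<in>ends e. \<exists>j\<in>ends e. i \<noteq> j \<and> a \<in> fibre n i \<and> b \<in> fibre n j}"
  have Es: "p \<in> Es \<longleftrightarrow> (\<exists>k<n. \<exists>l<n. p = {(i, k), (j, l)})" for p
  proof
    assume "p \<in> Es"
    then obtain a b i' j' where p: "p = {a, b}" and ij': "i' \<in> {i, j}" "j' \<in> {i, j}" "i' \<noteq> j'"
      and ab: "a \<in> fibre n i'" "b \<in> fibre n j'" unfolding Es_def e by blast
    obtain k l where kl: "a = (i', k)" "b = (j', l)" "k < n" "l < n" using ab by (auto simp: fibre_def)
    from ij' consider "i' = i" "j' = j" | "i' = j" "j' = i" by blast
    then show "\<exists>k<n. \<exists>l<n. p = {(i, k), (j, l)}"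
    proof cases
      case 1
      then show ?thesis using kl p by blast
    next
      case 2
      then have "p = {(i, l), (j, k)}" using kl p by (simp only: insert_commute)
      then show ?thesis using kl by blast
    qed
  next
    assume "\<exists>k<n. \<exists>l<n. p = {(i, k), (j, l)}"
    then obtain k l where "k < n" "l < n" "p = {(i, k), (j, l)}" by blast
    moreover then have "(i, k) \<in> fibre n i" "(j, l) \<in> fibre n j" by (simp_all add: fibre_def)
    ultimately show "p \<in> Es" unfolding Es_def e using ij by blast
  qed
  have FM: "m \<in> fibre_matchings ends n e \<longleftrightarrow> m \<subseteq> Es \<and> (\<forall>v\<in>fibre n i \<union> fibre n j. \<exists>!p. p \<in> m \<and> v \<in> p)" for m
    unfolding fibre_matchings_def perfect_matchings_def Es_def[symmetric] by (simp add: e)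
  have M_in: "M f \<in> fibre_matchings ends n e" if f: "bij_betw f {..<n} {..<n}" for f
  proof -
    have ran: "f k < n" if "k < n" for k using f that by (auto simp: bij_betw_def)
    have inj: "k = k'" if "k < n" "k' < n" "f k = f k'" for k k' using f that by (auto simp: bij_betw_def inj_on_def)
    have sub: "M f \<subseteq> Es"
    proof
      fix p assume "p \<in> M f"
      then obtain k where "k < n" "p = {(i, k), (j, f k)}" by (auto simp: M_def)
      then show "p \<in> Es" unfolding Es using ran by blast
    qed
    have 1: "\<exists>!p. p \<in> M f \<and> (i, k) \<in> p" if "k < n" for k
      using that ij by (intro ex1I[of _ "{(i, k), (j, f k)}"]) (auto simp: M_def)
    have 2: "\<exists>!p. p \<in> M f \<and> (j, l) \<in> p" if "l < n" for l
    proof -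
      have "l \<in> f ` {..<n}" using f that unfolding bij_betw_def by simp
      then obtain k where k: "k < n" "f k = l" by blast
      show ?thesis
      proof (rule ex1I[of _ "{(i, k), (j, l)}"])
        show "{(i, k), (j, l)} \<in> M f \<and> (j, l) \<in> {(i, k), (j, l)}" using k by (auto simp: M_def)
        fix p assume "p \<in> M f \<and> (j, l) \<in> p"
        then obtain k' where k': "k' < n" "p = {(i, k'), (j, f k')}" "(j, l) \<in> p" by (auto simp: M_def)
        then have "f k' = f k" using ij k by auto
        then have "k' = k" using inj k k' by blast
        then show "p = {(i, k), (j, l)}" using k k' by simp
      qed
    qed
    have "\<exists>!p. p \<in> M f \<and> v \<in> p" if "v \<in> fibre n i \<union> fibre n j" for v
    proof -
      obtain k where "k < n" "v = (i, k) \<or> v = (j, k)" using \<open>v \<in> _\<close> by (auto simp: fibre_def)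
      then show ?thesis using 1 2 by blast
    qed
    then show ?thesis unfolding FM using sub by blast
  qed
  have M_surj: "\<exists>f. f \<in> {..<n} \<rightarrow>\<^sub>E {..<n} \<and> bij_betw f {..<n} {..<n} \<and> m = M f" if m: "m \<in> fibre_matchings ends n e" for m
  proof -
    note facts = fibre_matchings_facts[OF m]
    have shape: "\<exists>k<n. \<exists>l<n. p = {(i, k), (j, l)}" if "p \<in> m" for p using m that Es FM by blast
    have "\<exists>l<n. {(i, k), (j, l)} \<in> m" if k: "k < n" for k
    proof -
      obtain p where p: "p \<in> m" "(i, k) \<in> p" using facts(2)[of i k] k e by auto
      then obtain k' l where "k' < n" "l < n" "p = {(i, k'), (j, l)}" using shape by blast
      then show ?thesis using p ij by auto
    qed
    then obtain f0 where f0: "\<And>k. k < n \<Longrightarrow> f0 k < n \<and> {(i, k), (j, f0 k)} \<in> m" by metis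
    define f where "f = restrict f0 {..<n}"
    have f: "f k < n" "{(i, k), (j, f k)} \<in> m" if "k < n" for k using f0 that by (auto simp: f_def)
    have "inj_on f {..<n}"
    proof (rule inj_onI)
      fix k k' assume k: "k \<in> {..<n}" "k' \<in> {..<n}" "f k = f k'"
      have in_m: "{(i, k), (j, f k)} \<in> m" "{(i, k'), (j, f k')} \<in> m" using f(2)[of k] f(2)[of k'] k(1,2) by auto
      have "{(i, k), (j, f k)} = {(i, k'), (j, f k')}"
        by (rule facts(3)[OF in_m, of "(j, f k)"]) (use k in simp_all)
      then show "k = k'" using ij by (auto simp: doubleton_eq_iff)
    qed
    moreover have "f ` {..<n} \<subseteq> {..<n}" using f by auto
    ultimately have "bij_betw f {..<n} {..<n}" by (simp add: bij_betw_def endo_inj_surj)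
    moreover have "m = M f"
    proof
      show "M f \<subseteq> m" using f by (auto simp: M_def)
      show "m \<subseteq> M f"
      proof
        fix p assume p: "p \<in> m"
        then obtain k l where k: "k < n" "p = {(i, k), (j, l)}" using shape by blast
        have "{(i, k), (j, f k)} \<in> m" using f k by simp
          with p have "p = {(i, k), (j, f k)}" by (rule facts(3)[of _ _ "(i, k)"]) (use k in simp_all)
        then show "p \<in> M f" using k by (auto simp: M_def)
      qed
    qed
    moreover have "f \<in> {..<n} \<rightarrow>\<^sub>E {..<n}" using f by (auto simp: f_def)
    ultimately show ?thesis by blast
  qed
  have "bij_betw M (colour_bijections {..<n} {..<n} (\<lambda>k. c (i, k)) (\<lambda>k. c (j, k)))
     {m \<in> fibre_matchings ends n e. \<forall>p\<in>m. \<forall>a\<in>p. \<forall>b\<in>p. c a = c b}"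
    unfolding bij_betw_def
  proof (intro conjI equalityI subsetI)
    show "inj_on M (colour_bijections {..<n} {..<n} (\<lambda>k. c (i, k)) (\<lambda>k. c (j, k)))"
    proof (rule inj_onI)
      fix f f' assume f: "f \<in> colour_bijections {..<n} {..<n} (\<lambda>k. c (i, k)) (\<lambda>k. c (j, k))"
        "f' \<in> colour_bijections {..<n} {..<n} (\<lambda>k. c (i, k)) (\<lambda>k. c (j, k))" "M f = M f'"
      show "f = f'"
      proof (rule PiE_ext)
        show "f \<in> {..<n} \<rightarrow>\<^sub>E {..<n}" "f' \<in> {..<n} \<rightarrow>\<^sub>E {..<n}" using f by (auto simp: colour_bijections_def)
        fix k assume "k \<in> {..<n}"
        then have "{(i, k), (j, f k)} \<in> M f'" using f(3) by (auto simp: M_def)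
        then show "f k = f' k" using ij by (auto simp: M_def doubleton_eq_iff)
      qed
    qed
  next
    fix m assume "m \<in> M ` colour_bijections {..<n} {..<n} (\<lambda>k. c (i, k)) (\<lambda>k. c (j, k))"
    then obtain f where f: "bij_betw f {..<n} {..<n}" "\<And>k. k < n \<Longrightarrow> c (j, f k) = c (i, k)" "m = M f"
      by (auto simp: colour_bijections_def)
    have compat: "\<forall>a\<in>p. \<forall>b\<in>p. c a = c b" if pm: "p \<in> m" for p
    proof -
      obtain k where "k < n" "p = {(i, k), (j, f k)}" using pm f(3) by (auto simp: M_def)
      then show ?thesis using f(2)[of k] by simp
    qed
    have "m \<in> fibre_matchings ends n e" unfolding f(3) by (rule M_in[OF f(1)])
    then show "m \<in> {m \<in> fibre_matchings ends n e. \<forall>p\<in>m. \<forall>a\<in>p. \<forall>b\<in>p. c a = c b}"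
      unfolding mem_Collect_eq by (rule conjI) (rule ballI, rule compat)
  next
    fix m assume m: "m \<in> {m \<in> fibre_matchings ends n e. \<forall>p\<in>m. \<forall>a\<in>p. \<forall>b\<in>p. c a = c b}"
    note m' = m[unfolded mem_Collect_eq]
    note mFM = m'[THEN conjunct1] and mc = m'[THEN conjunct2]
    from M_surj[OF mFM] obtain f where f: "f \<in> {..<n} \<rightarrow>\<^sub>E {..<n}" "bij_betw f {..<n} {..<n}" "m = M f" by blast
    have fc: "c (j, f k) = c (i, k)" if "k < n" for k
    proof -
      have "{(i, k), (j, f k)} \<in> m" unfolding f(3) M_def using that by simp
      from mc[THEN bspec, OF this] show ?thesis by blast
    qed
    have "f \<in> colour_bijections {..<n} {..<n} (\<lambda>k. c (i, k)) (\<lambda>k. c (j, k))"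
      unfolding colour_bijections_def using f(1,2) fc by simp
    with f(3) show "m \<in> M ` colour_bijections {..<n} {..<n} (\<lambda>k. c (i, k)) (\<lambda>k. c (j, k))" by (rule image_eqI)
  qed
  then show ?thesis by (rule bij_betw_same_card[symmetric])
qed

text \<open>A labelling assigns to the vertex \<open>(i, k)\<close> of the lift the base edge over which it is matched.\<close>

definition labellings :: "('e::finite \<Rightarrow> 'v::finite set) \<Rightarrow> nat \<Rightarrow> ('v \<Rightarrow> nat \<Rightarrow> 'e) set" where
  "labellings ends n = (PiE UNIV (\<lambda>i. {..<n} \<rightarrow>\<^sub>E incident ends i))"

text \<open>An edge over \<open>e\<close> that meets a vertex matched over \<open>e\<close> is the
  matching edge there, since that vertex has only one edge over \<open>e\<close>; its other end is
  then labelled \<open>e\<close> as well.\<close>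

definition compatible :: "('v \<Rightarrow> nat \<Rightarrow> 'e) \<Rightarrow> 'e \<Rightarrow> ('v \<times> nat) set set \<Rightarrow> bool" where
  "compatible l e m \<longleftrightarrow> (\<forall>p\<in>m. \<forall>a\<in>p. \<forall>b\<in>p. (case_prod l a = e) = (case_prod l b = e))"

text \<open>Each vertex has exactly one lifted edge over every incident base edge, so its label
  determines the matching edge at it. The inverse takes a labelling to the set of edges over e all
  of whose ends are labelled e, and compatibility makes every vertex covered.\<close>

lemma num_pm_lift_eq:
  fixes ends :: "'e::finite \<Rightarrow> 'v::finite set"
  assumes \<omega>: "\<And>e. \<omega> e \<in> fibre_matchings ends n e"
  shows "num_pm_lift n \<omega> = card {l \<in> labellings ends n. \<forall>e. compatible l e (\<omega> e)}"
proof -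
  note facts = fibre_matchings_facts[OF \<omega>]
  define PM where "PM = perfect_matchings (\<Union>i::'v. fibre n i) (SIGMA e:UNIV. \<omega> e) snd"
  have PM: "M \<in> PM \<longleftrightarrow> (\<forall>e p. (e, p) \<in> M \<longrightarrow> p \<in> \<omega> e) \<and> (\<forall>i k. k < n \<longrightarrow> (\<exists>!q. q \<in> M \<and> (i, k) \<in> snd q))" for M
  proof -
    have 1: "M \<subseteq> (SIGMA e:UNIV. \<omega> e) \<longleftrightarrow> (\<forall>e p. (e, p) \<in> M \<longrightarrow> p \<in> \<omega> e)" by auto
    have 2: "(\<forall>v\<in>(\<Union>i::'v. fibre n i). Q v) \<longleftrightarrow> (\<forall>i k. k < n \<longrightarrow> Q (i, k))" for Q
      by (auto simp: fibre_def)
    show ?thesis unfolding PM_def perfect_matchings_def mem_Collect_eq 1 2 by (rule refl)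
  qed
  define M where "M l = {(e, p). p \<in> \<omega> e \<and> (\<forall>a\<in>p. case_prod l a = e)}" for l :: "'v \<Rightarrow> nat \<Rightarrow> 'e"
  have lab: "l i k \<in> incident ends i" if "l \<in> labellings ends n" "k < n" for l i k
    using that by (auto simp: labellings_def PiE_iff)
  have M_mem: "\<exists>p. (l i k, p) \<in> M l \<and> (i, k) \<in> p"
    if l: "l \<in> labellings ends n" "\<forall>e. compatible l e (\<omega> e)" and k: "k < n" for l i k
  proof -
    have "i \<in> ends (l i k)" using lab[OF l(1) k] by (simp add: incident_def)
    then obtain p where p: "p \<in> \<omega> (l i k)" "(i, k) \<in> p" using facts(2) k by blast
    have "\<forall>a\<in>p. case_prod l a = l i k" using l(2) p unfolding compatible_def by fastforce
    then show ?thesis using p by (auto simp: M_def)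
  qed
  have "bij_betw M {l \<in> labellings ends n. \<forall>e. compatible l e (\<omega> e)} PM"
    unfolding bij_betw_def
  proof (intro conjI equalityI subsetI)
    show "inj_on M {l \<in> labellings ends n. \<forall>e. compatible l e (\<omega> e)}"
    proof (rule inj_onI, clarsimp)
      fix l l' assume l: "l \<in> labellings ends n" "\<forall>e. compatible l e (\<omega> e)"
        and l': "l' \<in> labellings ends n" "\<forall>e. compatible l' e (\<omega> e)" and eq: "M l = M l'"
      have "l i k = l' i k" if kn: "k < n" for i k
      proof -
        obtain p where "(l i k, p) \<in> M l" "(i, k) \<in> p" using M_mem[OF l kn] by blast
        then have "(l i k, p) \<in> M l'" "(i, k) \<in> p" using eq by auto
        then show ?thesis by (auto simp: M_def)
      qed
      moreover have "l i \<in> extensional {..<n}" "l' i \<in> extensional {..<n}" for i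
        using l(1) l'(1) by (auto simp: labellings_def PiE_iff)
      ultimately show "l = l'" by (intro ext) (metis extensional_arb lessThan_iff)
    qed
  next
    fix m assume "m \<in> M ` {l \<in> labellings ends n. \<forall>e. compatible l e (\<omega> e)}"
    then obtain l where l: "l \<in> labellings ends n" "\<forall>e. compatible l e (\<omega> e)" and m: "m = M l" by blast
    show "m \<in> PM" unfolding PM
    proof (intro conjI allI impI)
      show "p \<in> \<omega> e" if "(e, p) \<in> m" for e p using that by (auto simp: m M_def)
      fix i :: 'v and k assume k: "k < n"
      obtain p where p: "(l i k, p) \<in> M l" "(i, k) \<in> p" using M_mem[OF l k] by blast
      show "\<exists>!q. q \<in> m \<and> (i, k) \<in> snd q"
      proof (rule ex1I[of _ "(l i k, p)"])
        show "(l i k, p) \<in> m \<and> (i, k) \<in> snd (l i k, p)" using p m by simp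
        fix q assume q: "q \<in> m \<and> (i, k) \<in> snd q"
        then have "fst q = l i k" by (auto simp: m M_def)
        moreover have "snd q = p"
          using facts(3)[of "snd q" "l i k" p "(i, k)"] q p calculation by (auto simp: m M_def)
        ultimately show "q = (l i k, p)" by (auto simp: prod_eq_iff)
      qed
    qed
  next
    fix m assume m: "m \<in> PM"
    have sub: "\<And>e p. (e, p) \<in> m \<Longrightarrow> p \<in> \<omega> e" using m unfolding PM by blast
    have uni: "\<And>q q' v. q \<in> m \<Longrightarrow> q' \<in> m \<Longrightarrow> v \<in> snd q \<Longrightarrow> v \<in> snd q' \<Longrightarrow> snd v < n \<Longrightarrow> q = q'"
    proof -
      fix q q' v assume q: "q \<in> m" "q' \<in> m" "v \<in> snd q" "v \<in> snd q'" "snd v < n"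
      then have "\<exists>!q. q \<in> m \<and> (fst v, snd v) \<in> snd q" using m unfolding PM by blast
      then show "q = q'" using q unfolding prod.collapse by blast
    qed
    define q where "q i k = (SOME q. q \<in> m \<and> (i, k) \<in> snd q)" for i k
    define l0 where "l0 i k = fst (q i k)" for i k
    define p0 where "p0 i k = snd (q i k)" for i k
    have l0: "(l0 i k, p0 i k) \<in> m \<and> (i, k) \<in> p0 i k" if "k < n" for i k
    proof -
      have "\<exists>q. q \<in> m \<and> (i, k) \<in> snd q" using m \<open>k < n\<close> unfolding PM by blast
      then have "q i k \<in> m \<and> (i, k) \<in> snd (q i k)" unfolding q_def by (rule someI_ex)
      then show ?thesis by (simp add: l0_def p0_def)
    qed
    define l where "l i = restrict (l0 i) {..<n}" for i
    have l: "(l i k, p0 i k) \<in> m" "(i, k) \<in> p0 i k" if "k < n" for i k using l0 that by (auto simp: l_def)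
    have key: "(e, p) \<in> m \<longleftrightarrow> case_prod l v = e" if p: "p \<in> \<omega> e" "v \<in> p" for e p v
    proof -
      obtain i k where v: "v = (i, k)" by (cases v)
      have k: "k < n" using facts(1)[of p e i k] p v by auto
      show ?thesis
      proof
        assume "(e, p) \<in> m"
        then have "(e, p) = (l i k, p0 i k)" using l[OF k] p v k by (intro uni[of _ _ v]) auto
        then show "case_prod l v = e" by (simp add: v)
      next
        assume "case_prod l v = e"
        then have e: "e = l i k" by (simp add: v)
        have "p = p0 i k" using sub l[OF k] p v e by (intro facts(3)[of _ e _ v]) auto
        then show "(e, p) \<in> m" using l[OF k] e by simp
      qed
    qed
    have "l \<in> labellings ends n"
    proof -
      have "l i k \<in> incident ends i" if "k < n" for i k
        using facts(1)[OF sub[OF l(1)] l(2)] that by (auto simp: incident_def)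
      then show ?thesis unfolding labellings_def by (intro PiE_I) (simp_all add: l_def)
    qed
    moreover have "compatible l e (\<omega> e)" for e unfolding compatible_def using key by blast
    moreover have "m = M l"
    proof -
      have "(e, p) \<in> m \<longleftrightarrow> p \<in> \<omega> e \<and> (\<forall>a\<in>p. case_prod l a = e)" for e p
        using key sub facts(4)[of p e] by blast
      then show ?thesis by (auto simp: M_def)
    qed
    ultimately show "m \<in> M ` {l \<in> labellings ends n. \<forall>e. compatible l e (\<omega> e)}" by blast
  qed
  then have "card {l \<in> labellings ends n. \<forall>e. compatible l e (\<omega> e)} = card PM" by (rule bij_betw_same_card)
  then show ?thesis by (simp add: num_pm_lift_def PM_def)
qed

text \<open>The counts are entries of real vectors, so the factorial is carried over to the reals;
  the floor is exact at the points of \<open>count_vectors\<close>.\<close>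

definition rfact :: "real \<Rightarrow> real" where
  "rfact x = fact (nat \<lfloor>x\<rfloor>)"

lemma rfact_of_nat [simp]: "rfact (real m) = fact m"
  by (simp add: rfact_def)

lemma rfact_pos [simp]: "rfact x > 0"
  by (simp add: rfact_def)

definition count_vectors :: "('e::finite \<Rightarrow> 'v::finite set) \<Rightarrow> nat \<Rightarrow> (real ^ 'e ^ 'e ^ 'v) set" where
  "count_vectors ends n = {x \<in> V_star ends. (\<forall>i e f. x $ i $ e $ f \<in> \<nat>) \<and>
     (\<forall>i. (\<Sum>e\<in>incident ends i. \<Sum>f\<in>incident ends i. x $ i $ e $ f) = real n)}"

definition edge_weight :: "('e::finite \<Rightarrow> 'v::finite set) \<Rightarrow> real ^ 'e ^ 'e ^ 'v \<Rightarrow> 'v \<Rightarrow> 'e \<Rightarrow> real" where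
  "edge_weight ends x i e = rfact (x $ i $ e $ e) * rfact (sigma_var ends x i e)
     * rfact (tau_var ends x i e) * rfact (gamma_var ends x i e)"

text \<open>The contribution to the second moment of the pairs of matchings with count vector \<open>x\<close>. The
  factor of an edge is split evenly between its two endpoints, hence the square roots.\<close>

definition count_term :: "('e::finite \<Rightarrow> 'v::finite set) \<Rightarrow> nat \<Rightarrow> real ^ 'e ^ 'e ^ 'v \<Rightarrow> real" where
  "count_term ends n x =
     (\<Prod>i\<in>UNIV. fact n / (\<Prod>e\<in>incident ends i. \<Prod>f\<in>incident ends i. rfact (x $ i $ e $ f))
       * (\<Prod>e\<in>incident ends i. sqrt (edge_weight ends x i e / fact n)))"

lemma card_fibre_matchings:
  fixes ends :: "'e::finite \<Rightarrow> 'v::finite set"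
  assumes "loopless ends"
  shows "card (fibre_matchings ends n e) = fact n"
proof -
  obtain i j where ij: "ends e = {i, j}" "i \<noteq> j"
    using assms unfolding loopless_def card_2_iff by blast
  have "card (fibre_matchings ends n e) = card {m \<in> fibre_matchings ends n e. \<forall>p\<in>m. \<forall>a\<in>p. \<forall>b\<in>p. (\<lambda>_. ()) a = (\<lambda>_. ()) b}"
    by simp
  also have "\<dots> = card (colour_bijections {..<n} {..<n} (\<lambda>_. ()) (\<lambda>_. ()))"
    by (rule card_coloured_fibre_matchings[where ends = ends and e = e, OF ij])
  also have "\<dots> = (\<Prod>c\<in>(UNIV::unit set). fact (card {a \<in> {..<n}. () = c}))"
    by (rule card_colour_bijections) auto
  also have "\<dots> = fact n" by (simp add: UNIV_unit)
  finally show ?thesis .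
qed

section \<open>The second moment as a sum over pairs of labellings\<close>

lemma second_moment_sum_lifts:
  fixes ends :: "'e::finite \<Rightarrow> 'v::finite set"
  assumes "loopless ends"
  shows "second_moment ends n =
    (\<Sum>\<omega>\<in>PiE UNIV (fibre_matchings ends n). (real (num_pm_lift n \<omega>))\<^sup>2) / fact n ^ CARD('e)"
proof -
  define \<Omega> where "\<Omega> = PiE UNIV (fibre_matchings ends n)"
  have FM: "finite (fibre_matchings ends n e)" "fibre_matchings ends n e \<noteq> {}" for e
    using card_fibre_matchings[OF assms, of n e] by (auto intro: card_ge_0_finite)
  have "PiE_dflt UNIV {} (fibre_matchings ends n) = \<Omega>"
    by (auto simp: PiE_dflt_def \<Omega>_def PiE_def extensional_def)
  then have rl: "random_lift ends n = pmf_of_set \<Omega>"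
    unfolding random_lift_def using FM by (subst Pi_pmf_of_set) auto
  have fin: "finite \<Omega>" unfolding \<Omega>_def using FM by (intro finite_PiE) auto
  have ne: "\<Omega> \<noteq> {}" unfolding \<Omega>_def using FM by (simp add: PiE_eq_empty_iff)
  have "card \<Omega> = fact n ^ CARD('e)"
    unfolding \<Omega>_def by (subst card_PiE) (auto simp: card_fibre_matchings[OF assms])
  then have "real (card \<Omega>) = fact n ^ CARD('e)" by simp
  then show ?thesis
    unfolding second_moment_def rl using fin ne by (simp add: integral_pmf_of_set \<Omega>_def[symmetric])
qed

text \<open>The square counts pairs of labellings compatible with the lift. After exchanging the
  sums, each pair counts the lifts compatible with it, and this number factors because every
  condition concerns the matching over a single edge.\<close>

lemma sum_lifts_eq_sum_labellings:
  fixes ends :: "'e::finite \<Rightarrow> 'v::finite set"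
  shows "(\<Sum>\<omega>\<in>PiE UNIV (fibre_matchings ends n). (num_pm_lift n \<omega>)\<^sup>2) =
    (\<Sum>l\<in>labellings ends n. \<Sum>l'\<in>labellings ends n.
       \<Prod>e\<in>UNIV. card {m \<in> fibre_matchings ends n e. compatible l e m \<and> compatible l' e m})"
proof -
  define \<Omega> where "\<Omega> = PiE UNIV (fibre_matchings ends n)"
  define L where "L = labellings ends n"
  have FMfin: "finite (fibre_matchings ends n e)" for e
  proof -
    have "fibre_matchings ends n e \<subseteq> Pow (Pow (UNIV \<times> {..<n}))"
    proof (rule subsetI)
      fix m assume "m \<in> fibre_matchings ends n e"
      from fibre_matchings_facts(1)[OF this] show "m \<in> Pow (Pow (UNIV \<times> {..<n}))" by fastforce
    qed
    then show ?thesis by (rule finite_subset) simp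
  qed
  have fin: "finite \<Omega>" unfolding \<Omega>_def using FMfin by (intro finite_PiE) auto
  have finL: "finite L" unfolding L_def labellings_def by (intro finite_PiE) auto
  have "(\<Sum>\<omega>\<in>\<Omega>. (num_pm_lift n \<omega>)\<^sup>2) = (\<Sum>\<omega>\<in>\<Omega>. \<Sum>l\<in>L. \<Sum>l'\<in>L. of_bool (\<forall>e. compatible l e (\<omega> e) \<and> compatible l' e (\<omega> e)))"
  proof (rule sum.cong[OF refl])
    fix \<omega> assume "\<omega> \<in> \<Omega>"
    then have "num_pm_lift n \<omega> = card {l \<in> L. \<forall>e. compatible l e (\<omega> e)}"
      unfolding L_def by (intro num_pm_lift_eq) (auto simp: \<Omega>_def)
    also have "\<dots> = (\<Sum>l\<in>L. of_bool (\<forall>e. compatible l e (\<omega> e)))"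
      using finL by (simp add: Int_def of_bool_def sum.If_cases)
    finally have "(num_pm_lift n \<omega>)\<^sup>2 = (\<Sum>l\<in>L. \<Sum>l'\<in>L. of_bool (\<forall>e. compatible l e (\<omega> e)) * of_bool (\<forall>e. compatible l' e (\<omega> e)))"
      by (simp add: power2_eq_square sum_product)
    then show "(num_pm_lift n \<omega>)\<^sup>2 = (\<Sum>l\<in>L. \<Sum>l'\<in>L. of_bool (\<forall>e. compatible l e (\<omega> e) \<and> compatible l' e (\<omega> e)))"
      by (simp add: all_conj_distrib flip: of_bool_conj)
  qed
  also have "\<dots> = (\<Sum>l\<in>L. \<Sum>l'\<in>L. \<Sum>\<omega>\<in>\<Omega>. of_bool (\<forall>e. compatible l e (\<omega> e) \<and> compatible l' e (\<omega> e)))"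
    by (subst sum.swap) (intro sum.cong refl sum.swap)
  also have "\<dots> = (\<Sum>l\<in>L. \<Sum>l'\<in>L. \<Prod>e\<in>UNIV. card {m \<in> fibre_matchings ends n e. compatible l e m \<and> compatible l' e m})"
  proof (intro sum.cong refl)
    fix l l'
    have "(\<Sum>\<omega>\<in>\<Omega>. of_bool (\<forall>e. compatible l e (\<omega> e) \<and> compatible l' e (\<omega> e)))
      = card {\<omega> \<in> \<Omega>. \<forall>e. compatible l e (\<omega> e) \<and> compatible l' e (\<omega> e)}"
      using fin by (simp add: Int_def of_bool_def sum.If_cases)
    also have "{\<omega> \<in> \<Omega>. \<forall>e. compatible l e (\<omega> e) \<and> compatible l' e (\<omega> e)}
      = PiE UNIV (\<lambda>e. {m \<in> fibre_matchings ends n e. compatible l e m \<and> compatible l' e m})"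
      by (auto simp: \<Omega>_def)
    finally show "(\<Sum>\<omega>\<in>\<Omega>. of_bool (\<forall>e. compatible l e (\<omega> e) \<and> compatible l' e (\<omega> e)))
      = (\<Prod>e\<in>UNIV. card {m \<in> fibre_matchings ends n e. compatible l e m \<and> compatible l' e m})"
      by (simp add: card_PiE)
  qed
  finally show ?thesis by (simp add: \<Omega>_def L_def)
qed

definition pair_labellings :: "('e::finite \<Rightarrow> 'v::finite set) \<Rightarrow> nat \<Rightarrow> ('v \<Rightarrow> nat \<Rightarrow> 'e \<times> 'e) set" where
  "pair_labellings ends n = (PiE UNIV (\<lambda>i. {..<n} \<rightarrow>\<^sub>E incident ends i \<times> incident ends i))"

text \<open>The four colours of the vertices over \<open>i\<close> have class sizes x_iee,
  \<sigma>_ie, \<tau>_ie and \<gamma>_ie (\<open>pair_counts_classes\<close>): this is where the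
  arguments of \<open>phi\<close> come from.\<close>

definition pair_colour :: "('v \<Rightarrow> nat \<Rightarrow> 'e \<times> 'e) \<Rightarrow> 'e \<Rightarrow> 'v \<times> nat \<Rightarrow> bool \<times> bool" where
  "pair_colour u e a = (fst (u (fst a) (snd a)) = e, snd (u (fst a) (snd a)) = e)"

text \<open>Two labellings are zipped into one with values in pairs; compatibility with both then
  says that all edges over e are monochromatic for \<open>pair_colour\<close>.\<close>

lemma sum_labellings_eq_sum_pair_labellings:
  fixes ends :: "'e::finite \<Rightarrow> 'v::finite set"
  shows "(\<Sum>l\<in>labellings ends n. \<Sum>l'\<in>labellings ends n.
       \<Prod>e\<in>UNIV. card {m \<in> fibre_matchings ends n e. compatible l e m \<and> compatible l' e m}) =
    (\<Sum>u\<in>pair_labellings ends n.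
       \<Prod>e\<in>UNIV. card {m \<in> fibre_matchings ends n e. \<forall>p\<in>m. \<forall>a\<in>p. \<forall>b\<in>p. pair_colour u e a = pair_colour u e b})"
proof -
  define j where "j = (\<lambda>(l, l') (i :: 'v). restrict (\<lambda>k. (l i k :: 'e, l' i k :: 'e)) {..<n})"
  define j' where "j' u = ((\<lambda>i. restrict (\<lambda>k. fst (u i k)) {..<n}), (\<lambda>i. restrict (\<lambda>k. snd (u i k)) {..<n}))"
    for u :: "'v \<Rightarrow> nat \<Rightarrow> 'e \<times> 'e"
  define X where "X = labellings ends n \<times> labellings ends n"
  have PL: "l \<in> labellings ends n \<longleftrightarrow> (\<forall>i k. (k < n \<longrightarrow> l i k \<in> incident ends i) \<and> (\<not> k < n \<longrightarrow> l i k = undefined))" for l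
    by (auto simp: labellings_def PiE_iff extensional_def)
  have PP: "u \<in> pair_labellings ends n \<longleftrightarrow> (\<forall>i k. (k < n \<longrightarrow> u i k \<in> incident ends i \<times> incident ends i) \<and> (\<not> k < n \<longrightarrow> u i k = undefined))" for u
    by (auto simp: pair_labellings_def PiE_iff extensional_def)
  have bij: "bij_betw j X (pair_labellings ends n)"
  proof (rule bij_betw_byWitness[where f' = j'])
    show "\<forall>a\<in>X. j' (j a) = a"
      by (auto simp: X_def PL j_def j'_def fun_eq_iff restrict_def)
    show "\<forall>u\<in>pair_labellings ends n. j (j' u) = u"
      by (auto simp: PP j_def j'_def fun_eq_iff restrict_def)
    show "j ` X \<subseteq> pair_labellings ends n" by (auto simp: X_def PL PP j_def)
    show "j' ` pair_labellings ends n \<subseteq> X"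
    proof
      fix y assume "y \<in> j' ` pair_labellings ends n"
      then obtain u where u: "u \<in> pair_labellings ends n" "y = j' u" by blast
      have "fst (u i k) \<in> incident ends i \<and> snd (u i k) \<in> incident ends i" if "k < n" for i k
        using u(1) that unfolding PP mem_Times_iff by blast
      then show "y \<in> X" by (simp add: u(2) X_def PL j'_def)
    qed
  qed
  have eq: "(compatible l e m \<and> compatible l' e m) \<longleftrightarrow>
      (\<forall>p\<in>m. \<forall>a\<in>p. \<forall>b\<in>p. pair_colour (j (l, l')) e a = pair_colour (j (l, l')) e b)"
    if m: "m \<in> fibre_matchings ends n e" for l l' e m
  proof -
    have pc: "pair_colour (j (l, l')) e a = (case_prod l a = e, case_prod l' a = e)" if "p \<in> m" "a \<in> p" for p a
    proof -
      have "snd a < n" using fibre_matchings_facts(1)[OF m that(1), of "fst a" "snd a"] that(2) by simp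
      then show ?thesis by (simp add: pair_colour_def j_def case_prod_unfold)
    qed
    have "(\<forall>p\<in>m. \<forall>a\<in>p. \<forall>b\<in>p. pair_colour (j (l, l')) e a = pair_colour (j (l, l')) e b) \<longleftrightarrow>
      (\<forall>p\<in>m. \<forall>a\<in>p. \<forall>b\<in>p. (case_prod l a = e, case_prod l' a = e) = (case_prod l b = e, case_prod l' b = e))"
      by (intro ball_cong refl) (simp only: pc)
    then show ?thesis unfolding compatible_def prod.inject ball_conj_distrib by (rule sym)
  qed
  define h where "h u = (\<Prod>e\<in>UNIV. card {m \<in> fibre_matchings ends n e. \<forall>p\<in>m. \<forall>a\<in>p. \<forall>b\<in>p. pair_colour u e a = pair_colour u e b})" for u
  have "(\<Sum>u\<in>pair_labellings ends n. h u) = (\<Sum>x\<in>X. h (j x))"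
    using sum.reindex_bij_betw[OF bij, of h] by simp
  also have "\<dots> = (\<Sum>l\<in>labellings ends n. \<Sum>l'\<in>labellings ends n. h (j (l, l')))"
    unfolding X_def by (simp add: sum.cartesian_product)
  also have "\<dots> = (\<Sum>l\<in>labellings ends n. \<Sum>l'\<in>labellings ends n.
       \<Prod>e\<in>UNIV. card {m \<in> fibre_matchings ends n e. compatible l e m \<and> compatible l' e m})"
  proof (intro sum.cong refl)
    fix l l'
    have "{m \<in> fibre_matchings ends n e. \<forall>p\<in>m. \<forall>a\<in>p. \<forall>b\<in>p. pair_colour (j (l, l')) e a = pair_colour (j (l, l')) e b}
       = {m \<in> fibre_matchings ends n e. compatible l e m \<and> compatible l' e m}" for e
      by (rule Collect_cong) (metis eq)
    then show "h (j (l, l')) = (\<Prod>e\<in>UNIV. card {m \<in> fibre_matchings ends n e. compatible l e m \<and> compatible l' e m})"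
      unfolding h_def by (simp only:)
  qed
  finally show ?thesis by (simp only: h_def)
qed

lemma sum_Times: "(\<Sum>p\<in>A \<times> B. g p) = (\<Sum>a\<in>A. \<Sum>b\<in>B. g (a, b))"
  by (simp add: sum.cartesian_product)

lemma card_vimage_sum:
  assumes "finite A" "finite K"
  shows "card {k \<in> K. u k \<in> A} = (\<Sum>p\<in>A. card {k \<in> K. u k = p})"
proof -
  have eq: "{k \<in> K. u k \<in> A} = (\<Union>p\<in>A. {k \<in> K. u k = p})" by auto
  show ?thesis unfolding eq by (rule card_UN_disjoint) (use assms in auto)
qed

section \<open>Grouping the pairs by their counts\<close>

definition pair_counts :: "nat \<Rightarrow> ('v::finite \<Rightarrow> nat \<Rightarrow> 'e::finite \<times> 'e) \<Rightarrow> real ^ 'e ^ 'e ^ 'v" where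
  "pair_counts n u = (\<chi> i e f. real (card {k \<in> {..<n}. u i k = (e, f)}))"

lemma pair_counts_nth: "pair_counts n u $ i $ e $ f = real (card {k \<in> {..<n}. u i k = (e, f)})"
  by (simp add: pair_counts_def)

lemma pair_counts_classes:
  fixes ends :: "'e::finite \<Rightarrow> 'v::finite set"
  assumes u: "u \<in> pair_labellings ends n" and e: "e \<in> incident ends i"
  defines "x \<equiv> pair_counts n u" and "N \<equiv> \<lambda>c. card {k \<in> {..<n}. pair_colour u e (i, k) = c}"
  shows "x $ i $ e $ e = real (N (True, True))"
    and "sigma_var ends x i e = real (N (True, False))"
    and "tau_var ends x i e = real (N (False, True))"
    and "gamma_var ends x i e = real (N (False, False))"
proof -
  define I where "I = incident ends i"
  have uI: "u i k \<in> I \<times> I" if "k < n" for k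
    using u that by (auto simp: pair_labellings_def PiE_iff I_def)
  have c: "card {k \<in> {..<n}. u i k \<in> A} = (\<Sum>p\<in>A. card {k \<in> {..<n}. u i k = p})" if "finite A" for A
    by (rule card_vimage_sum) (use that in auto)
  have s: "N (True, True) = card {k \<in> {..<n}. u i k \<in> {(e, e)}}"
    "N (True, False) = card {k \<in> {..<n}. u i k \<in> {e} \<times> (I - {e})}"
    "N (False, True) = card {k \<in> {..<n}. u i k \<in> (I - {e}) \<times> {e}}"
    "N (False, False) = card {k \<in> {..<n}. u i k \<in> (I - {e}) \<times> (I - {e})}"
    unfolding N_def pair_colour_def by (rule arg_cong[where f = card]; use uI in \<open>force\<close>)+
  show "x $ i $ e $ e = real (N (True, True))" unfolding s(1) by (simp add: x_def pair_counts_nth)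
  show "sigma_var ends x i e = real (N (True, False))"
    unfolding s(2) by (subst c) (auto simp: sigma_var_def x_def pair_counts_nth I_def[symmetric] sum_Times)
  show "tau_var ends x i e = real (N (False, True))"
    unfolding s(3) by (subst c) (auto simp: tau_var_def x_def pair_counts_nth I_def[symmetric] sum_Times)
  show "gamma_var ends x i e = real (N (False, False))"
    unfolding s(4) by (subst c) (auto simp: gamma_var_def x_def pair_counts_nth I_def[symmetric] sum_Times)
qed

text \<open>The pairs are split by membership in row e and column e. Once the total is fixed, the
  conditions of \<open>V_star\<close> on the diagonal entry and on row and column sums therefore
  amount to equality of all four class sizes at both ends of e.\<close>

lemma total_split:
  fixes ends :: "'e::finite \<Rightarrow> 'v::finite set"
  assumes e: "e \<in> incident ends i"
  shows "(\<Sum>f\<in>incident ends i. x $ i $ e $ f) = x $ i $ e $ e + sigma_var ends x i e"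
    and "(\<Sum>f\<in>incident ends i. x $ i $ f $ e) = x $ i $ e $ e + tau_var ends x i e"
    and "(\<Sum>e\<in>incident ends i. \<Sum>f\<in>incident ends i. x $ i $ e $ f)
      = x $ i $ e $ e + sigma_var ends x i e + tau_var ends x i e + gamma_var ends x i e"
proof -
  show 1: "(\<Sum>f\<in>incident ends i. x $ i $ e $ f) = x $ i $ e $ e + sigma_var ends x i e"
    using e by (simp add: sigma_var_def sum.remove[of "incident ends i" e])
  show "(\<Sum>f\<in>incident ends i. x $ i $ f $ e) = x $ i $ e $ e + tau_var ends x i e"
    using e by (simp add: tau_var_def sum.remove[of "incident ends i" e])
  have "(\<Sum>e'\<in>incident ends i. \<Sum>f\<in>incident ends i. x $ i $ e' $ f)
     = (\<Sum>f\<in>incident ends i. x $ i $ e $ f) + (\<Sum>e'\<in>incident ends i - {e}. \<Sum>f\<in>incident ends i. x $ i $ e' $ f)"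
    using e by (simp add: sum.remove[of "incident ends i" e])
  also have "(\<Sum>e'\<in>incident ends i - {e}. \<Sum>f\<in>incident ends i. x $ i $ e' $ f)
     = (\<Sum>e'\<in>incident ends i - {e}. x $ i $ e' $ e + (\<Sum>f\<in>incident ends i - {e}. x $ i $ e' $ f))"
    using e by (intro sum.cong refl) (simp add: sum.remove[of "incident ends i" e])
  also have "\<dots> = tau_var ends x i e + gamma_var ends x i e"
    by (simp add: sum.distrib tau_var_def gamma_var_def)
  finally show "(\<Sum>e\<in>incident ends i. \<Sum>f\<in>incident ends i. x $ i $ e $ f)
      = x $ i $ e $ e + sigma_var ends x i e + tau_var ends x i e + gamma_var ends x i e"
    unfolding 1 by simp
qed

lemma pair_counts_props:
  fixes ends :: "'e::finite \<Rightarrow> 'v::finite set"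
  assumes u: "u \<in> pair_labellings ends n"
  shows "pair_counts n u \<in> var_space ends"
    and "pair_counts n u $ i $ e $ f \<in> \<nat>"
    and "(\<Sum>e\<in>incident ends i. \<Sum>f\<in>incident ends i. pair_counts n u $ i $ e $ f) = real n"
proof -
  have uI: "u i k \<in> incident ends i \<times> incident ends i" if "k < n" for i k
    using u that by (auto simp: pair_labellings_def PiE_iff)
  have "{k \<in> {..<n}. u i k = (e, f)} = {}" if "\<not> (e \<in> incident ends i \<and> f \<in> incident ends i)" for i e f
    using uI[of _ i] that by force
  then show "pair_counts n u \<in> var_space ends" unfolding var_space_def by (simp add: pair_counts_nth)
  show "pair_counts n u $ i $ e $ f \<in> \<nat>" by (simp add: pair_counts_nth)
  have "(\<Sum>e\<in>incident ends i. \<Sum>f\<in>incident ends i. pair_counts n u $ i $ e $ f)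
    = real (\<Sum>p\<in>incident ends i \<times> incident ends i. card {k \<in> {..<n}. u i k = p})"
    by (simp add: pair_counts_nth sum.cartesian_product case_prod_unfold)
  also have "(\<Sum>p\<in>incident ends i \<times> incident ends i. card {k \<in> {..<n}. u i k = p})
    = card {k \<in> {..<n}. u i k \<in> incident ends i \<times> incident ends i}"
    by (rule card_vimage_sum[symmetric]) auto
  also have "{k \<in> {..<n}. u i k \<in> incident ends i \<times> incident ends i} = {..<n}" using uI by auto
  finally show "(\<Sum>e\<in>incident ends i. \<Sum>f\<in>incident ends i. pair_counts n u $ i $ e $ f) = real n" by simp
qed

text \<open>Colour-preserving matchings over e exist exactly if the class sizes at its two ends
  agree, and all edges together give membership in \<open>V_star\<close>. Their number is then a
  product of four factorials, the same seen from either end; writing it as a product of two square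
  roots turns the product over edges into one over vertices.\<close>

lemma prod_pair_coloured_matchings:
  fixes ends :: "'e::finite \<Rightarrow> 'v::finite set"
  assumes ll: "loopless ends" and u: "u \<in> pair_labellings ends n"
  defines "x \<equiv> pair_counts n u"
  shows "real (\<Prod>e\<in>UNIV. card {m \<in> fibre_matchings ends n e. \<forall>p\<in>m. \<forall>a\<in>p. \<forall>b\<in>p. pair_colour u e a = pair_colour u e b})
    = (if x \<in> V_star ends then \<Prod>i\<in>UNIV. \<Prod>e\<in>incident ends i. sqrt (edge_weight ends x i e) else 0)"
proof -
  define M where "M e = card {m \<in> fibre_matchings ends n e. \<forall>p\<in>m. \<forall>a\<in>p. \<forall>b\<in>p. pair_colour u e a = pair_colour u e b}" for e
  define N where "N i e c = card {k \<in> {..<n}. pair_colour u e (i, k) = c}" for i e c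
  define E where "E e \<longleftrightarrow> (\<forall>i\<in>ends e. \<forall>j\<in>ends e. \<forall>c. N i e c = N j e c)" for e
  note cl = pair_counts_classes[OF u, folded x_def N_def]
  note props = pair_counts_props[OF u, folded x_def]
  have inc: "e \<in> incident ends i \<longleftrightarrow> i \<in> ends e" for e i by (simp add: incident_def)
  have M: "real (M e) = (if E e then \<Prod>i\<in>ends e. sqrt (edge_weight ends x i e) else 0)" for e
  proof -
    obtain i j where ij: "ends e = {i, j}" "i \<noteq> j" using ll unfolding loopless_def card_2_iff by blast
    have Mc: "M e = card (colour_bijections {..<n} {..<n} (\<lambda>k. pair_colour u e (i, k)) (\<lambda>k. pair_colour u e (j, k)))"
      unfolding M_def by (rule card_coloured_fibre_matchings[where ends = ends and e = e, OF ij])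
    show ?thesis
    proof (cases "E e")
      case True
      then have eq: "N i e c = N j e c" for c unfolding E_def ij(1) by blast
      have "M e = (\<Prod>c\<in>UNIV. fact (N i e c))"
        unfolding Mc N_def
        by (rule card_colour_bijections[where A = "{..<n}" and B = "{..<n}" and ca = "\<lambda>k. pair_colour u e (i, k)"
              and cb = "\<lambda>k. pair_colour u e (j, k)", OF finite_lessThan finite_lessThan eq[unfolded N_def]])
      also have "real \<dots> = edge_weight ends x i e"
      proof -
        have U: "(UNIV :: (bool \<times> bool) set) = {(True, True), (True, False), (False, True), (False, False)}" by auto
        have "e \<in> incident ends i" using ij by (simp add: inc)
        then show ?thesis unfolding U by (simp add: edge_weight_def cl)
      qed
      finally have Mi: "real (M e) = edge_weight ends x i e" .
      have "edge_weight ends x j e = edge_weight ends x i e"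
        using ij by (simp add: edge_weight_def cl inc eq)
      then have "(\<Prod>i\<in>ends e. sqrt (edge_weight ends x i e)) = sqrt (edge_weight ends x i e) * sqrt (edge_weight ends x i e)"
        using ij by simp
      also have "\<dots> = edge_weight ends x i e" by (simp add: edge_weight_def less_imp_le)
      finally show ?thesis using Mi True by simp
    next
      case False
      have "colour_bijections {..<n} {..<n} (\<lambda>k. pair_colour u e (i, k)) (\<lambda>k. pair_colour u e (j, k)) = {}"
      proof (rule ccontr)
        assume "\<not> ?thesis"
        then obtain f where "f \<in> colour_bijections {..<n} {..<n} (\<lambda>k. pair_colour u e (i, k)) (\<lambda>k. pair_colour u e (j, k))" by blast
        from colour_bijections_card_eq[where A = "{..<n}" and B = "{..<n}" and ca = "\<lambda>k. pair_colour u e (i, k)"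
              and cb = "\<lambda>k. pair_colour u e (j, k)", OF this] have ne: "N i e c = N j e c" for c unfolding N_def .
        have "E e" unfolding E_def ij(1) by (simp add: ne)
        then show False using False by contradiction
      qed
      then show ?thesis using False by (simp add: Mc)
    qed
  qed
  have EV: "(\<forall>e. E e) \<longleftrightarrow> x \<in> V_star ends"
  proof -
    have all4: "(\<forall>c :: bool \<times> bool. P c) \<longleftrightarrow> P (True, True) \<and> P (True, False) \<and> P (False, True) \<and> P (False, False)" for P
      by (metis (full_types) surj_pair)
    have "(\<forall>c. N i e c = N j e c) \<longleftrightarrow> x $ i $ e $ e = x $ j $ e $ e \<and> sigma_var ends x i e = sigma_var ends x j e
        \<and> tau_var ends x i e = tau_var ends x j e \<and> gamma_var ends x i e = gamma_var ends x j e"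
      if "i \<in> ends e" "j \<in> ends e" for i j e
      using that by (simp only: all4 inc[symmetric] cl of_nat_eq_iff)
    then have "E e \<longleftrightarrow> (\<forall>i\<in>ends e. \<forall>j\<in>ends e. x $ i $ e $ e = x $ j $ e $ e \<and> sigma_var ends x i e = sigma_var ends x j e
        \<and> tau_var ends x i e = tau_var ends x j e \<and> gamma_var ends x i e = gamma_var ends x j e)" for e
      unfolding E_def by (intro ball_cong refl) simp
    moreover have "x $ i $ e $ e = x $ j $ e $ e \<and> sigma_var ends x i e = sigma_var ends x j e
        \<and> tau_var ends x i e = tau_var ends x j e \<and> gamma_var ends x i e = gamma_var ends x j e \<longleftrightarrow>
        x $ i $ e $ e = x $ j $ e $ e \<and>
     (\<Sum>f\<in>incident ends i. x $ i $ e $ f) = (\<Sum>f\<in>incident ends j. x $ j $ e $ f) \<and>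
     (\<Sum>f\<in>incident ends i. x $ i $ f $ e) = (\<Sum>f\<in>incident ends j. x $ j $ f $ e)"
      if "i \<in> ends e" "j \<in> ends e" for i j e
    proof -
      have ii: "e \<in> incident ends i" "e \<in> incident ends j" using that by (simp_all add: inc)
      note t = total_split[OF ii(1), where x = x] total_split[OF ii(2), where x = x]
      show ?thesis unfolding t(1,2,4,5) using t(3,6) props(3)[of i] props(3)[of j] by auto
    qed
    ultimately have "E e \<longleftrightarrow> (\<forall>i\<in>ends e. \<forall>j\<in>ends e. x $ i $ e $ e = x $ j $ e $ e \<and>
     (\<Sum>f\<in>incident ends i. x $ i $ e $ f) = (\<Sum>f\<in>incident ends j. x $ j $ e $ f) \<and>
     (\<Sum>f\<in>incident ends i. x $ i $ f $ e) = (\<Sum>f\<in>incident ends j. x $ j $ f $ e))" for e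
      by (simp only: cong: ball_cong)
    then show ?thesis unfolding V_star_def using props(1) by (simp only: mem_Collect_eq simp_thms)
  qed
  have "real (\<Prod>e\<in>UNIV. M e) = (\<Prod>e\<in>UNIV. real (M e))" by simp
  also have "\<dots> = (if x \<in> V_star ends then \<Prod>e\<in>UNIV. \<Prod>i\<in>ends e. sqrt (edge_weight ends x i e) else 0)"
    unfolding EV[symmetric] M by auto
  also have "(\<Prod>e\<in>UNIV. \<Prod>i\<in>ends e. sqrt (edge_weight ends x i e))
      = (\<Prod>i\<in>UNIV. \<Prod>e\<in>incident ends i. sqrt (edge_weight ends x i e))"
    using prod.swap_restrict[of UNIV UNIV "\<lambda>e i. sqrt (edge_weight ends x i e)" "\<lambda>e i. i \<in> ends e"]
    by (simp add: incident_def)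
  finally show ?thesis by (simp only: M_def)
qed

text \<open>The labellings of different fibres are independent, and each fibre contributes a
  multinomial coefficient.\<close>

lemma card_pair_labellings_with_counts:
  fixes ends :: "'e::finite \<Rightarrow> 'v::finite set"
  assumes x: "x \<in> count_vectors ends n"
  shows "real (card {u \<in> pair_labellings ends n. pair_counts n u = x})
    = (\<Prod>i\<in>UNIV. fact n / (\<Prod>e\<in>incident ends i. \<Prod>f\<in>incident ends i. rfact (x $ i $ e $ f)))"
proof -
  define N where "N i p = nat \<lfloor>x $ i $ fst p $ snd p\<rfloor>" for i and p :: "'e \<times> 'e"
  have xN: "x $ i $ e $ f = real (N i (e, f))" for i e f
  proof -
    have "x $ i $ e $ f \<in> \<nat>" using x by (simp add: count_vectors_def)
    then show ?thesis by (auto simp: N_def elim!: Nats_cases)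
  qed
  define Y where "Y i = {l \<in> {..<n} \<rightarrow>\<^sub>E incident ends i \<times> incident ends i.
    \<forall>c\<in>incident ends i \<times> incident ends i. card {a \<in> {..<n}. l a = c} = N i c}" for i
  have "{u \<in> pair_labellings ends n. pair_counts n u = x} = PiE UNIV Y"
  proof (intro equalityI subsetI)
    fix u assume "u \<in> {u \<in> pair_labellings ends n. pair_counts n u = x}"
    then have u: "u \<in> pair_labellings ends n" "pair_counts n u = x" by simp_all
    have "real (card {a \<in> {..<n}. u i a = (e, f)}) = real (N i (e, f))" for i e f
      using u(2) by (simp only: xN[symmetric] pair_counts_nth[symmetric])
    then show "u \<in> PiE UNIV Y" using u(1) by (auto simp: Y_def pair_labellings_def PiE_iff)
  next
    fix u assume u: "u \<in> PiE UNIV Y"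
    then have u1: "u \<in> pair_labellings ends n" by (auto simp: Y_def pair_labellings_def PiE_iff)
    have "pair_counts n u $ i $ e $ f = x $ i $ e $ f" for i e f
    proof (cases "e \<in> incident ends i \<and> f \<in> incident ends i")
      case True
      then show ?thesis using u by (auto simp: Y_def PiE_iff pair_counts_nth xN)
    next
      case False
      have "x \<in> var_space ends" using x by (simp add: count_vectors_def V_star_def)
      then show ?thesis using pair_counts_props(1)[OF u1] False unfolding var_space_def by simp
    qed
    then show "u \<in> {u \<in> pair_labellings ends n. pair_counts n u = x}" using u1 by (simp add: Finite_Cartesian_Product.vec_eq_iff)
  qed
  then have "real (card {u \<in> pair_labellings ends n. pair_counts n u = x}) = (\<Prod>i\<in>UNIV. real (card (Y i)))"
    by (simp add: card_PiE)
  also have "\<dots> = (\<Prod>i\<in>UNIV. fact n / (\<Prod>e\<in>incident ends i. \<Prod>f\<in>incident ends i. rfact (x $ i $ e $ f)))"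
  proof (rule prod.cong[OF refl])
    fix i
    have "real (\<Sum>p\<in>incident ends i \<times> incident ends i. N i p) = (\<Sum>e\<in>incident ends i. \<Sum>f\<in>incident ends i. x $ i $ e $ f)"
      by (simp add: xN sum.cartesian_product case_prod_unfold)
    also have "\<dots> = real n" using x by (simp add: count_vectors_def)
    finally have "(\<Sum>p\<in>incident ends i \<times> incident ends i. N i p) = card {..<n}"
      unfolding of_nat_eq_iff by simp
    from card_functions_with_counts[OF _ _ this]
    have "real (card (Y i)) = fact n / (\<Prod>p\<in>incident ends i \<times> incident ends i. fact (N i p))" by (simp add: Y_def)
    then show "real (card (Y i)) = fact n / (\<Prod>e\<in>incident ends i. \<Prod>f\<in>incident ends i. rfact (x $ i $ e $ f))"
      by (simp add: xN prod.cartesian_product case_prod_unfold)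
  qed
  finally show ?thesis .
qed

lemma prod_power_degree:
  fixes ends :: "'e::finite \<Rightarrow> 'v::finite set"
  assumes "loopless ends" "c \<ge> 0"
  shows "(\<Prod>i\<in>UNIV. \<Prod>e\<in>incident ends i. sqrt c) = c ^ CARD('e)"
proof -
  have "(\<Prod>i\<in>UNIV. \<Prod>e\<in>incident ends i. sqrt c) = (\<Prod>e\<in>(UNIV::'e set). \<Prod>i\<in>ends e. sqrt c)"
    using prod.swap_restrict[of "UNIV :: 'e set" "UNIV :: 'v set" "\<lambda>e i. sqrt c" "\<lambda>e i. i \<in> ends e"]
    by (simp add: incident_def)
  also have "\<dots> = c ^ CARD('e)" using assms by (simp add: loopless_def)
  finally show ?thesis .
qed

text \<open>The weight of a pair labelling depends on its counts only and vanishes off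
  \<open>V_star\<close>. The division by the number n!^|E| of lifts is distributed as 1 / sqrt (n!)
  to each end of each edge.\<close>

theorem second_moment_eq:
  fixes ends :: "'e::finite \<Rightarrow> 'v::finite set"
  assumes ll: "loopless ends"
  shows "finite (count_vectors ends n)"
    and "second_moment ends n = (\<Sum>x\<in>count_vectors ends n. count_term ends n x)"
proof -
  define LL where "LL = pair_labellings ends n"
  define w where "w x = (\<Prod>i\<in>UNIV. \<Prod>e\<in>incident ends i. sqrt (edge_weight ends x i e))" for x
  have finLL: "finite LL" unfolding LL_def pair_labellings_def by (intro finite_PiE) auto
  have cv: "pair_counts n u \<in> count_vectors ends n \<longleftrightarrow> pair_counts n u \<in> V_star ends" if "u \<in> LL" for u
    using pair_counts_props[OF that[unfolded LL_def]] by (auto simp: count_vectors_def)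
  have sub: "count_vectors ends n \<subseteq> pair_counts n ` LL"
  proof
    fix x assume x: "x \<in> count_vectors ends n"
    have "real (card {u \<in> LL. pair_counts n u = x}) > 0"
      unfolding LL_def card_pair_labellings_with_counts[OF x] by (intro prod_pos divide_pos_pos ballI) auto
    then have "{u \<in> LL. pair_counts n u = x} \<noteq> {}" by (auto simp: card_gt_0_iff)
    then show "x \<in> pair_counts n ` LL" by blast
  qed
  then show "finite (count_vectors ends n)" using finLL finite_surj by blast
  have "(\<Sum>\<omega>\<in>PiE UNIV (fibre_matchings ends n). (real (num_pm_lift n \<omega>))\<^sup>2)
     = real (\<Sum>\<omega>\<in>PiE UNIV (fibre_matchings ends n). (num_pm_lift n \<omega>)\<^sup>2)" by simp
  also have "\<dots> = (\<Sum>u\<in>LL. if pair_counts n u \<in> V_star ends then w (pair_counts n u) else 0)"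
    unfolding sum_lifts_eq_sum_labellings sum_labellings_eq_sum_pair_labellings of_nat_sum LL_def w_def
    by (rule sum.cong[OF refl]) (rule prod_pair_coloured_matchings[OF ll])
  also have "\<dots> = (\<Sum>x\<in>pair_counts n ` LL. \<Sum>u\<in>{u \<in> LL. pair_counts n u = x}. if pair_counts n u \<in> V_star ends then w (pair_counts n u) else 0)"
    by (rule sum.image_gen[OF finLL])
  also have "\<dots> = (\<Sum>x\<in>pair_counts n ` LL. real (card {u \<in> LL. pair_counts n u = x}) * (if x \<in> V_star ends then w x else 0))"
    by (rule sum.cong[OF refl]) simp
  also have "\<dots> = (\<Sum>x\<in>count_vectors ends n. real (card {u \<in> LL. pair_counts n u = x}) * (if x \<in> V_star ends then w x else 0))"
    by (rule sum.mono_neutral_right) (use finLL sub cv in auto)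
  also have "\<dots> = (\<Sum>x\<in>count_vectors ends n. count_term ends n x * fact n ^ CARD('e))"
  proof (rule sum.cong[OF refl])
    fix x assume x: "x \<in> count_vectors ends n"
    have "(\<Prod>i\<in>UNIV. \<Prod>e\<in>incident ends i. sqrt (edge_weight ends x i e / fact n)) * fact n ^ CARD('e) = w x"
      unfolding prod_power_degree[OF ll fact_ge_zero, symmetric] w_def
      by (simp only: prod.distrib[symmetric] real_sqrt_mult[symmetric]) simp
    moreover have "x \<in> V_star ends" using x by (simp add: count_vectors_def)
    ultimately show "real (card {u \<in> LL. pair_counts n u = x}) * (if x \<in> V_star ends then w x else 0) = count_term ends n x * fact n ^ CARD('e)"
      unfolding LL_def card_pair_labellings_with_counts[OF x] count_term_def prod.distrib by simp
  qed
  finally show "second_moment ends n = (\<Sum>x\<in>count_vectors ends n. count_term ends n x)"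
    unfolding second_moment_sum_lifts[OF ll] by (simp add: sum_distrib_right[symmetric])
qed

section \<open>The entropy bound at a vertex of degree three\<close>

text \<open>A sum-of-squares certificate for the bound 4/3 on the square of the form at unit
  vectors. The squares vanish together at s_k = 1 / sqrt 3, c_k = sqrt (2/3), where the bound is
  attained.\<close>

lemma w_form_identity:
  fixes s1 s2 s3 c1 c2 c3 :: real
  shows "4 / 3 * ((s1\<^sup>2 + c1\<^sup>2) * (s2\<^sup>2 + c2\<^sup>2) * (s3\<^sup>2 + c3\<^sup>2)) - (s1 * c2 * c3 + c1 * s2 * c3 + c1 * c2 * s3)\<^sup>2
    = 1 / 3 * (s1\<^sup>2 + c1\<^sup>2) * ((s2 * c3 - c2 * s3)\<^sup>2 + (2 * s2 * s3 - c2 * c3)\<^sup>2)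
      + (s1 * (s2 * c3 + c2 * s3) - c1 * c2 * c3)\<^sup>2"
  by (simp add: power2_eq_square field_simps)

lemma w_form_le:
  fixes s1 s2 s3 c1 c2 c3 :: real
  shows "s1 * c2 * c3 + c1 * s2 * c3 + c1 * c2 * s3
    \<le> sqrt (4 / 3) * (sqrt (s1\<^sup>2 + c1\<^sup>2) * sqrt (s2\<^sup>2 + c2\<^sup>2) * sqrt (s3\<^sup>2 + c3\<^sup>2))"
proof -
  have "1 / 3 * (s1\<^sup>2 + c1\<^sup>2) * ((s2 * c3 - c2 * s3)\<^sup>2 + (2 * s2 * s3 - c2 * c3)\<^sup>2)
      + (s1 * (s2 * c3 + c2 * s3) - c1 * c2 * c3)\<^sup>2 \<ge> 0" by simp
  then have "(s1 * c2 * c3 + c1 * s2 * c3 + c1 * c2 * s3)\<^sup>2 \<le> 4 / 3 * ((s1\<^sup>2 + c1\<^sup>2) * (s2\<^sup>2 + c2\<^sup>2) * (s3\<^sup>2 + c3\<^sup>2))"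
    unfolding w_form_identity[symmetric] by linarith
  then have "\<bar>s1 * c2 * c3 + c1 * s2 * c3 + c1 * c2 * s3\<bar> \<le> sqrt (4 / 3 * ((s1\<^sup>2 + c1\<^sup>2) * (s2\<^sup>2 + c2\<^sup>2) * (s3\<^sup>2 + c3\<^sup>2)))"
    using real_sqrt_le_mono by (metis real_sqrt_abs)
  then show ?thesis unfolding real_sqrt_mult by linarith
qed

text \<open>Equality annihilates the first bracket of the certificate. Its two relations make (2
  s2^2 - c2^2) c3 and (2 s2^2 - c2^2) s3 vanish, and (s3, c3) is not 0. The form is symmetric in the
  three indices although the certificate is not, so the other indices follow by permutation.\<close>

lemma w_form_eq:
  fixes s1 s2 s3 c1 c2 c3 :: real
  assumes eq: "s1 * c2 * c3 + c1 * s2 * c3 + c1 * c2 * s3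
      = sqrt (4 / 3) * (sqrt (s1\<^sup>2 + c1\<^sup>2) * sqrt (s2\<^sup>2 + c2\<^sup>2) * sqrt (s3\<^sup>2 + c3\<^sup>2))"
    and pos: "s1\<^sup>2 + c1\<^sup>2 > 0" "s3\<^sup>2 + c3\<^sup>2 > 0"
  shows "2 * s2\<^sup>2 = c2\<^sup>2"
proof -
  have "(s1 * c2 * c3 + c1 * s2 * c3 + c1 * c2 * s3)\<^sup>2 = 4 / 3 * ((s1\<^sup>2 + c1\<^sup>2) * (s2\<^sup>2 + c2\<^sup>2) * (s3\<^sup>2 + c3\<^sup>2))"
    unfolding eq by (simp add: power_mult_distrib real_sqrt_pow2 add_nonneg_nonneg)
  with w_form_identity[of s1 c1 s2 c2 s3 c3]
  have 0: "1 / 3 * (s1\<^sup>2 + c1\<^sup>2) * ((s2 * c3 - c2 * s3)\<^sup>2 + (2 * s2 * s3 - c2 * c3)\<^sup>2)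
      + (s1 * (s2 * c3 + c2 * s3) - c1 * c2 * c3)\<^sup>2 = 0" by simp
  have nn: "1 / 3 * (s1\<^sup>2 + c1\<^sup>2) * ((s2 * c3 - c2 * s3)\<^sup>2 + (2 * s2 * s3 - c2 * c3)\<^sup>2) \<ge> 0"
    "(s1 * (s2 * c3 + c2 * s3) - c1 * c2 * c3)\<^sup>2 \<ge> 0" by simp_all
  have "1 / 3 * (s1\<^sup>2 + c1\<^sup>2) * ((s2 * c3 - c2 * s3)\<^sup>2 + (2 * s2 * s3 - c2 * c3)\<^sup>2) = 0"
    using 0 nn by linarith
  then have "(s2 * c3 - c2 * s3)\<^sup>2 + (2 * s2 * s3 - c2 * c3)\<^sup>2 = 0" using pos(1) by (simp only: mult_eq_0_iff) auto
  then have a: "s2 * c3 = c2 * s3" and b: "2 * s2 * s3 = c2 * c3" by (simp_all add: sum_power2_eq_zero_iff)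
  have "(2 * s2\<^sup>2 - c2\<^sup>2) * c3 = 2 * s2 * (s2 * c3) - c2 * (c2 * c3)" by (simp add: power2_eq_square algebra_simps)
  also have "\<dots> = 0" unfolding a b[symmetric] by simp
  finally have c3: "(2 * s2\<^sup>2 - c2\<^sup>2) * c3 = 0" .
  have "(2 * s2\<^sup>2 - c2\<^sup>2) * s3 = s2 * (2 * s2 * s3) - c2 * (c2 * s3)" by (simp add: power2_eq_square algebra_simps)
  also have "\<dots> = 0" unfolding b a[symmetric] by simp
  finally have s3: "(2 * s2\<^sup>2 - c2\<^sup>2) * s3 = 0" .
  show ?thesis using c3 s3 pos(2) by auto
qed

lemma w_form_eq_all:
  fixes s1 s2 s3 c1 c2 c3 :: real
  assumes eq: "s1 * c2 * c3 + c1 * s2 * c3 + c1 * c2 * s3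
      = sqrt (4 / 3) * (sqrt (s1\<^sup>2 + c1\<^sup>2) * sqrt (s2\<^sup>2 + c2\<^sup>2) * sqrt (s3\<^sup>2 + c3\<^sup>2))"
    and pos: "s1\<^sup>2 + c1\<^sup>2 > 0" "s2\<^sup>2 + c2\<^sup>2 > 0" "s3\<^sup>2 + c3\<^sup>2 > 0"
  shows "2 * s1\<^sup>2 = c1\<^sup>2" "2 * s2\<^sup>2 = c2\<^sup>2" "2 * s3\<^sup>2 = c3\<^sup>2"
proof -
  show "2 * s2\<^sup>2 = c2\<^sup>2" by (rule w_form_eq[OF eq pos(1,3)])
  show "2 * s1\<^sup>2 = c1\<^sup>2" by (rule w_form_eq[of s2 c1 c3 c2 s1 s3]) (use eq pos in \<open>simp_all add: mult_ac add_ac\<close>)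
  show "2 * s3\<^sup>2 = c3\<^sup>2" by (rule w_form_eq[of s1 c3 c2 c1 s3 s2]) (use eq pos in \<open>simp_all add: mult_ac add_ac\<close>)
qed

text \<open>The tensor square of the \<open>W\<close> form, bounded by applying the bound for \<open>W\<close> first to the
  second tensor factors and then to the norms of the slices.\<close>

definition w_square :: "(nat \<Rightarrow> real) \<Rightarrow> (nat \<Rightarrow> real) \<Rightarrow> (nat \<Rightarrow> real) \<Rightarrow> (nat \<Rightarrow> real) \<Rightarrow> real" where
  "w_square a s t c =
     (a 1 * c 2 * c 3 + s 1 * t 2 * c 3 + s 1 * c 2 * t 3)
   + (a 2 * c 1 * c 3 + s 2 * t 1 * c 3 + s 2 * c 1 * t 3)
   + (a 3 * c 1 * c 2 + s 3 * t 1 * c 2 + s 3 * c 1 * t 2)"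

text \<open>At each g the numbers a, s, t, c are the ss, sc, cs, cc entries of a 2 x 2 tensor, and p
  and q are the norms of its slices (a, s) and (t, c). Each line of \<open>w_square\<close> is the
  form at one slice (a, s) and two slices (t, c); the remaining sum is the form at the unit vectors
  (p, q).\<close>

lemma w_square_slices:
  assumes "\<And>g. (a g)\<^sup>2 + (s g)\<^sup>2 + (t g)\<^sup>2 + (c g)\<^sup>2 = 1"
  defines "p \<equiv> \<lambda>g. sqrt ((a g)\<^sup>2 + (s g)\<^sup>2)" and "q \<equiv> \<lambda>g. sqrt ((t g)\<^sup>2 + (c g)\<^sup>2)"
  shows "a 1 * c 2 * c 3 + s 1 * t 2 * c 3 + s 1 * c 2 * t 3 \<le> sqrt (4/3) * (p 1 * q 2 * q 3)"
    and "a 2 * c 1 * c 3 + s 2 * t 1 * c 3 + s 2 * c 1 * t 3 \<le> sqrt (4/3) * (p 2 * q 1 * q 3)"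
    and "a 3 * c 1 * c 2 + s 3 * t 1 * c 2 + s 3 * c 1 * t 2 \<le> sqrt (4/3) * (p 3 * q 1 * q 2)"
    and "p 1 * q 2 * q 3 + q 1 * p 2 * q 3 + q 1 * q 2 * p 3 \<le> sqrt (4/3)"
proof -
  show "a 1 * c 2 * c 3 + s 1 * t 2 * c 3 + s 1 * c 2 * t 3 \<le> sqrt (4/3) * (p 1 * q 2 * q 3)"
    "a 2 * c 1 * c 3 + s 2 * t 1 * c 3 + s 2 * c 1 * t 3 \<le> sqrt (4/3) * (p 2 * q 1 * q 3)"
    "a 3 * c 1 * c 2 + s 3 * t 1 * c 2 + s 3 * c 1 * t 2 \<le> sqrt (4/3) * (p 3 * q 1 * q 2)"
    unfolding p_def q_def by (rule w_form_le)+
  have n: "sqrt ((p g)\<^sup>2 + (q g)\<^sup>2) = 1" for g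
    using assms(1)[of g] by (simp add: p_def q_def add_nonneg_nonneg real_sqrt_pow2 add.assoc)
  show "p 1 * q 2 * q 3 + q 1 * p 2 * q 3 + q 1 * q 2 * p 3 \<le> sqrt (4/3)"
    using w_form_le[of "p 1" "q 2" "q 3" "q 1" "p 2" "p 3"] unfolding n by simp
qed

lemma w_square_le:
  assumes n: "\<And>g. (a g)\<^sup>2 + (s g)\<^sup>2 + (t g)\<^sup>2 + (c g)\<^sup>2 = 1"
  shows "w_square a s t c \<le> 4 / 3"
proof -
  define p where "p g = sqrt ((a g)\<^sup>2 + (s g)\<^sup>2)" for g
  define q where "q g = sqrt ((t g)\<^sup>2 + (c g)\<^sup>2)" for g
  note sl = w_square_slices[of a s t c, OF n, folded p_def q_def]
  have "w_square a s t c \<le> sqrt (4/3) * (p 1 * q 2 * q 3 + q 1 * p 2 * q 3 + q 1 * q 2 * p 3)"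
    using sl(1-3) unfolding w_square_def by (simp add: algebra_simps)
  also have "\<dots> \<le> sqrt (4/3) * sqrt (4/3)" by (rule mult_left_mono[OF sl(4)]) simp
  also have "\<dots> = 4/3" by (subst real_sqrt_mult_self) simp
  finally show ?thesis .
qed

text \<open>Equality overall forces it in the outer bound and in all three slice bounds. The outer
  one splits the unit mass as 1/3 and 2/3, and the inner ones split each part again as 1 : 2. These
  are the class masses of the uniform distribution on nine pairs.\<close>

lemma w_square_eq:
  assumes n: "\<And>g. (a g)\<^sup>2 + (s g)\<^sup>2 + (t g)\<^sup>2 + (c g)\<^sup>2 = 1"
    and eq: "w_square a s t c = 4 / 3" and g: "g \<in> {1, 2, 3}"
  shows "(a g)\<^sup>2 = 1/9" "(s g)\<^sup>2 = 2/9" "(t g)\<^sup>2 = 2/9" "(c g)\<^sup>2 = 4/9"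
proof -
  define p where "p g = sqrt ((a g)\<^sup>2 + (s g)\<^sup>2)" for g
  define q where "q g = sqrt ((t g)\<^sup>2 + (c g)\<^sup>2)" for g
  note sl = w_square_slices[of a s t c, OF n, folded p_def q_def]
  define k where "k = sqrt (4/3 :: real)"
  have k: "k > 0" "k * k = 4/3" by (simp_all add: k_def)
  have nk: "sqrt ((p g)\<^sup>2 + (q g)\<^sup>2) = 1" for g
    using n[of g] by (simp add: p_def q_def add_nonneg_nonneg real_sqrt_pow2 add.assoc)
  define X where "X = p 1 * q 2 * q 3 + q 1 * p 2 * q 3 + q 1 * q 2 * p 3"
  have sum: "w_square a s t c \<le> k * X"
    using sl(1-3) unfolding w_square_def X_def k_def by (simp add: algebra_simps)
  have Xk: "X \<le> k" using sl(4) by (simp add: X_def k_def)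
  have "k * k \<le> k * X" using sum eq k(2) by simp
  then have "k \<le> X" using k(1) by simp
  with Xk have X: "X = k" by simp
  have Xeq: "p 1 * q 2 * q 3 + q 1 * p 2 * q 3 + q 1 * q 2 * p 3
    = sqrt (4/3) * (sqrt ((p 1)\<^sup>2 + (q 1)\<^sup>2) * sqrt ((p 2)\<^sup>2 + (q 2)\<^sup>2) * sqrt ((p 3)\<^sup>2 + (q 3)\<^sup>2))"
    unfolding nk using X by (simp add: X_def k_def)
  have np: "(p g)\<^sup>2 + (q g)\<^sup>2 = 1" for g using nk[of g] by simp
  have "2 * (p 1)\<^sup>2 = (q 1)\<^sup>2" "2 * (p 2)\<^sup>2 = (q 2)\<^sup>2" "2 * (p 3)\<^sup>2 = (q 3)\<^sup>2"
    by (rule w_form_eq_all[OF Xeq]; simp add: np)+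
  then have pq: "(p g)\<^sup>2 = 1/3" "(q g)\<^sup>2 = 2/3" if "g \<in> {1,2,3}" for g using np[of g] that by auto
  have pq': "(a g)\<^sup>2 + (s g)\<^sup>2 = 1/3" "(t g)\<^sup>2 + (c g)\<^sup>2 = 2/3" if "g \<in> {1,2,3}" for g
    using pq[OF that] by (simp_all add: p_def q_def add_nonneg_nonneg)
  have tot: "k * X = k * (p 1 * q 2 * q 3) + k * (p 2 * q 1 * q 3) + k * (p 3 * q 1 * q 2)"
    by (simp add: X_def algebra_simps)
  have wkX: "w_square a s t c = k * X" using eq X k by simp
  have e: "a 1 * c 2 * c 3 + s 1 * t 2 * c 3 + s 1 * c 2 * t 3 = sqrt (4/3) * (p 1 * q 2 * q 3)"
    "a 2 * c 1 * c 3 + s 2 * t 1 * c 3 + s 2 * c 1 * t 3 = sqrt (4/3) * (p 2 * q 1 * q 3)"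
    using sl(1-3) wkX tot unfolding w_square_def k_def[symmetric] by linarith+
  have "2 * (a 1)\<^sup>2 = (s 1)\<^sup>2" "2 * (t 2)\<^sup>2 = (c 2)\<^sup>2" "2 * (t 3)\<^sup>2 = (c 3)\<^sup>2"
    by (rule w_form_eq_all[OF e(1)[unfolded p_def q_def]]; simp add: pq')+
  moreover have "2 * (a 2)\<^sup>2 = (s 2)\<^sup>2" "2 * (t 1)\<^sup>2 = (c 1)\<^sup>2" "2 * (t 3)\<^sup>2 = (c 3)\<^sup>2"
    by (rule w_form_eq_all[OF e(2)[unfolded p_def q_def]]; simp add: pq')+
  moreover have e3: "a 3 * c 1 * c 2 + s 3 * t 1 * c 2 + s 3 * c 1 * t 2 = sqrt (4/3) * (p 3 * q 1 * q 2)"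
    using sl(1-3) wkX tot unfolding w_square_def k_def[symmetric] by linarith
  have "2 * (a 3)\<^sup>2 = (s 3)\<^sup>2" by (rule w_form_eq_all(1)[OF e3[unfolded p_def q_def]]; simp add: pq')
  ultimately have "2 * (a g)\<^sup>2 = (s g)\<^sup>2 \<and> 2 * (t g)\<^sup>2 = (c g)\<^sup>2" using g by auto
  then show "(a g)\<^sup>2 = 1/9" "(s g)\<^sup>2 = 2/9" "(t g)\<^sup>2 = 2/9" "(c g)\<^sup>2 = 4/9"
    using pq'[OF g] by auto
qed

text \<open>Gibbs' inequality, for the weights \<open>w\<^sub>e\<^sub>f = \<Prod>\<^sub>g sqrt q\<^sub>g\<close> in which \<open>q\<^sub>g\<close> is the mass of the pairs
  \<open>(e', f')\<close> with \<open>e' = g \<longleftrightarrow> e = g\<close> and \<open>f' = g \<longleftrightarrow> f = g\<close>: it reduces the maximisation of \<open>phi\<close> at a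
  vertex of degree 3 to the bound \<open>4/3\<close> on the total weight, which is \<open>w_square\<close>.\<close>

lemma gibbs_term:
  fixes x q1 q2 q3 Z :: real
  assumes "x \<ge> 0" "q1 \<ge> 0" "q2 \<ge> 0" "q3 \<ge> 0" "x > 0 \<Longrightarrow> q1 > 0 \<and> q2 > 0 \<and> q3 > 0" "Z > 0"
  defines "w \<equiv> sqrt q1 * sqrt q2 * sqrt q3"
  shows "x * ((ln q1 + ln q2 + ln q3) / 2) - x * ln x \<le> w / Z - x + x * ln Z"
    and "x * ((ln q1 + ln q2 + ln q3) / 2) - x * ln x = w / Z - x + x * ln Z \<Longrightarrow> w = x * Z"
proof -
  have "x * ((ln q1 + ln q2 + ln q3) / 2) - x * ln x \<le> w / Z - x + x * ln Z \<and>
    (x * ((ln q1 + ln q2 + ln q3) / 2) - x * ln x = w / Z - x + x * ln Z \<longrightarrow> w = x * Z)"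
  proof (cases "x = 0")
    case True
    have "w \<ge> 0" using assms by (simp add: w_def)
    then show ?thesis using True assms(6) by auto
  next
    case False
    then have x: "x > 0" and q: "q1 > 0" "q2 > 0" "q3 > 0" using assms by auto
    have w: "w > 0" using q by (simp add: w_def)
    have lnw: "ln w = (ln q1 + ln q2 + ln q3) / 2" using q by (simp add: w_def ln_mult ln_sqrt)
    \<comment> \<open>The inequality comes from ln u <= u - 1, with equality only at u = 1, that is
      w = x Z.\<close>
    define u where "u = w / (x * Z)"
    have u: "u > 0" using w x assms(6) by (simp add: u_def)
    have lnu: "ln u = ln w - ln x - ln Z" using w x assms(6) by (simp add: u_def ln_div ln_mult)
    have xu: "x * u = w / Z" using x by (simp add: u_def)
    have e: "x * ((ln q1 + ln q2 + ln q3) / 2) - x * ln x = x * ln u + x * ln Z"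
      unfolding lnw[symmetric] lnu by (simp add: algebra_simps)
    have e2: "w / Z - x + x * ln Z = x * (u - 1) + x * ln Z" unfolding xu[symmetric] by (simp add: algebra_simps)
    have "ln u \<le> u - 1" using u by (rule ln_le_minus_one)
    moreover have "u = 1" if "ln u = u - 1" using ln_eq_minus_one[OF u that] .
    moreover have "w = x * Z" if "u = 1" using that x assms(6) by (simp add: u_def)
    ultimately show ?thesis unfolding e e2 using x by auto
  qed
  then show "x * ((ln q1 + ln q2 + ln q3) / 2) - x * ln x \<le> w / Z - x + x * ln Z"
    "x * ((ln q1 + ln q2 + ln q3) / 2) - x * ln x = w / Z - x + x * ln Z \<Longrightarrow> w = x * Z" by auto
qed

text \<open>For each g every pair (e, f) lies in exactly one of the classes with masses A g, S g, T
  g, C g. Distributing the logarithm of a class mass over its pairs writes F as a sum of nine terms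
  of \<open>gibbs_term\<close>; the coefficient - 1/2 of a diagonal entry arises as 1/2 - 1. With Z
  = 4/3 the bounds add up to w / (4/3) - 1 + ln (4/3), where w is \<open>w_square\<close> at the
  square roots of the masses.\<close>

lemma pair_entropy_bound_3:
  fixes x :: "nat \<Rightarrow> nat \<Rightarrow> real"
  assumes x0: "\<And>e f. x e f \<ge> 0"
    and tot: "x 1 1 + x 1 2 + x 1 3 + x 2 1 + x 2 2 + x 2 3 + x 3 1 + x 3 2 + x 3 3 = 1"
  defines "S \<equiv> \<lambda>g. if g = 1 then x 1 2 + x 1 3 else if g = 2 then x 2 1 + x 2 3 else x 3 1 + x 3 2"
    and "T \<equiv> \<lambda>g. if g = 1 then x 2 1 + x 3 1 else if g = 2 then x 1 2 + x 3 2 else x 1 3 + x 2 3"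
    and "C \<equiv> \<lambda>g. if g = 1 then x 2 2 + x 2 3 + x 3 2 + x 3 3 else if g = 2 then x 1 1 + x 1 3 + x 3 1 + x 3 3
        else x 1 1 + x 1 2 + x 2 1 + x 2 2"
  defines "F \<equiv> 1/2 * (xlnx (S 1) + xlnx (T 1) + xlnx (C 1) - xlnx (x 1 1)
      + xlnx (S 2) + xlnx (T 2) + xlnx (C 2) - xlnx (x 2 2)
      + xlnx (S (3::nat)) + xlnx (T (3::nat)) + xlnx (C (3::nat)) - xlnx (x 3 3))
      - (xlnx (x 1 2) + xlnx (x 1 3) + xlnx (x 2 1) + xlnx (x 2 3) + xlnx (x 3 1) + xlnx (x 3 2))"
  shows "F \<le> ln (4/3)"
    and "F = ln (4/3) \<Longrightarrow> e \<in> {1,2,3} \<Longrightarrow> f \<in> {1,2,3} \<Longrightarrow> x e f = 1/9"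
proof -
  define A where "A g = (if g = 1 then x 1 1 else if g = 2 then x 2 2 else x 3 3)" for g :: nat
  have nn: "A g \<ge> 0" "S g \<ge> 0" "T g \<ge> 0" "C g \<ge> 0" for g using x0 by (auto simp: A_def S_def T_def C_def)
  have norm: "(sqrt (A g))\<^sup>2 + (sqrt (S g))\<^sup>2 + (sqrt (T g))\<^sup>2 + (sqrt (C g))\<^sup>2 = 1" for g
    using nn[of g] tot by (simp add: A_def S_def T_def C_def)
  define w where "w = w_square (\<lambda>g. sqrt (A g)) (\<lambda>g. sqrt (S g)) (\<lambda>g. sqrt (T g)) (\<lambda>g. sqrt (C g))"
  have w: "w \<le> 4/3" unfolding w_def by (rule w_square_le[OF norm])
  define b where "b x q1 q2 q3 = x * ((ln q1 + ln q2 + ln q3) / 2) - x * ln x" for x q1 q2 q3 :: real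
  define z where "z x q1 q2 q3 = sqrt q1 * sqrt q2 * sqrt q3 / (4/3) - x + x * ln (4/3)" for x q1 q2 q3 :: real
  have sumF: "F = b (x 1 1) (A 1) (C 2) (C 3) + b (x 1 2) (S 1) (T 2) (C 3) + b (x 1 3) (S 1) (C 2) (T 3)
      + (b (x 2 2) (A 2) (C 1) (C 3) + b (x 2 1) (S 2) (T 1) (C 3) + b (x 2 3) (S 2) (C 1) (T 3))
      + (b (x 3 3) (A 3) (C 1) (C 2) + b (x 3 1) (S 3) (T 1) (C 2) + b (x 3 2) (S 3) (C 1) (T 2))"
  proof -
    have e: "xlnx (S 1) = (x 1 2 + x 1 3) * ln (S 1)" "xlnx (S 2) = (x 2 1 + x 2 3) * ln (S 2)" "xlnx (S 3) = (x 3 1 + x 3 2) * ln (S 3)"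
      "xlnx (T 1) = (x 2 1 + x 3 1) * ln (T 1)" "xlnx (T 2) = (x 1 2 + x 3 2) * ln (T 2)" "xlnx (T 3) = (x 1 3 + x 2 3) * ln (T 3)"
      "xlnx (C 1) = (x 2 2 + x 2 3 + x 3 2 + x 3 3) * ln (C 1)" "xlnx (C 2) = (x 1 1 + x 1 3 + x 3 1 + x 3 3) * ln (C 2)"
      "xlnx (C 3) = (x 1 1 + x 1 2 + x 2 1 + x 2 2) * ln (C 3)"
      by (simp_all add: xlnx_def S_def T_def C_def)
    have A: "A 1 = x 1 1" "A 2 = x 2 2" "A 3 = x 3 3" by (simp_all add: A_def)
    show ?thesis unfolding F_def e b_def A xlnx_def[of "x _ _"] by (simp add: field_simps)
  qed
  have sumz: "w / (4/3) - 1 + ln (4/3) = z (x 1 1) (A 1) (C 2) (C 3) + z (x 1 2) (S 1) (T 2) (C 3) + z (x 1 3) (S 1) (C 2) (T 3)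
      + (z (x 2 2) (A 2) (C 1) (C 3) + z (x 2 1) (S 2) (T 1) (C 3) + z (x 2 3) (S 2) (C 1) (T 3))
      + (z (x 3 3) (A 3) (C 1) (C 2) + z (x 3 1) (S 3) (T 1) (C 2) + z (x 3 2) (S 3) (C 1) (T 2))" (is "_ = ?R")
  proof -
    have "?R = w / (4/3) + (ln (4/3) - 1) * (x 1 1 + x 1 2 + x 1 3 + x 2 1 + x 2 2 + x 2 3 + x 3 1 + x 3 2 + x 3 3)"
      unfolding z_def w_def w_square_def by (simp add: algebra_simps add_divide_distrib)
    then show ?thesis unfolding tot by simp
  qed
  have nnx: "0 \<le> x 1 1" "0 \<le> x 1 2" "0 \<le> x 1 3" "0 \<le> x 2 1" "0 \<le> x 2 2" "0 \<le> x 2 3" "0 \<le> x 3 1" "0 \<le> x 3 2" "0 \<le> x 3 3"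
    by (rule x0)+
  note g = gibbs_term[where Z = "4/3", folded b_def z_def]
  have le: "b (x 1 1) (A 1) (C 2) (C 3) \<le> z (x 1 1) (A 1) (C 2) (C 3)"
    "b (x 1 2) (S 1) (T 2) (C 3) \<le> z (x 1 2) (S 1) (T 2) (C 3)"
    "b (x 1 3) (S 1) (C 2) (T 3) \<le> z (x 1 3) (S 1) (C 2) (T 3)"
    "b (x 2 2) (A 2) (C 1) (C 3) \<le> z (x 2 2) (A 2) (C 1) (C 3)"
    "b (x 2 1) (S 2) (T 1) (C 3) \<le> z (x 2 1) (S 2) (T 1) (C 3)"
    "b (x 2 3) (S 2) (C 1) (T 3) \<le> z (x 2 3) (S 2) (C 1) (T 3)"
    "b (x 3 3) (A 3) (C 1) (C 2) \<le> z (x 3 3) (A 3) (C 1) (C 2)"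
    "b (x 3 1) (S 3) (T 1) (C 2) \<le> z (x 3 1) (S 3) (T 1) (C 2)"
    "b (x 3 2) (S 3) (C 1) (T 2) \<le> z (x 3 2) (S 3) (C 1) (T 2)"
    by (rule g(1); (rule x0 nn | (use nnx in \<open>auto simp: A_def S_def T_def C_def\<close>)))+
  have Fle: "F \<le> w / (4/3) - 1 + ln (4/3)" unfolding sumF sumz using le by linarith
  also have "\<dots> \<le> ln (4/3)" using w by simp
  finally show "F \<le> ln (4/3)" .
  assume F: "F = ln (4/3)" and ef: "e \<in> {1,2,3}" "f \<in> {1,2,3}"
  have w1: "w = 4/3" using Fle w F by simp
  then have "F = w / (4/3) - 1 + ln (4/3)" using F by simp
  then have eqs: "b (x 1 2) (S 1) (T 2) (C 3) = z (x 1 2) (S 1) (T 2) (C 3)"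
    "b (x 1 3) (S 1) (C 2) (T 3) = z (x 1 3) (S 1) (C 2) (T 3)"
    "b (x 2 1) (S 2) (T 1) (C 3) = z (x 2 1) (S 2) (T 1) (C 3)"
    "b (x 2 3) (S 2) (C 1) (T 3) = z (x 2 3) (S 2) (C 1) (T 3)"
    "b (x 3 1) (S 3) (T 1) (C 2) = z (x 3 1) (S 3) (T 1) (C 2)"
    "b (x 3 2) (S 3) (C 1) (T 2) = z (x 3 2) (S 3) (C 1) (T 2)"
    unfolding sumF sumz using le by linarith+
  have ws: "sqrt (S 1) * sqrt (T 2) * sqrt (C 3) = x 1 2 * (4/3)"
    "sqrt (S 1) * sqrt (C 2) * sqrt (T 3) = x 1 3 * (4/3)"
    "sqrt (S 2) * sqrt (T 1) * sqrt (C 3) = x 2 1 * (4/3)"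
    "sqrt (S 2) * sqrt (C 1) * sqrt (T 3) = x 2 3 * (4/3)"
    "sqrt (S 3) * sqrt (T 1) * sqrt (C 2) = x 3 1 * (4/3)"
    "sqrt (S 3) * sqrt (C 1) * sqrt (T 2) = x 3 2 * (4/3)"
    by (rule g(2); (rule eqs x0 nn | (use nnx in \<open>auto simp: A_def S_def T_def C_def\<close>)))+
  have val: "A g = 1/9" "S g = 2/9" "T g = 2/9" "C g = 4/9" if "g \<in> {1,2,3}" for g
    using w_square_eq[OF norm w1[unfolded w_def] that] nn[of g] by simp_all
  \<comment> \<open>Every off-diagonal weight is 4/27 = (1/9) (4/3), so equality in Gibbs'
    inequality gives the entry 1/9; the diagonal entries are the masses A g themselves.\<close>
  have r: "sqrt (2/9) * sqrt (2/9) * sqrt (4/9) = (4/27 :: real)" "sqrt (2/9) * sqrt (4/9) * sqrt (2/9) = (4/27 :: real)"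
    by (simp_all add: real_sqrt_divide flip: real_sqrt_mult)
  have v: "S 1 = 2/9" "S 2 = 2/9" "S 3 = 2/9" "T 1 = 2/9" "T 2 = 2/9" "T 3 = 2/9" "C 1 = 4/9" "C 2 = 4/9" "C 3 = 4/9"
    by (rule val; simp)+
  have "x 1 1 = 1/9" "x 2 2 = 1/9" "x 3 3 = 1/9" using val(1)[of 1] val(1)[of 2] val(1)[of 3] by (simp_all add: A_def)
  moreover have "x 1 2 = 1/9" "x 1 3 = 1/9" "x 2 1 = 1/9" "x 2 3 = 1/9" "x 3 1 = 1/9" "x 3 2 = 1/9"
    using ws unfolding v r by simp_all
  ultimately show "x e f = 1/9" using ef by auto
qed

section \<open>Sums of terms x ln x in linear forms\<close>

text \<open>Scaling by h = a u reduces the remainder to a f(u) with f(u) = (1 + u) ln (1 + u) - u -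
  u^2 / 2, whose derivative ln (1 + u) - u is at most 2 u^2 in absolute value for |u| <=
  1/2.\<close>

lemma xlnx_taylor:
  fixes a h :: real
  assumes a: "a > 0" and h: "\<bar>h\<bar> \<le> a / 2"
  shows "\<bar>xlnx (a + h) - xlnx a - (1 + ln a) * h - h\<^sup>2 / (2 * a)\<bar> \<le> 2 * \<bar>h\<bar> ^ 3 / a\<^sup>2"
proof -
  define u where "u = h / a"
  have u: "\<bar>u\<bar> \<le> 1/2" using a h by (simp add: u_def field_simps)
  have hu: "h = a * u" using a by (simp add: u_def)
  define f where "f x = (1 + x) * ln (1 + x) - x - x\<^sup>2 / 2" for x :: real
  have "norm (f u - f 0) \<le> 2 * u\<^sup>2 * norm (u - 0)"
  proof (rule differentiable_bound)
    show "convex {- \<bar>u\<bar>..\<bar>u\<bar>}" "u \<in> {- \<bar>u\<bar>..\<bar>u\<bar>}" "0 \<in> {- \<bar>u\<bar>..\<bar>u\<bar>}" by auto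
    fix x assume x: "x \<in> {- \<bar>u\<bar>..\<bar>u\<bar>}"
    then have xu: "\<bar>x\<bar> \<le> \<bar>u\<bar>" "\<bar>x\<bar> \<le> 1/2" using u by auto
    then have x1: "1 + x > 0" by linarith
    have "(f has_real_derivative (ln (1 + x) - x)) (at x)"
      unfolding f_def using x1 by (auto intro!: derivative_eq_intros)
    then show "(f has_derivative (*) (ln (1 + x) - x)) (at x within {- \<bar>u\<bar>..\<bar>u\<bar>})"
      by (auto simp: has_field_derivative_def intro: has_derivative_at_withinI)
    have "\<bar>ln (1 + x) - x\<bar> \<le> 2 * x\<^sup>2" by (rule abs_ln_one_plus_x_minus_x_bound[OF xu(2)])
    also have "\<dots> \<le> 2 * u\<^sup>2" using xu(1) by (simp add: abs_le_square_iff)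
    finally have b: "\<bar>ln (1 + x) - x\<bar> \<le> 2 * u\<^sup>2" .
    show "onorm ((*) (ln (1 + x) - x)) \<le> 2 * u\<^sup>2"
      by (rule onorm_le) (use b in \<open>simp add: abs_mult mult_right_mono\<close>)
  qed
  then have f: "\<bar>f u\<bar> \<le> 2 * u\<^sup>2 * \<bar>u\<bar>" by (simp add: f_def)
  have "ln (a + h) = ln a + ln (1 + u)"
  proof -
    have "a + h = a * (1 + u)" by (simp add: hu algebra_simps)
    moreover have "1 + u > 0" using u by linarith
    ultimately show ?thesis using a by (simp add: ln_mult)
  qed
  then have "xlnx (a + h) - xlnx a - (1 + ln a) * h - h\<^sup>2 / (2 * a) = a * f u"
    using a by (simp add: xlnx_def f_def hu power2_eq_square field_simps)
  then have "\<bar>xlnx (a + h) - xlnx a - (1 + ln a) * h - h\<^sup>2 / (2 * a)\<bar> = a * \<bar>f u\<bar>"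
    using a by (simp add: abs_mult)
  also have "\<dots> \<le> a * (2 * u\<^sup>2 * \<bar>u\<bar>)" using f a by (intro mult_left_mono) auto
  also have "\<dots> = 2 * \<bar>h\<bar> ^ 3 / a\<^sup>2"
    using a by (simp add: u_def abs_divide power2_eq_square power3_eq_cube field_simps flip: abs_mult)
  finally show ?thesis .
qed

text \<open>At 0 the convention 0 ln 0 = 0 agrees with the limit of t ln t; feasible points on the
  boundary, where forms vanish, require this.\<close>

lemma continuous_on_xlnx: "continuous_on {0..} xlnx"
  unfolding continuous_on_def
proof
  fix x :: real assume x: "x \<in> {0..}"
  show "(xlnx \<longlongrightarrow> xlnx x) (at x within {0..})"
  proof (cases "x = 0")
    case True
    have "((\<lambda>t::real. t * ln t) \<longlongrightarrow> 0) (at_right 0)" by real_asymp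
    then have "((\<lambda>t::real. t * ln t) \<longlongrightarrow> 0) (at 0 within {0..})"
      by (simp add: at_within_Ici_at_right)
    then show ?thesis by (simp add: True xlnx_def[abs_def])
  next
    case False
    then have "isCont xlnx x" unfolding xlnx_def[abs_def] using x by (auto intro!: continuous_intros)
    then show ?thesis by (simp add: isCont_def filterlim_mono at_le)
  qed
qed

text \<open>The abstract setting of \<open>phi\<close>: a combination \<open>Phi\<close> of xlnx of
  linear forms that are positive at the centre p. \<open>Lam\<close> is the differential of
  \<open>Phi\<close> at p and \<open>Q\<close> is minus its Hessian there.\<close>

locale entropy_sum =
  fixes T :: "'t set" and c :: "'t \<Rightarrow> real" and l :: "'t \<Rightarrow> 'a::euclidean_space \<Rightarrow> real" and p :: 'a
  assumes finT: "finite T" and lin: "\<And>t. t \<in> T \<Longrightarrow> linear (l t)" and pos: "\<And>t. t \<in> T \<Longrightarrow> l t p > 0"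
begin

definition Phi where "Phi x = (\<Sum>t\<in>T. c t * xlnx (l t x))"
definition Lam where "Lam h = (\<Sum>t\<in>T. c t * ((1 + ln (l t p)) * l t h))"
definition Q where "Q z w = - (\<Sum>t\<in>T. c t * (l t z * l t w / l t p))"

lemma Q_sym: "Q z w = Q w z"
  by (simp add: Q_def mult.commute)

lemma bilinear_Q: "bilinear Q"
proof -
  have a: "Q (x + y) w = Q x w + Q y w" for x y w
    unfolding Q_def minus_add_distrib[symmetric] sum.distrib[symmetric] neg_equal_iff_equal
    by (intro sum.cong refl) (simp add: linear_add[OF lin] add_divide_distrib algebra_simps)
  have s: "Q (k *\<^sub>R x) w = k *\<^sub>R Q x w" for k x w
    unfolding Q_def real_scaleR_def mult_minus_right sum_distrib_left neg_equal_iff_equal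
    by (intro sum.cong refl) (simp add: linear_cmul[OF lin])
  have lin1: "linear (\<lambda>x. Q x w)" for w by (rule linearI) (simp_all only: a s)
  have "linear (Q z)" for z
  proof -
    have "linear (\<lambda>w. Q z w)" by (subst Q_sym) (rule lin1)
    then show ?thesis by simp
  qed
  with lin1 show ?thesis unfolding bilinear_def by blast
qed

lemma linear_Lam: "linear Lam"
  unfolding Lam_def
  by (auto intro!: linearI simp: linear_add[OF lin] linear_cmul[OF lin] sum.distrib sum_distrib_left
      algebra_simps intro!: sum.cong)

lemma form_bound: obtains K where "K > 0" "\<And>t (h :: 'a). t \<in> T \<Longrightarrow> \<bar>l t h\<bar> \<le> K * norm h"
proof -
  have "\<exists>K>0. \<forall>h. \<bar>l t h\<bar> \<le> K * norm h" if t: "t \<in> T" for t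
    using linear_bounded_pos[OF lin[OF t]] by (metis real_norm_def)
  then obtain K where K: "\<And>t. t \<in> T \<Longrightarrow> K t > 0" "\<And>t h. t \<in> T \<Longrightarrow> \<bar>l t h\<bar> \<le> K t * norm h" by metis
  show ?thesis
  proof (rule that[of "1 + sum K T"])
    have "sum K T \<ge> 0" using K(1) by (intro sum_nonneg) (auto intro: less_imp_le)
    then show "1 + sum K T > 0" by simp
    fix t and h :: 'a assume t: "t \<in> T"
    have "K t \<le> sum K T" using t finT K(1) by (intro member_le_sum) (auto intro: less_imp_le)
    then have "K t * norm h \<le> (1 + sum K T) * norm h" by (intro mult_right_mono) auto
    then show "\<bar>l t h\<bar> \<le> (1 + sum K T) * norm h" using K(2)[OF t, of h] by linarith
  qed
qed

lemma pos_bound: obtains m where "m > 0" "\<And>t. t \<in> T \<Longrightarrow> m \<le> l t p"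
proof (cases "T = {}")
  case True then show ?thesis using that[of 1] by auto
next
  case False
  show ?thesis
    by (rule that[of "Min ((\<lambda>t. l t p) ` T)"]) (use False finT pos in auto)
qed

lemma taylor:
  obtains \<delta> C where "\<delta> > 0" "C > 0"
    "\<And>h :: 'a. norm h \<le> \<delta> \<Longrightarrow> \<bar>Phi (p + h) - Phi p - Lam h + Q h h / 2\<bar> \<le> C * norm h ^ 3"
    "\<And>t h. t \<in> T \<Longrightarrow> norm h \<le> \<delta> \<Longrightarrow> \<bar>l t h\<bar> \<le> l t p / 2"
proof -
  obtain K where K: "K > 0" "\<And>t h. t \<in> T \<Longrightarrow> \<bar>l t h\<bar> \<le> K * norm h" by (rule form_bound) blast
  obtain m where m: "m > 0" "\<And>t. t \<in> T \<Longrightarrow> m \<le> l t p" by (rule pos_bound) blast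
  define \<delta> where "\<delta> = m / (2 * K)"
  define C where "C = 1 + (\<Sum>t\<in>T. \<bar>c t\<bar> * (2 * K ^ 3 / m\<^sup>2))"
  have lt: "\<bar>l t h\<bar> \<le> l t p / 2" if "t \<in> T" "norm h \<le> \<delta>" for t h
  proof -
    have "K * norm h \<le> K * \<delta>" using that K by simp
    also have "\<dots> = m / 2" using K by (simp add: \<delta>_def)
    finally show ?thesis using K(2)[OF that(1), of h] m(2)[OF that(1)] by linarith
  qed
  show ?thesis
  proof (rule that[of \<delta> C])
    show "\<delta> > 0" using m K by (simp add: \<delta>_def)
    have "(\<Sum>t\<in>T. \<bar>c t\<bar> * (2 * K ^ 3 / m\<^sup>2)) \<ge> 0" using K by (intro sum_nonneg) auto
    then show "C > 0" by (simp add: C_def)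
    show "\<bar>l t h\<bar> \<le> l t p / 2" if "t \<in> T" "norm h \<le> \<delta>" for t h using lt that .
    fix h :: 'a assume h: "norm h \<le> \<delta>"
    define E where "E t = xlnx (l t p + l t h) - xlnx (l t p) - (1 + ln (l t p)) * l t h - (l t h)\<^sup>2 / (2 * l t p)" for t
    have E: "\<bar>E t\<bar> \<le> 2 * K ^ 3 / m\<^sup>2 * norm h ^ 3" if t: "t \<in> T" for t
    proof -
      have "\<bar>E t\<bar> \<le> 2 * \<bar>l t h\<bar> ^ 3 / (l t p)\<^sup>2" unfolding E_def by (rule xlnx_taylor[OF pos[OF t] lt[OF t h]])
      also have "\<dots> \<le> 2 * (K * norm h) ^ 3 / m\<^sup>2"
        using K m t by (intro frac_le mult_left_mono power_mono) auto
      finally show ?thesis by (simp add: power_mult_distrib)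
    qed
    have "Phi (p + h) - Phi p - Lam h + Q h h / 2 = (\<Sum>t\<in>T. c t * E t)"
    proof -
      have "Phi (p + h) = (\<Sum>t\<in>T. c t * xlnx (l t p + l t h))"
        unfolding Phi_def by (intro sum.cong refl) (simp add: linear_add[OF lin])
      moreover have "Q h h / 2 = - (\<Sum>t\<in>T. c t * ((l t h)\<^sup>2 / (2 * l t p)))"
        unfolding Q_def by (simp add: sum_divide_distrib power2_eq_square mult_ac)
      ultimately show ?thesis
        unfolding Lam_def E_def Phi_def[of p] by (simp add: sum_subtractf right_diff_distrib)
    qed
    also have "\<bar>\<dots>\<bar> \<le> (\<Sum>t\<in>T. \<bar>c t * E t\<bar>)" by (rule sum_abs)
    also have "\<dots> \<le> (\<Sum>t\<in>T. \<bar>c t\<bar> * (2 * K ^ 3 / m\<^sup>2) * norm h ^ 3)"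
      by (rule sum_mono) (simp only: abs_mult mult.assoc, intro mult_left_mono, use E in \<open>auto simp: mult.assoc\<close>)
    also have "\<dots> = (C - 1) * norm h ^ 3" by (simp add: C_def sum_distrib_right)
    also have "\<dots> \<le> C * norm h ^ 3" by (intro mult_right_mono) auto
    finally show "\<bar>Phi (p + h) - Phi p - Lam h + Q h h / 2\<bar> \<le> C * norm h ^ 3" .
  qed
qed

text \<open>The formula for the first derivative is available where all forms are positive. This set
  is open and contains p, so the outer derivative at p sees nothing else.\<close>

lemma hessian_Phi: "hessian Phi p z w = - Q z w"
proof -
  define U where "U = {y. \<forall>t\<in>T. l t y > 0}"
  have cont: "continuous_on UNIV (l t)" if "t \<in> T" for t using lin[OF that] by (rule linear_continuous_on_compose[OF continuous_on_id, unfolded o_def, simplified]) 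
  have "U = (\<Inter>t\<in>T. {y. l t y > 0})" by (auto simp: U_def)
  moreover have "open {y. l t y > 0}" if "t \<in> T" for t
    by (rule open_Collect_less) (use cont[OF that] in auto)
  ultimately have "open U" using finT by (auto intro!: open_INT)
  have pU: "p \<in> U" using pos by (simp add: U_def)
  have D: "(l t has_derivative l t) (at y)" if "t \<in> T" for t y
    using lin[OF that] by (rule linear_imp_has_derivative)
  have 1: "(Phi has_derivative (\<lambda>w. \<Sum>t\<in>T. c t * ((1 + ln (l t y)) * l t w))) (at y)" if y: "y \<in> U" for y
    unfolding Phi_def[abs_def] xlnx_def
    by (rule has_derivative_sum)
      (use y in \<open>auto intro!: derivative_eq_intros D simp: U_def fun_eq_iff algebra_simps\<close>)
  have 2: "frechet_derivative Phi (at y) w = (\<Sum>t\<in>T. c t * ((1 + ln (l t y)) * l t w))" if "y \<in> U" for y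
    using frechet_derivative_at[OF 1[OF that]] by metis
  have "((\<lambda>y. \<Sum>t\<in>T. c t * ((1 + ln (l t y)) * l t w)) has_derivative (\<lambda>z. \<Sum>t\<in>T. c t * (l t z * l t w / l t p))) (at p)"
    by (rule has_derivative_sum)
      (use pos in \<open>auto intro!: derivative_eq_intros D simp: fun_eq_iff algebra_simps divide_inverse\<close>)
  then have "((\<lambda>y. frechet_derivative Phi (at y) w) has_derivative (\<lambda>z. \<Sum>t\<in>T. c t * (l t z * l t w / l t p))) (at p)"
    by (rule has_derivative_transform_within_open[OF _ \<open>open U\<close> pU]) (simp add: 2)
  then have "frechet_derivative (\<lambda>y. frechet_derivative Phi (at y) w) (at p) = (\<lambda>z. \<Sum>t\<in>T. c t * (l t z * l t w / l t p))"
    by (rule frechet_derivative_at[symmetric])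
  then show ?thesis by (simp add: hessian_def Q_def)
qed

text \<open>All forms are positive at p, so p + s h is feasible for small s of either sign. The
  Taylor expansion divided by s gives the first claim and divided by s^2 the second, as s tends to
  0.\<close>

lemma max_necessary:
  assumes V: "subspace V" and h: "h \<in> V"
    and max: "\<And>x. x - p \<in> V \<Longrightarrow> (\<And>t. t \<in> T \<Longrightarrow> l t x \<ge> 0) \<Longrightarrow> Phi x \<le> Phi p"
  shows "Lam h = 0" and "Q h h \<ge> 0"
proof -
  obtain \<delta> C where \<delta>: "\<delta> > 0" and C: "C > 0"
    and tay: "\<And>h. norm h \<le> \<delta> \<Longrightarrow> \<bar>Phi (p + h) - Phi p - Lam h + Q h h / 2\<bar> \<le> C * norm h ^ 3"
    and lt: "\<And>t h. t \<in> T \<Longrightarrow> norm h \<le> \<delta> \<Longrightarrow> \<bar>l t h\<bar> \<le> l t p / 2" by (rule taylor) blast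
  define \<epsilon> where "\<epsilon> = \<delta> / (1 + norm h)"
  have nh: "1 + norm h > 0" by (simp add: add_pos_nonneg)
  have \<epsilon>: "\<epsilon> > 0" using \<delta> nh by (simp add: \<epsilon>_def)
  define M where "M = C * norm h ^ 3"
  have key: "s * Lam h - s\<^sup>2 * Q h h / 2 \<le> M * \<bar>s\<bar> ^ 3" if s: "\<bar>s\<bar> \<le> \<epsilon>" for s
  proof -
    have "\<bar>s\<bar> * norm h \<le> \<epsilon> * (1 + norm h)" using s \<epsilon> by (intro mult_mono) auto
    also have "\<dots> = \<delta>" using nh by (simp add: \<epsilon>_def)
    finally have n: "norm (s *\<^sub>R h) \<le> \<delta>" by simp
    have "Phi (p + s *\<^sub>R h) \<le> Phi p"
    proof (rule max)
      show "p + s *\<^sub>R h - p \<in> V" using V h by (simp add: subspace_scale)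
      fix t assume t: "t \<in> T"
      show "l t (p + s *\<^sub>R h) \<ge> 0" using lt[OF t n] pos[OF t] by (simp add: linear_add[OF lin[OF t]])
    qed
    moreover have "Lam (s *\<^sub>R h) = s * Lam h" by (simp add: linear_cmul[OF linear_Lam])
    moreover have "Q (s *\<^sub>R h) (s *\<^sub>R h) = s\<^sup>2 * Q h h"
      using bilinear_Q by (simp add: bilinear_lmul bilinear_rmul power2_eq_square)
    moreover have "C * norm (s *\<^sub>R h) ^ 3 = M * \<bar>s\<bar> ^ 3" by (simp add: M_def power_mult_distrib mult_ac)
    ultimately show ?thesis using tay[OF n] by linarith
  qed
  have small: "\<forall>\<^sub>F s in at_right (0::real). 0 < s \<and> s \<le> \<epsilon>"
    using \<epsilon> by (auto simp: eventually_at_right intro!: exI[of _ \<epsilon>])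
  have "Lam h \<le> 0"
  proof (rule tendsto_lowerbound[where F = "at_right (0::real)"])
    show "((\<lambda>s. s * Q h h / 2 + M * s\<^sup>2) \<longlongrightarrow> 0) (at_right 0)" by (auto intro!: tendsto_eq_intros)
    show "\<forall>\<^sub>F s in at_right 0. Lam h \<le> s * Q h h / 2 + M * s\<^sup>2"
      using small
    proof eventually_elim
      case (elim s)
      then have "s * Lam h \<le> s * (s * Q h h / 2 + M * s\<^sup>2)" using key[of s]
        by (simp add: power2_eq_square power3_eq_cube algebra_simps)
      then show ?case using elim by simp
    qed
  qed simp
  moreover have "- Lam h \<le> 0"
  proof (rule tendsto_lowerbound[where F = "at_right (0::real)"])
    show "((\<lambda>s. s * Q h h / 2 + M * s\<^sup>2) \<longlongrightarrow> 0) (at_right 0)" by (auto intro!: tendsto_eq_intros)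
    show "\<forall>\<^sub>F s in at_right 0. - Lam h \<le> s * Q h h / 2 + M * s\<^sup>2"
      using small
    proof eventually_elim
      case (elim s)
      then have "s * - Lam h \<le> s * (s * Q h h / 2 + M * s\<^sup>2)" using key[of "- s"]
        by (simp add: power2_eq_square power3_eq_cube algebra_simps)
      then show ?case using elim by (simp only: mult_le_cancel_left_pos)
    qed
  qed simp
  ultimately show L: "Lam h = 0" by simp
  have "- Q h h / 2 \<le> 0"
  proof (rule tendsto_lowerbound[where F = "at_right (0::real)"])
    show "((\<lambda>s. M * s) \<longlongrightarrow> 0) (at_right 0)" by (auto intro!: tendsto_eq_intros)
    show "\<forall>\<^sub>F s in at_right 0. - Q h h / 2 \<le> M * s"
      using small
    proof eventually_elim
      case (elim s)
      then have "s\<^sup>2 * (- Q h h / 2) \<le> s\<^sup>2 * (M * s)" using key[of s] L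
        by (simp add: power2_eq_square power3_eq_cube algebra_simps)
      then show ?case using elim by (simp only: mult_le_cancel_left_pos zero_less_power)
    qed
  qed simp
  then show "Q h h \<ge> 0" by simp
qed

text \<open>Near p the Taylor expansion and coercivity of \<open>Q\<close> give a quadratic loss. On
  the rest of D compactness gives a constant loss e, which is quadratic with constant e / R^2 when D
  has radius R around p.\<close>

lemma quadratic_upper_bound:
  assumes V: "subspace V" and D: "compact D" and DV: "\<And>x. x \<in> D \<Longrightarrow> x - p \<in> V"
    and Dpos: "\<And>x t. x \<in> D \<Longrightarrow> t \<in> T \<Longrightarrow> l t x \<ge> 0"
    and max: "\<And>x. x \<in> D \<Longrightarrow> x \<noteq> p \<Longrightarrow> Phi x < Phi p"
    and L: "\<And>h. h \<in> V \<Longrightarrow> Lam h = 0" and pd: "\<And>h. h \<in> V \<Longrightarrow> h \<noteq> 0 \<Longrightarrow> Q h h > 0"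
  obtains k where "k > 0" "\<And>x. x \<in> D \<Longrightarrow> Phi x \<le> Phi p - k * (norm (x - p))\<^sup>2"
proof -
  obtain \<delta> C where \<delta>: "\<delta> > 0" and C: "C > 0"
    and tay: "\<And>h. norm h \<le> \<delta> \<Longrightarrow> \<bar>Phi (p + h) - Phi p - Lam h + Q h h / 2\<bar> \<le> C * norm h ^ 3"
    by (rule taylor) blast
  obtain q where q: "q > 0" "\<And>x. x \<in> V \<Longrightarrow> q * (norm x)\<^sup>2 \<le> Q x x"
    using bilinear_pos_def_coercive[OF bilinear_Q V pd] by blast
  \<comment> \<open>In this radius the cubic error costs at most q / 4, half of the quadratic loss q
    / 2.\<close>
  define r where "r = min \<delta> (q / (4 * C))"
  have r: "r > 0" "r \<le> \<delta>" "C * r \<le> q / 4" using \<delta> q C by (auto simp: r_def min_def field_simps)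
  have near: "Phi x \<le> Phi p - q / 4 * (norm (x - p))\<^sup>2" if x: "x \<in> D" "norm (x - p) \<le> r" for x
  proof -
    define h where "h = x - p"
    have h: "h \<in> V" "norm h \<le> r" using x DV by (auto simp: h_def)
    have "Phi (p + h) - Phi p \<le> - Q h h / 2 + C * norm h ^ 3" using tay[of h] h r L[OF h(1)] by auto
    moreover have "C * norm h ^ 3 \<le> q / 4 * (norm h)\<^sup>2"
    proof -
      have "C * norm h ^ 3 = C * norm h * (norm h)\<^sup>2" by (simp add: power2_eq_square power3_eq_cube)
      also have "\<dots> \<le> C * r * (norm h)\<^sup>2" using h C by (intro mult_right_mono mult_left_mono) auto
      also have "\<dots> \<le> q / 4 * (norm h)\<^sup>2" using r by (intro mult_right_mono) auto
      finally show ?thesis .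
    qed
    ultimately show ?thesis using q(2)[OF h(1)] by (simp add: h_def)
  qed
  define D' where "D' = D - ball p r"
  have cD': "compact D'" unfolding D'_def by (intro compact_diff D) auto
  have contP: "continuous_on D' Phi"
    unfolding Phi_def[abs_def]
  proof (intro continuous_on_sum continuous_on_mult continuous_on_const)
    fix t assume t: "t \<in> T"
    have "continuous_on D' (l t)" using lin[OF t] by (rule linear_continuous_on[OF linear_conv_bounded_linear[THEN iffD1]])
    then show "continuous_on D' (\<lambda>x. xlnx (l t x))"
      by (rule continuous_on_compose2[OF continuous_on_xlnx]) (use Dpos t in \<open>auto simp: D'_def\<close>)
  qed
  have "\<exists>e>0. \<forall>x\<in>D'. Phi x \<le> Phi p - e"
  proof (cases "D' = {}")
    case True then show ?thesis by (intro exI[of _ 1]) auto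
  next
    case False
    then obtain x1 where x1: "x1 \<in> D'" "\<And>x. x \<in> D' \<Longrightarrow> Phi x \<le> Phi x1"
      using continuous_attains_sup[OF cD' False contP] by blast
    have "x1 \<noteq> p" "x1 \<in> D" using x1(1) r by (auto simp: D'_def)
    from max[OF this(2,1)] show ?thesis
      by (intro exI[of _ "Phi p - Phi x1"]) (use x1 in auto)
  qed
  then obtain e where e: "e > 0" "\<And>x. x \<in> D' \<Longrightarrow> Phi x \<le> Phi p - e" by blast
  obtain R where R: "R > 0" "\<And>x. x \<in> D \<Longrightarrow> norm (x - p) \<le> R"
  proof -
    have "bounded ((\<lambda>x. x - p) ` D)" using compact_imp_bounded[OF D] by (rule bounded_translation_minus)
    then show ?thesis using that by (auto simp: bounded_pos)
  qed
  define k where "k = min (q / 4) (e / R\<^sup>2)"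
  have k: "k \<le> q / 4" "k \<le> e / R\<^sup>2" by (simp_all only: k_def min.cobounded1 min.cobounded2)
  show ?thesis
  proof (rule that[of k])
    show "k > 0" using q e R by (simp add: k_def)
    fix x assume x: "x \<in> D"
    show "Phi x \<le> Phi p - k * (norm (x - p))\<^sup>2"
    proof (cases "norm (x - p) \<le> r")
      case True
      have "k * (norm (x - p))\<^sup>2 \<le> q / 4 * (norm (x - p))\<^sup>2" by (intro mult_right_mono k) auto
      then show ?thesis using near[OF x True] by linarith
    next
      case False
      then have "x \<in> D'" using x by (auto simp: D'_def dist_norm norm_minus_commute)
      have "k * (norm (x - p))\<^sup>2 \<le> e / R\<^sup>2 * R\<^sup>2"
        using R x q e by (intro mult_mono power_mono k) auto
      also have "\<dots> = e" using R by simp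
      finally show ?thesis using e(2)[OF \<open>x \<in> D'\<close>] by linarith
    qed
  qed
qed

end

text \<open>An isotropic vector of a semidefinite form lies in its radical, so its coordinates would
  be a non-zero kernel vector of the matrix of the form.\<close>

lemma psd_form_det_pos_def:
  fixes B :: "'a::real_vector \<Rightarrow> 'a \<Rightarrow> real"
  assumes B: "bilinear B" and sym: "\<And>x y. B x y = B y x"
    and psd: "\<And>x. x \<in> span (set bs) \<Longrightarrow> B x x \<ge> 0" and det: "form_det B bs \<noteq> 0"
    and x: "x \<in> span (set bs)" "x \<noteq> 0"
  shows "B x x > 0"
proof (rule ccontr)
  assume "\<not> B x x > 0"
  then have x0: "B x x = 0" using psd[OF x(1)] by simp
  have l: "B (u + v) w = B u w + B v w" "B (k *\<^sub>R u) w = k * B u w"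
    "B w (u + v) = B w u + B w v" "B w (k *\<^sub>R u) = k * B w u" for u v w k
    using B by (auto simp: bilinear_ladd bilinear_lmul bilinear_radd bilinear_rmul)
  have orth: "B x y = 0" if y: "y \<in> span (set bs)" for y
  proof (rule ccontr)
    assume ne: "B x y \<noteq> 0"
    \<comment> \<open>Makes the value of the form at s x + y equal to - 1.\<close>
    define s where "s = - (B y y + 1) / (2 * B x y)"
    have "s *\<^sub>R x + y \<in> span (set bs)" using x y by (intro span_add span_mul)
    from psd[OF this] have "2 * s * B x y + B y y \<ge> 0"
      using sym[of y x] x0 by (simp add: l algebra_simps)
    moreover have "2 * s * B x y = - (B y y + 1)" using ne by (simp add: s_def)
    ultimately show False by simp
  qed
  obtain k where k: "x = (\<Sum>i<length bs. k i *\<^sub>R bs ! i)" using x(1) by (rule span_set_sum)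
  define m where "m = length bs"
  define G where "G = mat m m (\<lambda>(i, j). B (bs ! i) (bs ! j))"
  define v where "v = vec m k"
  have "v \<noteq> 0\<^sub>v m"
  proof
    assume "v = 0\<^sub>v m"
    then have "k i = 0" if "i < m" for i using that by (metis index_vec index_zero_vec(1) v_def)
    then have "x = 0" unfolding k m_def[symmetric] by (intro sum.neutral) auto
    then show False using x by simp
  qed
  moreover have "G *\<^sub>v v = 0\<^sub>v m"
  proof (rule eq_vecI)
    fix i assume i: "i < dim_vec (0\<^sub>v m)"
    then have i: "i < m" by simp
    have "bs ! i \<in> span (set bs)" using i by (auto simp: m_def intro: span_base)
    have "vec_index (G *\<^sub>v v) i = (\<Sum>j<m. B (bs ! i) (bs ! j) * k j)"
      using i by (simp add: G_def v_def scalar_prod_def atLeast0LessThan)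
    also have "\<dots> = (\<Sum>a\<in>{0::nat}. \<Sum>j<m. 1 * k j * B (bs ! i) (bs ! j))" by (simp add: mult.commute)
    also have "\<dots> = B (\<Sum>a\<in>{0::nat}. 1 *\<^sub>R bs ! i) x"
      unfolding k m_def by (rule bilinear_sum_sum[OF B, symmetric])
    also have "\<dots> = 0" using orth[OF \<open>bs ! i \<in> _\<close>] sym[of x] by simp
    finally show "vec_index (G *\<^sub>v v) i = vec_index (0\<^sub>v m) i" using i by simp
  qed (simp add: G_def)
  ultimately have "Determinant.det G = 0"
    by (subst det_0_iff_vec_prod_zero[of G m]) (auto simp: G_def v_def intro!: exI[of _ v])
  then show False using det by (simp add: form_det_def G_def m_def)
qed

text \<open>The coefficients c_t have both signs, so an upper bound on a power needs a two-sided
  bound on its base.\<close>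

lemma powr_le_powr_abs:
  fixes u A c :: real
  assumes "1 \<le> A" "1 / A \<le> u" "u \<le> A"
  shows "u powr c \<le> A powr \<bar>c\<bar>"
proof (cases "c \<ge> 0")
  case True
  have "u > 0" using assms by (smt (verit) divide_pos_pos)
  then show ?thesis using assms True by (simp add: powr_mono2)
next
  case False
  have u: "u > 0" using assms by (smt (verit) divide_pos_pos)
  have "u powr c \<le> (1 / A) powr c" using assms False u by (intro powr_mono2') auto
  also have "\<dots> = A powr \<bar>c\<bar>" using assms False by (simp add: powr_divide powr_minus_divide)
  finally show ?thesis .
qed

text \<open>Eventuality along this filter of pairs means uniformity in z as n runs along F, so the
  ordinary limit rules yield uniform estimates.\<close>

lemma eventually_uniform_iff:
  "eventually P (inf (filtercomap fst F) (principal A)) \<longleftrightarrow> (\<forall>\<^sub>F n in F. \<forall>z. (n, z) \<in> A \<longrightarrow> P (n, z))"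
  unfolding eventually_inf_principal eventually_filtercomap
proof
  assume "\<exists>Q. eventually Q F \<and> (\<forall>x. Q (fst x) \<longrightarrow> x \<in> A \<longrightarrow> P x)"
  then obtain Q where "eventually Q F" "\<And>x. Q (fst x) \<Longrightarrow> x \<in> A \<Longrightarrow> P x" by blast
  then show "\<forall>\<^sub>F n in F. \<forall>z. (n, z) \<in> A \<longrightarrow> P (n, z)" by (auto elim: eventually_mono)
next
  assume "\<forall>\<^sub>F n in F. \<forall>z. (n, z) \<in> A \<longrightarrow> P (n, z)"
  then show "\<exists>Q. eventually Q F \<and> (\<forall>x. Q (fst x) \<longrightarrow> x \<in> A \<longrightarrow> P x)"
    by (intro exI[of _ "\<lambda>n. \<forall>z. (n, z) \<in> A \<longrightarrow> P (n, z)"]) auto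
qed

section \<open>Stirling factors and Laplace's method for entropy sums\<close>

context entropy_sum
begin

text \<open>What remains of the product of (l_t x)!^(c_t) once the factors m^m e^(-m) are taken out,
  divided by its Stirling approximation at the centre x = n p. It is therefore close to 1 near n
  p.\<close>

definition stirling_weight :: "nat \<Rightarrow> 'a \<Rightarrow> real" where
  "stirling_weight n x = (\<Prod>t\<in>T. (stirling_quot (nat \<lfloor>l t x\<rfloor>) / sqrt (2 * pi * real n * l t p)) powr c t)"

lemma stirling_weight_nonneg: "stirling_weight n x \<ge> 0"
  by (simp add: stirling_weight_def prod_nonneg)

lemma stirling_weight_le:
  assumes "1 \<le> A" and "\<And>t. t \<in> T \<Longrightarrow> 1 / A \<le> stirling_quot (nat \<lfloor>l t x\<rfloor>) / sqrt (2 * pi * real n * l t p)"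
    and "\<And>t. t \<in> T \<Longrightarrow> stirling_quot (nat \<lfloor>l t x\<rfloor>) / sqrt (2 * pi * real n * l t p) \<le> A"
  shows "stirling_weight n x \<le> A powr (\<Sum>t\<in>T. \<bar>c t\<bar>)"
proof -
  have "stirling_weight n x \<le> (\<Prod>t\<in>T. A powr \<bar>c t\<bar>)"
    unfolding stirling_weight_def using assms by (intro prod_mono) (auto intro!: powr_le_powr_abs)
  also have "\<dots> = A powr (\<Sum>t\<in>T. \<bar>c t\<bar>)" using assms(1) finT by (simp add: powr_sum)
  finally show ?thesis .
qed

text \<open>With a = n l_t(p) each count N lies between a / 2 and 3 a / 2. Then pi < 4 gives 2 pi a
  <= 16 N, and pi > 3 gives N <= 2 pi a, which with e <= 3 makes 4 a two-sided bound for the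
  normalised quotient.\<close>

lemma stirling_weight_bound_near:
  assumes n: "n > 0" and near: "\<And>t. t \<in> T \<Longrightarrow> \<bar>l t x - real n * l t p\<bar> \<le> real n * l t p / 2"
    and int: "\<And>t. t \<in> T \<Longrightarrow> l t x \<in> \<int>"
  shows "stirling_weight n x \<le> 4 powr (\<Sum>t\<in>T. \<bar>c t\<bar>)"
proof (rule stirling_weight_le)
  fix t assume t: "t \<in> T"
  define N where "N = nat \<lfloor>l t x\<rfloor>"
  define a where "a = real n * l t p"
  have a: "a > 0" using n pos[OF t] by (simp add: a_def)
  have ba: "a / 2 \<le> l t x" "l t x \<le> 3 / 2 * a" using near[OF t] unfolding a_def[symmetric] by linarith+
  have N: "real N = l t x" using int[OF t] ba a by (auto simp: N_def elim!: Ints_cases)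
  then have N0: "N > 0" using ba a by (cases N) auto
  have e: "exp 1 \<le> (3::real)" by (rule exp_le)
  have s: "sqrt (2 * pi * a) > 0" using a by simp
  have "sqrt (2 * pi * a) \<le> sqrt (16 * real N)"
  proof -
    have "2 * pi * a \<le> 2 * 4 * a" using pi_less_4 a by (intro mult_right_mono) auto
    then show ?thesis using ba N by (intro real_sqrt_le_mono) linarith
  qed
  also have "\<dots> = 4 * sqrt (real N)" by (simp add: real_sqrt_mult)
  also have "\<dots> \<le> 4 * stirling_quot N" using stirling_quot_lower[OF N0] by simp
  finally show "1 / 4 \<le> stirling_quot (nat \<lfloor>l t x\<rfloor>) / sqrt (2 * pi * real n * l t p)"
    using s unfolding N_def[symmetric] a_def by (simp add: field_simps)
  have "stirling_quot N \<le> exp 1 * sqrt (real N)" by (rule stirling_quot_upper[OF N0])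
  also have "\<dots> \<le> 3 * sqrt (2 * pi * a)"
  proof (intro mult_mono e real_sqrt_le_mono)
    have "2 * 3 * a \<le> 2 * pi * a" using pi_gt3 a by (intro mult_right_mono) auto
    then show "real N \<le> 2 * pi * a" using ba N a by linarith
  qed auto
  also have "\<dots> \<le> 4 * sqrt (2 * pi * a)" using s by simp
  finally show "stirling_quot (nat \<lfloor>l t x\<rfloor>) / sqrt (2 * pi * real n * l t p) \<le> 4"
    using s unfolding N_def[symmetric] a_def by (simp add: field_simps)
qed simp

text \<open>Forms may vanish here, so the quotients are only bounded below by 1 and above linearly
  in n. The resulting polynomial bound is enough where the exponential factor is small.\<close>

lemma stirling_weight_bound_far:
  obtains A where "A \<ge> 1"
    "\<And>n x. n > 0 \<Longrightarrow> (\<And>t. t \<in> T \<Longrightarrow> 0 \<le> l t x \<and> l t x \<le> M * real n) \<Longrightarrow>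
      stirling_weight n x \<le> (A * real n) powr (\<Sum>t\<in>T. \<bar>c t\<bar>)"
proof -
  obtain m where m: "m > 0" "\<And>t. t \<in> T \<Longrightarrow> m \<le> l t p" by (rule pos_bound) blast
  define B where "B = 1 + (\<Sum>t\<in>T. 2 * pi * l t p)"
  have Bt: "2 * pi * l t p \<le> B" if t: "t \<in> T" for t
  proof -
    have "2 * pi * l t p \<le> (\<Sum>t\<in>T. 2 * pi * l t p)"
      using t finT pos by (intro member_le_sum) (auto intro!: mult_nonneg_nonneg less_imp_le)
    then show ?thesis by (simp add: B_def)
  qed
  have "(\<Sum>t\<in>T. 2 * pi * l t p) \<ge> 0" using pos by (intro sum_nonneg) (simp add: less_imp_le)
  then have B1: "B \<ge> 1" by (simp add: B_def)
  define s where "s = sqrt (2 * pi * m)"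
  have s: "s > 0" using m by (simp add: s_def)
  \<comment> \<open>\<open>B\<close> takes care of the inverses of the normalised quotients and the
    second summand of the quotients themselves; the 3 stands for e.\<close>
  define A where "A = B + 3 * (\<bar>M\<bar> + 1) / s"
  have A: "B \<le> A" "3 * (\<bar>M\<bar> + 1) / s \<le> A" using s B1 by (auto simp: A_def intro!: divide_nonneg_pos)
  show ?thesis
  proof (rule that[of A])
    show "A \<ge> 1" using A B1 by simp
    fix n :: nat and x assume n: "n > 0" and x: "\<And>t. t \<in> T \<Longrightarrow> 0 \<le> l t x \<and> l t x \<le> M * real n"
    have rn: "real n \<ge> 1" using n by simp
    show "stirling_weight n x \<le> (A * real n) powr (\<Sum>t\<in>T. \<bar>c t\<bar>)"
    proof (rule stirling_weight_le)
      have An: "A * 1 \<le> A * real n" using rn A B1 by (intro mult_left_mono) auto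
      then show "1 \<le> A * real n" using A B1 by linarith
      fix t assume t: "t \<in> T"
      define N where "N = nat \<lfloor>l t x\<rfloor>"
      define a where "a = 2 * pi * real n * l t p"
      have a: "a > 0" using n pos[OF t] by (simp add: a_def)
      have aB: "a \<le> B * real n" using mult_right_mono[OF Bt[OF t], of "real n"] by (simp add: a_def mult_ac)
      have "B * real n \<le> A * real n" using A by (intro mult_right_mono) auto
      have "1 * 1 \<le> B * real n" using B1 rn by (intro mult_mono) auto
      then have bn: "1 \<le> B * real n" by simp
      have "sqrt a \<le> sqrt (B * real n)" using aB by simp
      also have "\<dots> \<le> B * real n"
        using bn mult_left_mono[OF bn, of "B * real n"] by (intro real_le_lsqrt) (auto simp: power2_eq_square)
      also have "\<dots> \<le> A * real n" by fact
      finally have sa: "sqrt a \<le> A * real n" .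
      have pa: "A * real n > 0" using sa a by (smt (verit) real_sqrt_gt_zero)
      have "1 / (A * real n) \<le> 1 / sqrt a" using sa a by (intro divide_left_mono) (auto intro!: mult_pos_pos pa)
      also have "\<dots> \<le> stirling_quot N / sqrt a"
        using stirling_quot_ge_1[of N] a by (intro divide_right_mono) auto
      finally show "1 / (A * real n) \<le> stirling_quot (nat \<lfloor>l t x\<rfloor>) / sqrt (2 * pi * real n * l t p)"
        by (simp add: N_def a_def)
      have "real N \<le> l t x" using x[OF t] by (simp add: N_def)
      also have "\<dots> \<le> M * real n" using x[OF t] by simp
      also have "\<dots> \<le> \<bar>M\<bar> * real n" by (intro mult_right_mono) auto
      finally have "real (Suc N) \<le> (\<bar>M\<bar> + 1) * real n" using rn by (simp add: algebra_simps)
      then have "exp 1 * real (Suc N) \<le> 3 * ((\<bar>M\<bar> + 1) * real n)"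
        using exp_le by (intro mult_mono) auto
      then have q: "stirling_quot N \<le> 3 * (\<bar>M\<bar> + 1) * real n" using stirling_quot_le_Suc[of N] unfolding mult.assoc by (rule order_trans[rotated])
      have "s \<le> sqrt a" unfolding s_def a_def
      proof (intro real_sqrt_le_mono)
        have "m * 1 \<le> l t p * real n" using m t rn by (intro mult_mono) (auto intro: order_trans[of 0 m] less_imp_le)
        then have "2 * pi * m \<le> 2 * pi * (l t p * real n)" by (intro mult_left_mono) auto
        then show "2 * pi * m \<le> 2 * pi * real n * l t p" by (simp add: mult_ac)
      qed
      then have "stirling_quot N / sqrt a \<le> 3 * (\<bar>M\<bar> + 1) * real n / s"
        using q s by (intro frac_le) auto
      also have "\<dots> = 3 * (\<bar>M\<bar> + 1) / s * real n" by simp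
      also have "\<dots> \<le> A * real n" using A by (intro mult_right_mono) auto
      finally show "stirling_quot (nat \<lfloor>l t x\<rfloor>) / sqrt (2 * pi * real n * l t p) \<le> A * real n"
        by (simp add: N_def a_def)
    qed
  qed
qed

text \<open>An arbitrary filter on an arbitrary parameter s lets the limit be taken uniformly over a
  region of points.\<close>

lemma stirling_weight_tendsto:
  assumes lim: "filterlim nn at_top G" and int: "\<And>t. t \<in> T \<Longrightarrow> \<forall>\<^sub>F s in G. l t (x s) \<in> \<int>"
    and near: "\<And>t. t \<in> T \<Longrightarrow> ((\<lambda>s. l t (x s) / real (nn s)) \<longlongrightarrow> l t p) G"
  shows "((\<lambda>s. stirling_weight (nn s) (x s)) \<longlongrightarrow> 1) G"
proof -
  have npos: "\<forall>\<^sub>F s in G. nn s > 0" using lim eventually_gt_at_top[of "0::nat"] by (auto simp: filterlim_iff)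
  have limr: "filterlim (\<lambda>s. real (nn s)) at_top G"
    using filterlim_compose[OF filterlim_real_sequentially lim] .
  have "((\<lambda>s. (stirling_quot (nat \<lfloor>l t (x s)\<rfloor>) / sqrt (2 * pi * real (nn s) * l t p)) powr c t) \<longlongrightarrow> 1 powr c t) G"
    if t: "t \<in> T" for t
  proof (rule tendsto_powr[OF _ tendsto_const])
    define N where "N s = nat \<lfloor>l t (x s)\<rfloor>" for s
    have "\<forall>\<^sub>F s in G. l t (x s) / real (nn s) > 0"
      using order_tendstoD(1)[OF near[OF t] pos[OF t]] .
    with int[OF t] npos have ev: "\<forall>\<^sub>F s in G. real (N s) = l t (x s) \<and> N s > 0 \<and> nn s > 0"
    proof eventually_elim
      case (elim s)
      then have "l t (x s) > 0" by (simp add: zero_less_divide_iff)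
      then show ?case using elim by (auto simp: N_def elim!: Ints_cases)
    qed
    have "filterlim (\<lambda>s. l t (x s) / real (nn s) * real (nn s)) at_top G"
      by (rule filterlim_tendsto_pos_mult_at_top[OF near[OF t] pos[OF t] limr])
    then have "filterlim (\<lambda>s. real (N s)) at_top G"
      by (rule filterlim_cong[THEN iffD1, OF refl refl, rotated]) (use ev in eventually_elim, auto)
    then have "filterlim N at_top G"
      by (simp add: filterlim_at_top_gt[where c = 0] filterlim_sequentially_iff_filterlim_real)
    from filterlim_compose[OF stirling this]
    have a: "((\<lambda>s. stirling_quot (N s) / sqrt (2 * pi * real (N s))) \<longlongrightarrow> 1) G" .
    have "((\<lambda>s. sqrt (l t (x s) / real (nn s) / l t p)) \<longlongrightarrow> sqrt (l t p / l t p)) G"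
      using pos[OF t] by (intro tendsto_intros near t) auto
    then have b: "((\<lambda>s. sqrt (l t (x s) / real (nn s) / l t p)) \<longlongrightarrow> 1) G" using pos[OF t] by simp
    have "((\<lambda>s. stirling_quot (N s) / sqrt (2 * pi * real (N s)) * sqrt (l t (x s) / real (nn s) / l t p)) \<longlongrightarrow> 1 * 1) G"
      by (rule tendsto_mult[OF a b])
    moreover have "\<forall>\<^sub>F s in G. stirling_quot (N s) / sqrt (2 * pi * real (N s)) * sqrt (l t (x s) / real (nn s) / l t p)
        = stirling_quot (nat \<lfloor>l t (x s)\<rfloor>) / sqrt (2 * pi * real (nn s) * l t p)"
      using ev
    proof eventually_elim
      case (elim s)
      have "sqrt (2 * pi * real (N s)) > 0" using elim by simp
      then have "stirling_quot (N s) / sqrt (2 * pi * real (N s)) * sqrt (real (N s) / real (nn s) / l t p)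
          = stirling_quot (N s) / sqrt (2 * pi * real (nn s) * l t p)"
        using elim pos[OF t] by (simp add: real_sqrt_divide real_sqrt_mult)
      moreover have "real (N s) = l t (x s)" using elim by blast
      ultimately show ?case by (simp only: N_def)
    qed
    ultimately show "((\<lambda>s. stirling_quot (nat \<lfloor>l t (x s)\<rfloor>) / sqrt (2 * pi * real (nn s) * l t p)) \<longlongrightarrow> 1) G"
      by (simp add: Lim_transform_eventually)
  qed simp
  then have "((\<lambda>s. stirling_weight (nn s) (x s)) \<longlongrightarrow> (\<Prod>t\<in>T. 1 powr c t)) G"
    unfolding stirling_weight_def by (intro tendsto_prod)
  then show ?thesis by simp
qed

text \<open>The hypotheses of \<open>lattice_laplace\<close> are verified with B = \<open>Q\<close>.
  The maximum makes \<open>Lam\<close> vanish on the span and gives the quadratic loss k |x/n -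
  p|^2; half of it provides the Gaussian domination, the other half pays for the polynomial bound on
  \<open>stirling_weight\<close> far from p.\<close>

theorem entropy_laplace:
  fixes v :: "nat \<Rightarrow> 'a"
  assumes ind: "distinct bs" "independent (set bs)"
    and D: "compact {x. x - p \<in> span (set bs) \<and> (\<forall>t\<in>T. 0 \<le> l t x)}"
    and max: "\<And>x. x - p \<in> span (set bs) \<Longrightarrow> (\<And>t. t \<in> T \<Longrightarrow> 0 \<le> l t x) \<Longrightarrow> x \<noteq> p \<Longrightarrow> Phi x < Phi p"
    and pd: "\<And>h. h \<in> span (set bs) \<Longrightarrow> h \<noteq> 0 \<Longrightarrow> Q h h > 0"
    and F: "F \<le> sequentially" and v: "\<forall>\<^sub>F n in F. v n \<in> span (set bs)"
    and int: "\<forall>\<^sub>F n in F. \<forall>y\<in>lattice_span bs. \<forall>t\<in>T. l t (real n *\<^sub>R p + (v n + y)) \<in> \<int>"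
    and X: "\<forall>\<^sub>F n in F. X n = {x. x - real n *\<^sub>R p - v n \<in> lattice_span bs \<and> (\<forall>t\<in>T. 0 \<le> l t x)}"
  shows "((\<lambda>n. infsum (\<lambda>x. exp (real n * (Phi (x /\<^sub>R real n) - Phi p)) * stirling_weight n x) (X n)
      / (2 * pi * real n) powr (real (length bs) / 2)) \<longlongrightarrow> 1 / sqrt (form_det Q bs)) F"
proof -
  define V where "V = span (set bs)"
  define D' where "D' = {x. x - p \<in> V \<and> (\<forall>t\<in>T. 0 \<le> l t x)}"
  define \<Lambda> where "\<Lambda> = lattice_span bs"
  have V: "subspace V" by (simp add: V_def)
  have \<Lambda>V: "y \<in> V" if "y \<in> \<Lambda>" for y using that lattice_span_subset_span by (auto simp: \<Lambda>_def V_def)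
  have Lam0: "Lam h = 0" if "h \<in> V" for h
  proof (rule max_necessary(1)[OF V that])
    fix x assume "x - p \<in> V" "\<And>t. t \<in> T \<Longrightarrow> 0 \<le> l t x"
    then show "Phi x \<le> Phi p" using max[of x] by (cases "x = p") (auto simp: V_def)
  qed
  obtain k where k: "k > 0" "\<And>x. x \<in> D' \<Longrightarrow> Phi x \<le> Phi p - k * (norm (x - p))\<^sup>2"
    by (rule quadratic_upper_bound[OF V D[folded V_def D'_def] _ _ _ Lam0 pd[folded V_def]])
      (use max in \<open>auto simp: D'_def V_def\<close>)
  obtain \<delta> C1 where \<delta>: "\<delta> > 0" and C1: "C1 > 0"
    and tay: "\<And>h. norm h \<le> \<delta> \<Longrightarrow> \<bar>Phi (p + h) - Phi p - Lam h + Q h h / 2\<bar> \<le> C1 * norm h ^ 3"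
    and lt: "\<And>t h. t \<in> T \<Longrightarrow> norm h \<le> \<delta> \<Longrightarrow> \<bar>l t h\<bar> \<le> l t p / 2" by (rule taylor) blast
  obtain K where K: "K > 0" "\<And>t h. t \<in> T \<Longrightarrow> \<bar>l t h\<bar> \<le> K * norm h" by (rule form_bound) blast
  obtain M where M: "\<And>x. x \<in> D' \<Longrightarrow> norm x \<le> M"
    using compact_imp_bounded[OF D[folded V_def D'_def]] by (auto simp: bounded_iff D'_def)
  obtain A where A: "A \<ge> 1"
    "\<And>n x. n > 0 \<Longrightarrow> (\<And>t. t \<in> T \<Longrightarrow> 0 \<le> l t x \<and> l t x \<le> K * M * real n) \<Longrightarrow>
      stirling_weight n x \<le> (A * real n) powr (\<Sum>t\<in>T. \<bar>c t\<bar>)"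
    by (rule stirling_weight_bound_far) blast
  define \<kappa> where "\<kappa> = (\<Sum>t\<in>T. \<bar>c t\<bar>)"
  define ok where "ok n z \<longleftrightarrow> (\<forall>t\<in>T. 0 \<le> l t (real n *\<^sub>R p + z))" for n z
  \<comment> \<open>Extension by zero to all points of the coset, since Laplace's method sums over
    the whole lattice and not only over feasible points.\<close>
  define G where "G n z = (if ok n z then exp (real n * (Phi (p + z /\<^sub>R real n) - Phi p)) * stirling_weight n (real n *\<^sub>R p + z) else 0)"
    for n :: nat and z
  have npos: "\<forall>\<^sub>F n in F. n > 0" using F eventually_gt_at_top[of "0::nat"] by (rule filter_leD)
  have sc: "real n *\<^sub>R (p + z /\<^sub>R real n) = real n *\<^sub>R p + z" if "n > 0" for n z
    using that by (simp add: scaleR_add_right)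
  have lts: "l t (p + z /\<^sub>R real n) = l t (real n *\<^sub>R p + z) / real n" if "n > 0" "t \<in> T" for n z t
    using that by (simp add: linear_add[OF lin] linear_cmul[OF lin] field_simps)
  have inD: "p + z /\<^sub>R real n \<in> D'" if "n > 0" "z \<in> V" "ok n z" for n z
    using that lts V by (auto simp: D'_def ok_def subspace_scale)
  have decay: "\<forall>\<^sub>F n in F. (A * real n) powr \<kappa> * exp (- (k / 2 * \<delta>\<^sup>2) * real n) \<le> 1"
  proof -
    have lim: "((\<lambda>n. (A * real n) powr \<kappa> * exp (- a * real n)) \<longlongrightarrow> 0) sequentially" if "a > 0" "A > 0" for a A :: real
      using that by real_asymp
    have "((\<lambda>n. (A * real n) powr \<kappa> * exp (- (k / 2 * \<delta>\<^sup>2) * real n)) \<longlongrightarrow> 0) sequentially"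
      by (rule lim) (use k \<delta> A in auto)
    then have "\<forall>\<^sub>F n in sequentially. (A * real n) powr \<kappa> * exp (- (k / 2 * \<delta>\<^sup>2) * real n) < 1"
      by (rule order_tendstoD) simp
    then show ?thesis using F by (auto elim!: eventually_mono dest!: filter_leD[OF F])
  qed
  have dom: "\<forall>\<^sub>F n in F. \<forall>y\<in>\<Lambda>. \<bar>G n (v n + y)\<bar> \<le> (4 powr \<kappa> + 1) * exp (- (k / 2) * (norm (v n + y))\<^sup>2 / real n)"
    using npos v int decay
  proof eventually_elim
    case (elim n)
    show ?case
    proof
      fix y assume y: "y \<in> \<Lambda>"
      define z where "z = v n + y"
      have z: "z \<in> V" using elim y \<Lambda>V by (auto simp: z_def V_def intro: span_add)
      have int: "l t (real n *\<^sub>R p + z) \<in> \<int>" if "t \<in> T" for t using elim that y by (auto simp: z_def \<Lambda>_def)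
      have n: "n > 0" "real n > 0" using elim by auto
      show "\<bar>G n (v n + y)\<bar> \<le> (4 powr \<kappa> + 1) * exp (- (k / 2) * (norm (v n + y))\<^sup>2 / real n)"
      proof (cases "ok n z")
        case False
        then show ?thesis by (simp add: G_def z_def[symmetric] add_nonneg_nonneg)
      next
        case True
        define x where "x = p + z /\<^sub>R real n"
        define h where "h = z /\<^sub>R real n"
        define E where "E = exp (- (k / 2) * (norm z)\<^sup>2 / real n)"
        have x: "x \<in> D'" unfolding x_def by (rule inD[OF n(1) z True])
        have nh: "norm h = norm z / real n" by (simp add: h_def divide_inverse mult.commute)
        have "real n * (Phi x - Phi p) \<le> real n * - (k * (norm h)\<^sup>2)"
          using k(2)[OF x] by (intro mult_left_mono) (auto simp: x_def h_def)
        \<comment> \<open>The loss k |z|^2 / n is split evenly: the first half is the exponent of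
          \<open>E\<close>, the second is kept against \<open>stirling_weight\<close>.\<close>
        also have "\<dots> = - (k / 2) * (norm z)\<^sup>2 / real n + - (k / 2 * (norm h)\<^sup>2) * real n"
          using n by (simp add: nh power2_eq_square field_simps)
        finally have "exp (real n * (Phi x - Phi p)) \<le> E * exp (- (k / 2 * (norm h)\<^sup>2) * real n)"
          by (simp add: E_def flip: exp_add)
        then have g: "\<bar>G n z\<bar> \<le> E * exp (- (k / 2 * (norm h)\<^sup>2) * real n) * stirling_weight n (real n *\<^sub>R p + z)"
          using True stirling_weight_nonneg by (simp add: G_def x_def abs_mult mult_right_mono)
        have "exp (- (k / 2 * (norm h)\<^sup>2) * real n) * stirling_weight n (real n *\<^sub>R p + z) \<le> 4 powr \<kappa> + 1"
        proof (cases "norm h \<le> \<delta>")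
          case near: True
          have "stirling_weight n (real n *\<^sub>R p + z) \<le> 4 powr \<kappa>"
            unfolding \<kappa>_def
          proof (rule stirling_weight_bound_near[OF n(1) _ int])
            fix t assume t: "t \<in> T"
            have "l t (real n *\<^sub>R p + z) - real n * l t p = real n * l t h"
              using n t by (simp add: h_def linear_add[OF lin] linear_cmul[OF lin])
            then show "\<bar>l t (real n *\<^sub>R p + z) - real n * l t p\<bar> \<le> real n * l t p / 2"
              using lt[OF t near] n mult_left_mono[of "\<bar>l t h\<bar>" "l t p / 2" "real n"] by (simp add: abs_mult)
          qed
          moreover have "exp (- (k / 2 * (norm h)\<^sup>2) * real n) \<le> 1" using k by simp
          ultimately have "exp (- (k / 2 * (norm h)\<^sup>2) * real n) * stirling_weight n (real n *\<^sub>R p + z) \<le> 1 * 4 powr \<kappa>"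
            using stirling_weight_nonneg by (intro mult_mono) auto
          then show ?thesis by simp
        next
          case far: False
          have "stirling_weight n (real n *\<^sub>R p + z) \<le> (A * real n) powr \<kappa>"
            unfolding \<kappa>_def
          proof (rule A(2)[OF n(1)])
            fix t assume t: "t \<in> T"
            have "l t x \<le> K * norm x" using K(2)[OF t, of x] by linarith
            also have "\<dots> \<le> K * M" using M[OF x] K by simp
            finally have "l t x * real n \<le> K * M * real n" by (intro mult_right_mono) auto
            moreover have "l t x * real n = l t (real n *\<^sub>R p + z)" using n lts[OF n(1) t, of z] by (simp add: x_def)
            ultimately show "0 \<le> l t (real n *\<^sub>R p + z) \<and> l t (real n *\<^sub>R p + z) \<le> K * M * real n"
              using True t by (auto simp: ok_def)
          qed
          moreover have "exp (- (k / 2 * (norm h)\<^sup>2) * real n) \<le> exp (- (k / 2 * \<delta>\<^sup>2) * real n)"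
          proof -
            have "\<delta>\<^sup>2 \<le> (norm h)\<^sup>2" using far \<delta> by (intro power_mono) auto
            then show ?thesis using k n by simp
          qed
          ultimately have "exp (- (k / 2 * (norm h)\<^sup>2) * real n) * stirling_weight n (real n *\<^sub>R p + z)
            \<le> exp (- (k / 2 * \<delta>\<^sup>2) * real n) * (A * real n) powr \<kappa>"
            using stirling_weight_nonneg by (intro mult_mono) auto
          also have "\<dots> \<le> 1" using elim(4) by (simp only: mult.commute)
          also have "\<dots> \<le> 4 powr \<kappa> + 1" by simp
          finally show ?thesis .
        qed
        then have "E * (exp (- (k / 2 * (norm h)\<^sup>2) * real n) * stirling_weight n (real n *\<^sub>R p + z)) \<le> E * (4 powr \<kappa> + 1)"
          by (rule mult_left_mono) (simp add: E_def)
        then have "\<bar>G n z\<bar> \<le> E * (4 powr \<kappa> + 1)" using g by (simp only: mult.assoc)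
        then show ?thesis unfolding z_def[symmetric] E_def by (simp only: mult.commute)
      qed
    qed
  qed
  have loc: "\<forall>\<^sub>F n in F. \<forall>y\<in>\<Lambda>. norm (v n + y) \<le> R * sqrt (real n) \<longrightarrow>
        \<bar>G n (v n + y) - exp (- Q (v n + y) (v n + y) / (2 * real n))\<bar> \<le> e"
    if R: "R > 0" and e: "e > 0" for R e
  proof -
    define S where "S = {(n, z). n > 0 \<and> z \<in> V \<and> norm z \<le> R * sqrt (real n) \<and> (\<forall>t\<in>T. l t (real n *\<^sub>R p + z) \<in> \<int>)}"
    \<comment> \<open>Convergence along \<open>H\<close> is convergence as \<open>n\<close> grows, uniformly in \<open>z\<close> with \<open>(n, z) \<in> S\<close>.\<close>
    define H where "H = inf (filtercomap fst F) (principal S)"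
    have evH: "eventually P H \<longleftrightarrow> (\<forall>\<^sub>F n in F. \<forall>z. (n, z) \<in> S \<longrightarrow> P (n, z))" for P
      unfolding H_def by (rule eventually_uniform_iff)
    have HS: "\<forall>\<^sub>F s in H. s \<in> S" by (simp add: evH)
    have limH: "filterlim fst at_top H"
      unfolding filterlim_def le_filter_def eventually_filtermap
      by (auto simp: evH dest!: filter_leD[OF F] elim!: eventually_mono)
    then have limr: "filterlim (\<lambda>s. real (fst s)) at_top H"
      by (rule filterlim_compose[OF filterlim_real_sequentially])
    have small: "((\<lambda>s. norm (snd s /\<^sub>R real (fst s))) \<longlongrightarrow> 0) H"
    proof (rule tendsto_sandwich[OF _ _ tendsto_const])
      have "((\<lambda>n. R / sqrt n) \<longlongrightarrow> 0) at_top" using R by real_asymp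
      from filterlim_compose[OF this limr] show "((\<lambda>s. R / sqrt (real (fst s))) \<longlongrightarrow> 0) H" .
      show "\<forall>\<^sub>F s in H. norm (snd s /\<^sub>R real (fst s)) \<le> R / sqrt (real (fst s))"
        using HS
      proof eventually_elim
        case (elim s)
        obtain n z where s: "s = (n, z)" by (cases s)
        have nz: "n > 0" "norm z \<le> R * sqrt (real n)" using elim by (auto simp: S_def s)
        have "norm z / real n \<le> R * sqrt (real n) / real n" using nz by (intro divide_right_mono) auto
        also have "\<dots> = R / sqrt (real n)" using nz by (simp add: field_simps)
        finally show ?case by (simp add: s divide_inverse mult.commute)
      qed
      show "\<forall>\<^sub>F s in H. 0 \<le> norm (snd s /\<^sub>R real (fst s))" by (intro always_eventually allI norm_ge_zero)
    qed
    then have small0: "((\<lambda>s. snd s /\<^sub>R real (fst s)) \<longlongrightarrow> 0) H" by (rule tendsto_norm_zero_cancel)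
    have near: "((\<lambda>s. l t (real (fst s) *\<^sub>R p + snd s) / real (fst s)) \<longlongrightarrow> l t p) H" if t: "t \<in> T" for t
    proof -
      have "((\<lambda>s. l t (p + snd s /\<^sub>R real (fst s))) \<longlongrightarrow> l t (p + 0)) H"
        by (rule bounded_linear.tendsto[OF linear_conv_bounded_linear[THEN iffD1, OF lin[OF t]]])
          (intro tendsto_intros small0)
      moreover have "\<forall>\<^sub>F s in H. l t (p + snd s /\<^sub>R real (fst s)) = l t (real (fst s) *\<^sub>R p + snd s) / real (fst s)"
        using HS by eventually_elim (use lts[OF _ t] in \<open>auto simp: S_def\<close>)
      ultimately show ?thesis by (simp add: Lim_transform_eventually)
    qed
    have W: "((\<lambda>s. stirling_weight (fst s) (real (fst s) *\<^sub>R p + snd s)) \<longlongrightarrow> 1) H"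
    proof (rule stirling_weight_tendsto[OF limH _ near])
      show "\<forall>\<^sub>F s in H. l t (real (fst s) *\<^sub>R p + snd s) \<in> \<int>" if "t \<in> T" for t
        using HS by eventually_elim (use that in \<open>auto simp: S_def\<close>)
    qed
    \<comment> \<open>The logarithm of the exponential factor divided by the Gaussian. In the ball
      of radius R sqrt n the Taylor error is at most n C1 (R / sqrt n)^3 = C1 R^3 / sqrt n.\<close>
    define \<epsilon> where "\<epsilon> s = real (fst s) * (Phi (p + snd s /\<^sub>R real (fst s)) - Phi p) + Q (snd s) (snd s) / (2 * real (fst s))"
      for s :: "nat \<times> 'a"
    have hsmall: "\<forall>\<^sub>F s in H. norm (snd s /\<^sub>R real (fst s)) < \<delta>"
      by (rule order_tendstoD(2)[OF small]) (use \<delta> in auto)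
    have "(\<epsilon> \<longlongrightarrow> 0) H"
    proof (rule Lim_null_comparison)
      have "((\<lambda>n. C1 * R ^ 3 / sqrt n) \<longlongrightarrow> 0) at_top" using R C1 by real_asymp
      from filterlim_compose[OF this limr] show "((\<lambda>s. C1 * R ^ 3 / sqrt (real (fst s))) \<longlongrightarrow> 0) H" .
      show "\<forall>\<^sub>F s in H. norm (\<epsilon> s) \<le> C1 * R ^ 3 / sqrt (real (fst s))"
        using HS hsmall
      proof eventually_elim
        case (elim s)
        obtain n z where s: "s = (n, z)" by (cases s)
        have nz: "real n > 0" "norm z \<le> R * sqrt (real n)" "z \<in> V" using elim by (auto simp: S_def s)
        define h where "h = z /\<^sub>R real n"
        have h: "h \<in> V" "norm h \<le> \<delta>" using nz V elim by (auto simp: h_def s subspace_scale)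
        have z: "z = real n *\<^sub>R h" using nz by (simp add: h_def)
        have "Q z z = real n * real n * Q h h"
          unfolding z using bilinear_Q by (simp add: bilinear_lmul bilinear_rmul)
        then have "\<epsilon> s = real n * (Phi (p + h) - Phi p - Lam h + Q h h / 2)"
          using nz Lam0[OF h(1)] by (simp add: \<epsilon>_def s h_def[symmetric] algebra_simps)
        then have "\<bar>\<epsilon> s\<bar> \<le> real n * (C1 * norm h ^ 3)"
          using tay[OF h(2)] nz by (simp add: abs_mult)
        also have "norm h ^ 3 \<le> (R / sqrt (real n)) ^ 3"
        proof (rule power_mono)
          have "norm z / real n \<le> R * sqrt (real n) / real n" using nz by (intro divide_right_mono) auto
          also have "\<dots> = R / sqrt (real n)" using nz by (simp add: field_simps)
          finally show "norm h \<le> R / sqrt (real n)" by (simp add: h_def divide_inverse mult.commute)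
        qed simp
        then have "real n * (C1 * norm h ^ 3) \<le> real n * (C1 * (R / sqrt (real n)) ^ 3)"
          using nz C1 by (intro mult_left_mono) auto
        also have "\<dots> = C1 * R ^ 3 / sqrt (real n)"
          using nz by (simp add: power_divide power3_eq_cube)
        finally show ?case by (simp add: s)
      qed
    qed
    then have EE: "((\<lambda>s. exp (\<epsilon> s)) \<longlongrightarrow> 1) H" using tendsto_exp by fastforce
    have "((\<lambda>s. exp (\<epsilon> s) * stirling_weight (fst s) (real (fst s) *\<^sub>R p + snd s) - 1) \<longlongrightarrow> 1 * 1 - 1) H"
      by (intro tendsto_intros EE W)
    then have "\<forall>\<^sub>F s in H. \<bar>exp (\<epsilon> s) * stirling_weight (fst s) (real (fst s) *\<^sub>R p + snd s) - 1\<bar> < e"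
      using e by (auto simp: tendsto_iff dist_norm)
    with HS hsmall have "\<forall>\<^sub>F s in H. \<bar>G (fst s) (snd s) - exp (- Q (snd s) (snd s) / (2 * real (fst s)))\<bar> \<le> e"
    proof eventually_elim
      case (elim s)
      obtain n z where s: "s = (n, z)" by (cases s)
      have nz: "n > 0" "z \<in> V" using elim by (auto simp: S_def s)
      have "0 \<le> l t (real n *\<^sub>R p + z)" if t: "t \<in> T" for t
      proof -
        have "\<bar>l t (z /\<^sub>R real n)\<bar> \<le> l t p / 2" using elim t by (intro lt) (auto simp: s)
        then have "0 \<le> l t p + l t (z /\<^sub>R real n)" using pos[OF t] by linarith
        then have "0 \<le> l t (p + z /\<^sub>R real n)" by (simp add: linear_add[OF lin[OF t]])
        then show ?thesis unfolding lts[OF nz(1) t] using nz by (simp add: zero_le_divide_iff)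
      qed
      then have ok: "ok n z" by (simp add: ok_def)
      define E where "E = exp (- Q z z / (2 * real n))"
      have "Q z z \<ge> 0" using pd[of z] nz bilinear_Q by (cases "z = 0") (auto simp: V_def bilinear_lzero)
      then have E: "0 < E" "E \<le> 1" by (auto simp: E_def)
      have "exp (real n * (Phi (p + z /\<^sub>R real n) - Phi p)) = exp (\<epsilon> s) * E"
        by (simp add: \<epsilon>_def s E_def flip: exp_add)
      then have "G n z - E = E * (exp (\<epsilon> s) * stirling_weight n (real n *\<^sub>R p + z) - 1)"
        using ok by (simp add: G_def algebra_simps)
      then have "\<bar>G n z - E\<bar> = E * \<bar>exp (\<epsilon> s) * stirling_weight n (real n *\<^sub>R p + z) - 1\<bar>"
        using E by (simp add: abs_mult)
      also have "\<dots> \<le> 1 * e" using elim E by (intro mult_mono) (auto simp: s)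
      finally show ?case by (simp add: s E_def)
    qed
    then have "\<forall>\<^sub>F n in F. \<forall>z. (n, z) \<in> S \<longrightarrow> \<bar>G n z - exp (- Q z z / (2 * real n))\<bar> \<le> e"
      by (simp add: evH)
    then show ?thesis using npos v int
    proof eventually_elim
      case (elim n)
      show ?case
      proof (intro ballI impI)
        fix y assume y: "y \<in> \<Lambda>" "norm (v n + y) \<le> R * sqrt (real n)"
        have "(n, v n + y) \<in> S" using elim y \<Lambda>V by (auto simp: S_def \<Lambda>_def V_def intro: span_add)
        then show "\<bar>G n (v n + y) - exp (- Q (v n + y) (v n + y) / (2 * real n))\<bar> \<le> e" using elim by blast
      qed
    qed
  qed
  have "((\<lambda>n. infsum (\<lambda>y. G n (v n + y)) (lattice_span bs) / (2 * pi * real n) powr (real (length bs) / 2))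
     \<longlongrightarrow> 1 / sqrt (form_det Q bs)) F"
    by (rule lattice_laplace[OF bilinear_Q Q_sym ind _ F v _ dom[unfolded \<Lambda>_def] loc[unfolded \<Lambda>_def]])
      (use pd k in auto)
  moreover have "\<forall>\<^sub>F n in F. infsum (\<lambda>y. G n (v n + y)) (lattice_span bs) / (2 * pi * real n) powr (real (length bs) / 2)
    = infsum (\<lambda>x. exp (real n * (Phi (x /\<^sub>R real n) - Phi p)) * stirling_weight n x) (X n)
      / (2 * pi * real n) powr (real (length bs) / 2)"
    using npos X
  proof eventually_elim
    case (elim n)
    define Y where "Y = {y \<in> \<Lambda>. ok n (v n + y)}"
    define g where "g x = exp (real n * (Phi (x /\<^sub>R real n) - Phi p)) * stirling_weight n x" for x
    have gp: "(real n *\<^sub>R p + z) /\<^sub>R real n = p + z /\<^sub>R real n" for z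
      using elim by (simp add: scaleR_add_right)
    have "infsum (\<lambda>y. G n (v n + y)) \<Lambda> = infsum (\<lambda>y. g (real n *\<^sub>R p + (v n + y))) Y"
      by (rule infsum_cong_neutral) (auto simp: Y_def G_def g_def gp)
    also have "\<dots> = infsum g ((\<lambda>y. real n *\<^sub>R p + (v n + y)) ` Y)"
      by (subst infsum_reindex) (auto simp: inj_on_def o_def)
    also have "(\<lambda>y. real n *\<^sub>R p + (v n + y)) ` Y = X n"
    proof (intro equalityI subsetI)
      fix x assume x: "x \<in> X n"
      then show "x \<in> (\<lambda>y. real n *\<^sub>R p + (v n + y)) ` Y"
        by (intro image_eqI[of _ _ "x - real n *\<^sub>R p - v n"]) (use elim in \<open>auto simp: Y_def ok_def \<Lambda>_def\<close>)
    qed (use elim in \<open>auto simp: Y_def ok_def \<Lambda>_def\<close>)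
    finally show ?case by (simp add: \<Lambda>_def g_def)
  qed
  ultimately show ?thesis by (rule Lim_transform_eventually)
qed

end

section \<open>The function phi\<close>

text \<open>\<open>phi\<close> is a linear combination of values \<open>xlnx (l x)\<close> for linear forms \<open>l\<close>. The form of index
  \<open>(i, e, Inl f)\<close> is the variable \<open>x\<^sub>i\<^sub>e\<^sub>f\<close>; those of index \<open>(i, e, Inr k)\<close> with \<open>k = 0, 1, 2\<close> are
  \<open>\<sigma>\<^sub>i\<^sub>e\<close>, \<open>\<tau>\<^sub>i\<^sub>e\<close> and \<open>\<gamma>\<^sub>i\<^sub>e\<close>.\<close>

definition form_index :: "('e::finite \<Rightarrow> 'v::finite set) \<Rightarrow> ('v \<times> 'e \<times> ('e + nat)) set" where
  "form_index ends = (SIGMA i:UNIV. SIGMA e:incident ends i. incident ends i <+> {0, 1, 2})"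

text \<open>Also the exponents of the factorials in \<open>count_term\<close>: - 1 for every entry
  from the multinomial coefficient and 1/2 for each of the four classes from the edge weights. A
  diagonal entry receives both.\<close>

definition form_coeff :: "'v \<times> 'e \<times> ('e + nat) \<Rightarrow> real" where
  "form_coeff = (\<lambda>(i, e, s). case s of Inl f \<Rightarrow> if f = e then - 1/2 else - 1 | Inr k \<Rightarrow> 1/2)"

definition form :: "('e::finite \<Rightarrow> 'v::finite set) \<Rightarrow> 'v \<times> 'e \<times> ('e + nat) \<Rightarrow> real ^ 'e ^ 'e ^ 'v \<Rightarrow> real" where
  "form ends = (\<lambda>(i, e, s) x. case s of Inl f \<Rightarrow> x $ i $ e $ f
     | Inr k \<Rightarrow> if k = 0 then sigma_var ends x i e else if k = 1 then tau_var ends x i e else gamma_var ends x i e)"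

lemma form_simps [simp]:
  "form ends (i, e, Inl f) x = x $ i $ e $ f"
  "form ends (i, e, Inr 0) x = sigma_var ends x i e"
  "form ends (i, e, Inr 1) x = tau_var ends x i e"
  "form ends (i, e, Inr (Suc 0)) x = tau_var ends x i e"
  "form ends (i, e, Inr 2) x = gamma_var ends x i e"
  by (simp_all add: form_def)

lemma form_coeff_simps [simp]:
  "form_coeff (i, e, Inl f) = (if f = e then - 1/2 else - 1)"
  "form_coeff (i, e, Inr k) = 1/2"
  by (simp_all add: form_coeff_def)

lemma finite_form_index [simp]: "finite (form_index ends)"
  by (auto simp: form_index_def)

lemma form_index_cases:
  assumes "t \<in> form_index ends"
  obtains i e f where "t = (i, e, Inl f)" "e \<in> incident ends i" "f \<in> incident ends i"
    | i e where "t = (i, e, Inr 0)" "e \<in> incident ends i"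
    | i e where "t = (i, e, Inr 1)" "e \<in> incident ends i"
    | i e where "t = (i, e, Inr 2)" "e \<in> incident ends i"
  using assms by (auto simp: form_index_def)

text \<open>\<open>h\<close> is kept general because the same sum occurs with \<open>xlnx\<close>
  (for \<open>phi\<close>), with ln of \<open>rfact\<close> (for the count term), with the identity
  (for the linear terms of Stirling's formula), and at x0 with ln and with a constant.\<close>

lemma sum_form_index:
  fixes h :: "real \<Rightarrow> real"
  shows "(\<Sum>t\<in>form_index ends. form_coeff t * h (form ends t x)) = (\<Sum>i\<in>UNIV. \<Sum>e\<in>incident ends i.
    (h (x $ i $ e $ e) + h (sigma_var ends x i e) + h (tau_var ends x i e) + h (gamma_var ends x i e)) / 2
    - (\<Sum>f\<in>incident ends i. h (x $ i $ e $ f)))"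
proof -
  define k where "k t = form_coeff t * h (form ends t x)" for t
  have "(\<Sum>t\<in>form_index ends. k t) = (\<Sum>i\<in>UNIV. \<Sum>e\<in>incident ends i. \<Sum>s\<in>incident ends i <+> {0, 1, 2}. k (i, e, s))"
  proof -
    have "(\<Sum>t\<in>form_index ends. k t) = (\<Sum>i\<in>UNIV. \<Sum>u\<in>incident ends i \<times> (incident ends i <+> {0, 1, 2}). k (i, u))"
      unfolding form_index_def
      using sum.Sigma[of UNIV "\<lambda>i. incident ends i \<times> (incident ends i <+> {0, 1, 2})" "\<lambda>i u. k (i, u)"] by simp
    then show ?thesis by (simp only: sum_Times)
  qed
  also have "\<dots> = (\<Sum>i\<in>UNIV. \<Sum>e\<in>incident ends i.
    (h (x $ i $ e $ e) + h (sigma_var ends x i e) + h (tau_var ends x i e) + h (gamma_var ends x i e)) / 2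
    - (\<Sum>f\<in>incident ends i. h (x $ i $ e $ f)))"
  proof (intro sum.cong refl)
    fix i e assume e: "e \<in> incident ends i"
    have "(\<Sum>f\<in>incident ends i - {e}. k (i, e, Inl f)) = (\<Sum>f\<in>incident ends i - {e}. - h (x $ i $ e $ f))"
      by (intro sum.cong refl) (auto simp: k_def)
    then have "(\<Sum>f\<in>incident ends i. k (i, e, Inl f)) = h (x $ i $ e $ e) / 2 - (\<Sum>f\<in>incident ends i. h (x $ i $ e $ f))"
      using e by (simp add: sum.remove[of _ e] sum_negf k_def)
    then show "(\<Sum>s\<in>incident ends i <+> {0, 1, 2}. k (i, e, s)) =
      (h (x $ i $ e $ e) + h (sigma_var ends x i e) + h (tau_var ends x i e) + h (gamma_var ends x i e)) / 2
      - (\<Sum>f\<in>incident ends i. h (x $ i $ e $ f))"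
      by (simp add: sum.Plus k_def add_divide_distrib)
  qed
  finally show ?thesis by (simp add: k_def)
qed

lemma phi_eq: "phi ends x = (\<Sum>t\<in>form_index ends. form_coeff t * xlnx (form ends t x))"
  unfolding phi_def sum_form_index sum_distrib_left
proof (intro sum.cong refl)
  fix i e assume "e \<in> incident ends i"
  then show "1 / 2 * (xlnx (sigma_var ends x i e) + xlnx (tau_var ends x i e) + xlnx (gamma_var ends x i e)
       - xlnx (x $ i $ e $ e) - (\<Sum>f\<in>incident ends i - {e}. 2 * xlnx (x $ i $ e $ f)))
    = (xlnx (x $ i $ e $ e) + xlnx (sigma_var ends x i e) + xlnx (tau_var ends x i e) + xlnx (gamma_var ends x i e)) / 2
      - (\<Sum>f\<in>incident ends i. xlnx (x $ i $ e $ f))"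
    by (simp add: sum.remove[of _ e] algebra_simps flip: sum_distrib_left)
qed

lemma linear_form: "linear (form ends t)"
proof -
  have vec: "linear (\<lambda>x :: real ^ 'e ^ 'e ^ 'v. x $ i $ e $ f)" for i e f
    by (intro linearI) auto
  have sums: "linear (\<lambda>x. sigma_var ends x i e)" "linear (\<lambda>x. tau_var ends x i e)" "linear (\<lambda>x. gamma_var ends x i e)" for i e
    unfolding sigma_var_def tau_var_def gamma_var_def by (intro linear_compose_sum ballI vec)+
  obtain i e s where t: "t = (i, e, s)" by (cases t)
  show ?thesis
  proof (cases s)
    case (Inl f)
    then show ?thesis using vec[of i e f] by (simp add: t form_def)
  next
    case (Inr k)
    then show ?thesis using sums[of i e] by (cases "k = 0"; cases "k = 1") (simp_all add: t form_def)
  qed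
qed

lemma form_x0:
  assumes reg: "regular ends d" and e: "e \<in> incident ends i"
  shows "f \<in> incident ends i \<Longrightarrow> x0 ends d $ i $ e $ f = 1 / (real d)\<^sup>2"
    and "sigma_var ends (x0 ends d) i e = (real d - 1) / (real d)\<^sup>2"
    and "tau_var ends (x0 ends d) i e = (real d - 1) / (real d)\<^sup>2"
    and "gamma_var ends (x0 ends d) i e = (real d - 1)\<^sup>2 / (real d)\<^sup>2"
proof -
  have "card (incident ends i) = d" using reg by (simp add: regular_def)
  then have c: "real (card (incident ends i - {e})) = real d - 1"
    using e by (metis One_nat_def card_Diff_singleton card_gt_0_iff empty_iff finite of_nat_1 of_nat_diff Suc_leI)
  show "f \<in> incident ends i \<Longrightarrow> x0 ends d $ i $ e $ f = 1 / (real d)\<^sup>2" using e by (simp add: x0_def)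
  define J where "J = incident ends i - {e}"
  have x: "x0 ends d $ i $ a $ b = 1 / (real d)\<^sup>2" if "a \<in> insert e J" "b \<in> insert e J" for a b
    using that e by (auto simp: x0_def J_def)
  have "sigma_var ends (x0 ends d) i e = (\<Sum>f\<in>J. 1 / (real d)\<^sup>2)" "tau_var ends (x0 ends d) i e = (\<Sum>f\<in>J. 1 / (real d)\<^sup>2)"
    "gamma_var ends (x0 ends d) i e = (\<Sum>f\<in>J. \<Sum>f\<in>J. 1 / (real d)\<^sup>2)"
    unfolding sigma_var_def tau_var_def gamma_var_def J_def[symmetric] by (intro sum.cong refl x; simp)+
  then show "sigma_var ends (x0 ends d) i e = (real d - 1) / (real d)\<^sup>2" "tau_var ends (x0 ends d) i e = (real d - 1) / (real d)\<^sup>2"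
    "gamma_var ends (x0 ends d) i e = (real d - 1)\<^sup>2 / (real d)\<^sup>2"
    by (simp_all only: sum_constant c[folded J_def]) (simp_all add: power2_eq_square)
qed

lemma form_x0_pos:
  assumes reg: "regular ends d" and d: "d \<ge> 2" and t: "t \<in> form_index ends"
  shows "form ends t (x0 ends d) > 0"
  using t d by (cases rule: form_index_cases) (auto simp: form_x0[OF reg] simp del: One_nat_def)

lemma entropy_sum_phi:
  assumes "regular ends d" "d \<ge> 2"
  shows "entropy_sum (form_index ends) (form ends) (x0 ends d)"
  by (rule entropy_sum.intro) (rule finite_form_index linear_form form_x0_pos[OF assms]; assumption)+

text \<open>The linear terms of Stirling's formula depend on the total mass only; at a count vector
  they cancel against those of the power g (1 - d/2) of n!.\<close>

lemma sum_coeff_form: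
  assumes "regular ends d"
  shows "(\<Sum>t\<in>form_index ends. form_coeff t * form ends t x)
    = (real d / 2 - 1) * (\<Sum>i\<in>UNIV. \<Sum>e\<in>incident ends i. \<Sum>f\<in>incident ends i. x $ i $ e $ f)"
  unfolding sum_form_index[where h = "\<lambda>y. y"] sum_distrib_left[of _ _ UNIV]
proof (rule sum.cong[OF refl])
  fix i
  define w where "w = (\<Sum>e\<in>incident ends i. \<Sum>f\<in>incident ends i. x $ i $ e $ f)"
  have "(\<Sum>e\<in>incident ends i. (x $ i $ e $ e + sigma_var ends x i e + tau_var ends x i e + gamma_var ends x i e) / 2
      - (\<Sum>f\<in>incident ends i. x $ i $ e $ f)) = (\<Sum>e\<in>incident ends i. w / 2 - (\<Sum>f\<in>incident ends i. x $ i $ e $ f))"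
    by (intro sum.cong refl) (simp only: w_def total_split(3))
  also have "\<dots> = (real d / 2 - 1) * w"
    using assms by (simp add: sum_subtractf w_def[symmetric] algebra_simps regular_def)
  finally show "(\<Sum>e\<in>incident ends i. (x $ i $ e $ e + sigma_var ends x i e + tau_var ends x i e + gamma_var ends x i e) / 2
      - (\<Sum>f\<in>incident ends i. x $ i $ e $ f)) = (real d / 2 - 1) * (\<Sum>e\<in>incident ends i. \<Sum>f\<in>incident ends i. x $ i $ e $ f)"
    by (simp only: w_def)
qed

lemma sum_form_x0:
  fixes ends :: "'e::finite \<Rightarrow> 'v::finite set" and h :: "real \<Rightarrow> real"
  assumes reg: "regular ends d"
  shows "(\<Sum>t\<in>form_index ends. form_coeff t * h (form ends t (x0 ends d)))
    = real CARD('v) * real d * (h ((real d - 1) / (real d)\<^sup>2) + h ((real d - 1)\<^sup>2 / (real d)\<^sup>2) / 2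
      + (1/2 - real d) * h (1 / (real d)\<^sup>2))"
proof -
  have "(\<Sum>t\<in>form_index ends. form_coeff t * h (form ends t (x0 ends d))) = (\<Sum>i\<in>(UNIV::'v set). \<Sum>e\<in>incident ends i.
      h ((real d - 1) / (real d)\<^sup>2) + h ((real d - 1)\<^sup>2 / (real d)\<^sup>2) / 2 + (1/2 - real d) * h (1 / (real d)\<^sup>2))"
    unfolding sum_form_index
  proof (intro sum.cong refl)
    fix i e assume e: "e \<in> incident ends i"
    have "(\<Sum>f\<in>incident ends i. h (x0 ends d $ i $ e $ f)) = (\<Sum>f\<in>incident ends i. h (1 / (real d)\<^sup>2))"
      by (intro sum.cong refl) (simp only: form_x0[OF reg e])
    also have "\<dots> = real d * h (1 / (real d)\<^sup>2)" using reg by (simp add: regular_def)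
    finally show "(h (x0 ends d $ i $ e $ e) + h (sigma_var ends (x0 ends d) i e) + h (tau_var ends (x0 ends d) i e)
        + h (gamma_var ends (x0 ends d) i e)) / 2 - (\<Sum>f\<in>incident ends i. h (x0 ends d $ i $ e $ f))
      = h ((real d - 1) / (real d)\<^sup>2) + h ((real d - 1)\<^sup>2 / (real d)\<^sup>2) / 2 + (1/2 - real d) * h (1 / (real d)\<^sup>2)"
      unfolding form_x0(2-4)[OF reg e] form_x0(1)[OF reg e e] by (simp add: algebra_simps add_divide_distrib)
  qed
  also have "\<dots> = real CARD('v) * real d * (h ((real d - 1) / (real d)\<^sup>2) + h ((real d - 1)\<^sup>2 / (real d)\<^sup>2) / 2
      + (1/2 - real d) * h (1 / (real d)\<^sup>2))"
    using reg by (simp add: regular_def)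
  finally show ?thesis .
qed

lemma ln_degree_quotients:
  assumes "d \<ge> 2"
  shows "ln (1 / (real d)\<^sup>2) = - 2 * ln (real d)"
    and "ln ((real d - 1) / (real d)\<^sup>2) = ln (real d - 1) - 2 * ln (real d)"
    and "ln ((real d - 1)\<^sup>2 / (real d)\<^sup>2) = 2 * ln (real d - 1) - 2 * ln (real d)"
  using assms by (simp_all add: ln_div ln_realpow)

text \<open>The contribution of one vertex is the logarithm of (d - 1)^(d - 1) / d^(d - 2), the base
  of the exponential growth.\<close>

lemma phi_x0:
  fixes ends :: "'e::finite \<Rightarrow> 'v::finite set"
  assumes reg: "regular ends d" and d: "d \<ge> 2"
  shows "phi ends (x0 ends d) = real CARD('v) * ((real d - 1) * ln (real d - 1) - (real d - 2) * ln (real d))"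
proof -
  define D L where "D = ln (real d)" and "L = ln (real d - 1)"
  have "real d > 0" using d by auto
  then show ?thesis
    unfolding phi_eq sum_form_x0[OF reg, of xlnx] unfolding xlnx_def ln_degree_quotients[OF d] D_def[symmetric] L_def[symmetric]
    by (simp add: power2_eq_square divide_simps) (simp add: algebra_simps)
qed

section \<open>The count terms in exponential form\<close>

lemma count_vectors_form_Nats:
  assumes "x \<in> count_vectors ends n"
  shows "form ends t x \<in> \<nat>"
proof -
  have "x $ i $ e $ f = real (nat \<lfloor>x $ i $ e $ f\<rfloor>)" for i e f
  proof -
    have "x $ i $ e $ f \<in> \<nat>" using assms by (simp add: count_vectors_def)
    then show ?thesis by (auto elim!: Nats_cases)
  qed
  then obtain N where N: "x $ i $ e $ f = real (N i e f)" for i e f by (rule that)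
  have sums: "sigma_var ends x i e \<in> \<nat>" "tau_var ends x i e \<in> \<nat>" "gamma_var ends x i e \<in> \<nat>" for i e
    unfolding sigma_var_def tau_var_def gamma_var_def N of_nat_sum[symmetric] by (rule of_nat_in_Nats)+
  obtain i e s where t: "t = (i, e, s)" by (cases t)
  show ?thesis unfolding t form_def N using sums[of i e] by (cases s) (simp_all add: N)
qed

lemma rfact_neq_0 [simp]: "rfact y \<noteq> 0"
  using rfact_pos[of y] by linarith

lemma stirling_quot_neq_0 [simp]: "stirling_quot m \<noteq> 0"
  using stirling_quot_pos[of m] by linarith

lemma ln_count_term:
  fixes ends :: "'e::finite \<Rightarrow> 'v::finite set"
  assumes reg: "regular ends d"
  shows "ln (count_term ends n x) = real CARD('v) * (1 - real d / 2) * ln (fact n)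
    + (\<Sum>t\<in>form_index ends. form_coeff t * ln (rfact (form ends t x)))"
    and "count_term ends n x > 0"
proof -
  define r where "r y = ln (rfact y)" for y
  define N :: real where "N = fact n"
  have N: "N > 0" by (simp add: N_def)
  have card: "card (incident ends i) = d" for i using reg by (simp add: regular_def)
  have w: "edge_weight ends x i e > 0" for i e by (simp add: edge_weight_def)
  have pos: "(\<Prod>e\<in>incident ends i. \<Prod>f\<in>incident ends i. rfact (x $ i $ e $ f)) > 0"
    "(\<Prod>e\<in>incident ends i. sqrt (edge_weight ends x i e / N)) > 0" for i
    by (intro prod_pos ballI rfact_pos real_sqrt_gt_zero divide_pos_pos w N)+
  show "count_term ends n x > 0"
    unfolding count_term_def N_def[symmetric] by (intro prod_pos ballI mult_pos_pos divide_pos_pos pos N rfact_pos)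
  have "ln (count_term ends n x) = (\<Sum>i\<in>UNIV. ln (N / (\<Prod>e\<in>incident ends i. \<Prod>f\<in>incident ends i. rfact (x $ i $ e $ f))
       * (\<Prod>e\<in>incident ends i. sqrt (edge_weight ends x i e / N))))"
    unfolding count_term_def N_def[symmetric] by (rule ln_prod) (simp, rule less_imp_neq[symmetric], intro mult_pos_pos divide_pos_pos pos N)
  also have "\<dots> = (\<Sum>i\<in>UNIV. (1 - real d / 2) * ln N + (\<Sum>e\<in>incident ends i.
    (r (x $ i $ e $ e) + r (sigma_var ends x i e) + r (tau_var ends x i e) + r (gamma_var ends x i e)) / 2
    - (\<Sum>f\<in>incident ends i. r (x $ i $ e $ f))))"
  proof (rule sum.cong[OF refl])
    fix i
    have a: "ln (\<Prod>e\<in>incident ends i. \<Prod>f\<in>incident ends i. rfact (x $ i $ e $ f))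
      = (\<Sum>e\<in>incident ends i. \<Sum>f\<in>incident ends i. r (x $ i $ e $ f))"
      by (simp add: ln_prod r_def)
    have "ln (\<Prod>e\<in>incident ends i. sqrt (edge_weight ends x i e / N)) = (\<Sum>e\<in>incident ends i. ln (sqrt (edge_weight ends x i e / N)))"
      
      by (rule ln_prod[OF finite]) (intro less_imp_neq[symmetric] real_sqrt_gt_zero divide_pos_pos w N)
    also have "\<dots> = (\<Sum>e\<in>incident ends i. (r (x $ i $ e $ e) + r (sigma_var ends x i e) + r (tau_var ends x i e) + r (gamma_var ends x i e)) / 2 - ln N / 2)"
    proof (intro sum.cong refl)
      fix e
      have "ln (edge_weight ends x i e) = r (x $ i $ e $ e) + r (sigma_var ends x i e) + r (tau_var ends x i e) + r (gamma_var ends x i e)"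
        by (simp add: edge_weight_def r_def ln_mult)
      then show "ln (sqrt (edge_weight ends x i e / N)) = (r (x $ i $ e $ e) + r (sigma_var ends x i e) + r (tau_var ends x i e) + r (gamma_var ends x i e)) / 2 - ln N / 2"
        using w[of i e] N by (simp add: ln_sqrt ln_div diff_divide_distrib)
    qed
    finally have b: "ln (\<Prod>e\<in>incident ends i. sqrt (edge_weight ends x i e / N)) = \<dots>" .
    show "ln (N / (\<Prod>e\<in>incident ends i. \<Prod>f\<in>incident ends i. rfact (x $ i $ e $ f)) * (\<Prod>e\<in>incident ends i. sqrt (edge_weight ends x i e / N)))
      = (1 - real d / 2) * ln N + (\<Sum>e\<in>incident ends i.
    (r (x $ i $ e $ e) + r (sigma_var ends x i e) + r (tau_var ends x i e) + r (gamma_var ends x i e)) / 2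
    - (\<Sum>f\<in>incident ends i. r (x $ i $ e $ f)))"
      using N less_imp_neq[OF w, symmetric] by (simp add: ln_mult ln_div a b sum_subtractf card algebra_simps)
  qed
  also have "\<dots> = real CARD('v) * (1 - real d / 2) * ln (fact n)
    + (\<Sum>t\<in>form_index ends. form_coeff t * ln (rfact (form ends t x)))"
    unfolding sum_form_index[where h = "\<lambda>y. ln (rfact y)"] by (simp add: sum.distrib N_def r_def)
  finally show "ln (count_term ends n x) = real CARD('v) * (1 - real d / 2) * ln (fact n)
    + (\<Sum>t\<in>form_index ends. form_coeff t * ln (rfact (form ends t x)))" .
qed

text \<open>An exact identity, obtained by taking logarithms. Normalising the Stirling factors at x0
  contributes \<Prod> (2 pi n l_t(x0))^(c_t / 2): the coefficients sum to g (2 d - d^2), which is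
  twice the exponent of 2 pi n, and half the sum of c_t ln l_t(x0) is the logarithm of ((d - 1) d^(d
  - 2))^(d g).\<close>

lemma count_term_eq:
  fixes ends :: "'e::finite \<Rightarrow> 'v::finite set"
  assumes reg: "regular ends d" and d: "d \<ge> 2" and n: "n > 0" and x: "x \<in> count_vectors ends n"
  defines "g \<equiv> real CARD('v)"
  shows "count_term ends n x = ((real d - 1) * real d ^ (d - 2)) ^ (d * CARD('v))
      * ((real d - 1) ^ (d - 1) / real d ^ (d - 2)) ^ (CARD('v) * n)
      * stirling_quot n powr (g * (1 - real d / 2)) * (2 * pi * real n) powr (g * (2 * real d - (real d)\<^sup>2) / 2)
      * (exp (real n * (phi ends (x /\<^sub>R real n) - phi ends (x0 ends d)))
        * entropy_sum.stirling_weight (form_index ends) form_coeff (form ends) (x0 ends d) n x)"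
proof -
  interpret E: entropy_sum "form_index ends" form_coeff "form ends" "x0 ends d"
    by (rule entropy_sum_phi[OF reg d])
  define D L where "D = ln (real d)" and "L = ln (real d - 1)"
  define s where "s t = ln (stirling_quot (nat \<lfloor>form ends t x\<rfloor>))" for t
  have d0: "real d > 0" "real d - 1 > 0" using d by auto
  have n0: "real n > 0" using n by simp
  have tot: "(\<Sum>e\<in>incident ends i. \<Sum>f\<in>incident ends i. x $ i $ e $ f) = real n" for i
    using x by (simp add: count_vectors_def)
  have r: "ln (rfact (form ends t x)) = s t + (real n * xlnx (form ends t (x /\<^sub>R real n)) + (ln (real n) - 1) * form ends t x)" for t
  proof -
    obtain N where N: "form ends t x = real N" using count_vectors_form_Nats[OF x] by (rule Nats_cases)
    have "form ends t (x /\<^sub>R real n) = real N / real n"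
      by (simp add: linear_cmul[OF linear_form] N divide_inverse mult.commute)
    then have "real n * xlnx (form ends t (x /\<^sub>R real n)) = real N * (ln (real N) - ln (real n))"
      using n0 by (cases "N = 0") (auto simp: xlnx_def ln_div)
    moreover have "ln (rfact (form ends t x)) = s t + (real N * ln (real N) - real N)"
      using stirling_quot_pos[of N] by (simp add: N s_def fact_eq_stirling_quot ln_mult_pos)
    ultimately show ?thesis by (simp add: N algebra_simps)
  qed
  have "(\<Sum>t\<in>form_index ends. form_coeff t * ln (rfact (form ends t x)))
    = (\<Sum>t\<in>form_index ends. form_coeff t * s t) + (real n * phi ends (x /\<^sub>R real n)
       + (ln (real n) - 1) * ((real d / 2 - 1) * (g * real n)))"
  proof -
    define a where "a t = form_coeff t * s t" for t
    define b where "b t = form_coeff t * xlnx (form ends t (x /\<^sub>R real n))" for t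
    define c where "c t = form_coeff t * form ends t x" for t
    have "(\<Sum>t\<in>form_index ends. form_coeff t * ln (rfact (form ends t x)))
      = (\<Sum>t\<in>form_index ends. a t + (real n * b t + (ln (real n) - 1) * c t))"
      unfolding r a_def b_def c_def by (intro sum.cong refl) (simp add: algebra_simps)
    also have "\<dots> = sum a (form_index ends) + (real n * sum b (form_index ends) + (ln (real n) - 1) * sum c (form_index ends))"
      by (simp only: sum.distrib sum_distrib_left)
    also have "sum b (form_index ends) = phi ends (x /\<^sub>R real n)" unfolding phi_eq by (intro sum.cong refl) (simp only: b_def)
    also have "sum c (form_index ends) = (real d / 2 - 1) * (g * real n)"
      unfolding c_def sum_coeff_form[OF reg] tot by (simp add: g_def)
    finally show ?thesis by (simp only: a_def)
  qed
  moreover have "ln (fact n) = ln (stirling_quot n) + (real n * ln (real n) - real n)"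
    using stirling_quot_pos[of n] by (simp add: fact_eq_stirling_quot ln_mult_pos)
  ultimately have lc: "ln (count_term ends n x) = g * (1 - real d / 2) * ln (stirling_quot n)
      + real n * phi ends (x /\<^sub>R real n) + (\<Sum>t\<in>form_index ends. form_coeff t * s t)"
    unfolding ln_count_term(1)[OF reg] g_def[symmetric] by (simp only:) (simp add: algebra_simps add_divide_distrib diff_divide_distrib)
  have px: "form ends t (x0 ends d) > 0" if "t \<in> form_index ends" for t using form_x0_pos[OF reg d that] .
  have wpos: "E.stirling_weight n x > 0" unfolding E.stirling_weight_def
  proof (rule prod_pos)
    fix t assume "t \<in> form_index ends"
    from px[OF this] have "sqrt (2 * pi * real n * form ends t (x0 ends d)) > 0" using n0 by simp
    then have "stirling_quot (nat \<lfloor>form ends t x\<rfloor>) / sqrt (2 * pi * real n * form ends t (x0 ends d)) > 0"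
      by (intro divide_pos_pos) auto
    then show "(stirling_quot (nat \<lfloor>form ends t x\<rfloor>) / sqrt (2 * pi * real n * form ends t (x0 ends d))) powr form_coeff t > 0"
      by (simp only: powr_gt_zero)
  qed
  have "ln (E.stirling_weight n x) = (\<Sum>t\<in>form_index ends. form_coeff t * (s t - (ln (2 * pi * real n) + ln (form ends t (x0 ends d))) / 2))"
  proof -
    have q: "stirling_quot m / sqrt (2 * pi * real n * form ends t (x0 ends d)) > 0" if "t \<in> form_index ends" for m t
      using px[OF that] n0 by simp
    have "ln (E.stirling_weight n x) = (\<Sum>t\<in>form_index ends. ln ((stirling_quot (nat \<lfloor>form ends t x\<rfloor>)
        / sqrt (2 * pi * real n * form ends t (x0 ends d))) powr form_coeff t))"
      unfolding E.stirling_weight_def 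
      by (rule ln_prod[OF finite_form_index]) (subst powr_eq_0_iff, rule less_imp_neq[symmetric], erule q)
    also have "\<dots> = (\<Sum>t\<in>form_index ends. form_coeff t * (s t - (ln (2 * pi * real n) + ln (form ends t (x0 ends d))) / 2))"
    proof (intro sum.cong refl)
      fix t assume t: "t \<in> form_index ends"
      have "ln (2 * pi * real n * form ends t (x0 ends d)) = ln (2 * pi * real n) + ln (form ends t (x0 ends d))"
        by (rule ln_mult_pos) (use px[OF t] n0 in auto)
      then show "ln ((stirling_quot (nat \<lfloor>form ends t x\<rfloor>) / sqrt (2 * pi * real n * form ends t (x0 ends d))) powr form_coeff t)
        = form_coeff t * (s t - (ln (2 * pi * real n) + ln (form ends t (x0 ends d))) / 2)"
        using px[OF t] n0 by (simp add: ln_powr ln_div ln_sqrt s_def)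
    qed
    finally show ?thesis .
  qed
  also have "\<dots> = (\<Sum>t\<in>form_index ends. form_coeff t * s t - ln (2 * pi * real n) / 2 * (form_coeff t * 1)
      - 1/2 * (form_coeff t * ln (form ends t (x0 ends d))))"
    by (intro sum.cong refl) (simp add: algebra_simps add_divide_distrib)
  also have "\<dots> = (\<Sum>t\<in>form_index ends. form_coeff t * s t) - (ln (2 * pi * real n) * (\<Sum>t\<in>form_index ends. form_coeff t * 1)
      + (\<Sum>t\<in>form_index ends. form_coeff t * ln (form ends t (x0 ends d)))) / 2"
    unfolding sum_subtractf sum_distrib_left[symmetric] by (simp add: add_divide_distrib)
  also have "(\<Sum>t\<in>form_index ends. form_coeff t * 1) = g * (2 * real d - (real d)\<^sup>2)"
    using sum_form_x0[OF reg, of "\<lambda>_. 1"] by (simp add: g_def power2_eq_square algebra_simps)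
  also have "(\<Sum>t\<in>form_index ends. form_coeff t * ln (form ends t (x0 ends d))) = 2 * g * real d * (L + (real d - 2) * D)"
    using sum_form_x0[OF reg, of ln] unfolding ln_degree_quotients[OF d] D_def[symmetric] L_def[symmetric] g_def[symmetric]
    by (simp add: algebra_simps add_divide_distrib diff_divide_distrib)
  finally have lw: "(\<Sum>t\<in>form_index ends. form_coeff t * s t) = ln (E.stirling_weight n x)
     + (ln (2 * pi * real n) * (g * (2 * real d - (real d)\<^sup>2)) + 2 * g * real d * (L + (real d - 2) * D)) / 2"
    by simp
  have "count_term ends n x = exp (ln (count_term ends n x))" using ln_count_term(2)[OF reg] by simp
  also have "ln (count_term ends n x) = g * real d * (L + (real d - 2) * D) + real n * phi ends (x0 ends d)
      + g * (1 - real d / 2) * ln (stirling_quot n) + g * (2 * real d - (real d)\<^sup>2) / 2 * ln (2 * pi * real n)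
      + (real n * (phi ends (x /\<^sub>R real n) - phi ends (x0 ends d)) + ln (E.stirling_weight n x))"
    unfolding lc lw by (simp add: algebra_simps add_divide_distrib diff_divide_distrib)
  also have "exp \<dots> = exp (g * real d * (L + (real d - 2) * D)) * exp (real n * phi ends (x0 ends d))
      * stirling_quot n powr (g * (1 - real d / 2)) * (2 * pi * real n) powr (g * (2 * real d - (real d)\<^sup>2) / 2)
      * (exp (real n * (phi ends (x /\<^sub>R real n) - phi ends (x0 ends d))) * E.stirling_weight n x)"
    using wpos n0 stirling_quot_pos[of n] by (simp add: exp_add powr_def)
  also have "exp (g * real d * (L + (real d - 2) * D)) = ((real d - 1) * real d ^ (d - 2)) ^ (d * CARD('v))"
  proof -
    have "ln ((real d - 1) * real d ^ (d - 2)) = L + (real d - 2) * D"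
      using d d0 by (simp add: ln_mult ln_realpow L_def D_def of_nat_diff)
    then have "exp (L + (real d - 2) * D) = (real d - 1) * real d ^ (d - 2)"
      using d0 by (metis exp_ln mult_pos_pos zero_less_power)
    then show ?thesis using exp_of_nat_mult[of "d * CARD('v)" "L + (real d - 2) * D"] by (simp add: g_def mult_ac)
  qed
  also have "exp (real n * phi ends (x0 ends d)) = ((real d - 1) ^ (d - 1) / real d ^ (d - 2)) ^ (CARD('v) * n)"
  proof -
    have "ln ((real d - 1) ^ (d - 1) / real d ^ (d - 2)) = (real d - 1) * L - (real d - 2) * D"
      using d d0 by (simp add: ln_div ln_realpow L_def D_def of_nat_diff)
    then have "exp ((real d - 1) * L - (real d - 2) * D) = (real d - 1) ^ (d - 1) / real d ^ (d - 2)"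
      using d0 by (metis exp_ln divide_pos_pos zero_less_power)
    then show ?thesis using exp_of_nat_mult[of "CARD('v) * n" "(real d - 1) * L - (real d - 2) * D"]
      unfolding phi_x0[OF reg d] by (simp add: L_def D_def mult_ac)
  qed
  finally show ?thesis .
qed

section \<open>The lattice and the feasible set\<close>

lemma Ints_inner_Basis_iff:
  fixes x :: "real ^ 'e::finite ^ 'f::finite ^ 'v::finite"
  shows "(\<forall>b\<in>Basis. x \<bullet> b \<in> \<int>) \<longleftrightarrow> (\<forall>i e f. x $ i $ e $ f \<in> \<int>)"
  by (auto simp: Basis_vec_def inner_axis)

lemma finite_image_Collect3:
  fixes F :: "'a::finite \<Rightarrow> 'b::finite \<Rightarrow> 'c::finite \<Rightarrow> 'd"
  shows "finite {F a b c | a b c. P a b c}"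
proof (rule finite_subset)
  show "{F a b c | a b c. P a b c} \<subseteq> (\<lambda>x. F (fst x) (fst (snd x)) (snd (snd x))) ` UNIV"
  proof clarify
    fix a b c
    show "F a b c \<in> (\<lambda>x. F (fst x) (fst (snd x)) (snd (snd x))) ` UNIV"
      by (rule image_eqI[of _ _ "(a, b, c)"]) simp_all
  qed
qed simp

lemma linear_component3: "linear (\<lambda>x :: real ^ 'e::finite ^ 'f::finite ^ 'v::finite. x $ i $ e $ f)"
  by (intro linearI) auto

text \<open>The equations of \<open>V_star\<close> as a finite set of functionals with integer
  coefficients, the shape in which \<open>integer_solutions_span\<close> is applied to V.\<close>

definition V_star_functionals :: "('e::finite \<Rightarrow> 'v::finite set) \<Rightarrow> (real ^ 'e ^ 'e ^ 'v \<Rightarrow> real) set" where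
  "V_star_functionals ends =
     {\<lambda>x. x $ i $ e $ f | i e f. \<not> (e \<in> incident ends i \<and> f \<in> incident ends i)}
   \<union> {\<lambda>x. x $ i $ e $ e - x $ j $ e $ e | e i j. i \<in> ends e \<and> j \<in> ends e}
   \<union> {\<lambda>x. (\<Sum>f\<in>incident ends i. x $ i $ e $ f) - (\<Sum>f\<in>incident ends j. x $ j $ e $ f) | e i j. i \<in> ends e \<and> j \<in> ends e}
   \<union> {\<lambda>x. (\<Sum>f\<in>incident ends i. x $ i $ f $ e) - (\<Sum>f\<in>incident ends j. x $ j $ f $ e) | e i j. i \<in> ends e \<and> j \<in> ends e}"

definition V_functionals :: "('e::finite \<Rightarrow> 'v::finite set) \<Rightarrow> (real ^ 'e ^ 'e ^ 'v \<Rightarrow> real) set" where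
  "V_functionals ends = V_star_functionals ends
     \<union> range (\<lambda>i x. \<Sum>e\<in>incident ends i. \<Sum>f\<in>incident ends i. x $ i $ e $ f)"

lemma ball_Collect3: "(\<forall>\<phi>\<in>{F a b c | a b c. P a b c}. Q \<phi>) \<longleftrightarrow> (\<forall>a b c. P a b c \<longrightarrow> Q (F a b c))"
  by blast

lemma ball_range: "(\<forall>\<phi>\<in>range F. Q \<phi>) \<longleftrightarrow> (\<forall>a. Q (F a))"
  by blast

lemma V_star_eq: "V_star ends = {x. \<forall>\<phi>\<in>V_star_functionals ends. \<phi> x = 0}"
  unfolding V_star_def var_space_def V_star_functionals_def ball_Un ball_Collect3 right_minus_eq mem_Collect_eq
  by (rule Collect_cong) blast

lemma V_set_eq: "V_set ends = {x. \<forall>\<phi>\<in>V_functionals ends. \<phi> x = 0}"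
  unfolding V_set_def V_star_def var_space_def V_functionals_def V_star_functionals_def ball_Un ball_Collect3 ball_range right_minus_eq
    mem_Collect_eq
  by (rule Collect_cong) blast

lemma finite_V_functionals: "finite (V_functionals ends)"
  unfolding V_functionals_def V_star_functionals_def by (intro finite_UnI finite_image_Collect3) auto

lemma linear_V_functionals: "\<phi> \<in> V_functionals ends \<Longrightarrow> linear \<phi>"
proof -
  have "\<forall>\<phi>\<in>V_functionals ends. linear \<phi>"
    unfolding V_functionals_def V_star_functionals_def ball_Un ball_Collect3 ball_range
    by (intro conjI allI impI linear_compose_sum linear_compose_sub linear_component3 ballI)
  then show "\<phi> \<in> V_functionals ends \<Longrightarrow> linear \<phi>" by blast
qed

lemma Ints_V_functionals:
  assumes "\<phi> \<in> V_functionals ends" "\<And>i e f. x $ i $ e $ f \<in> \<int>"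
  shows "\<phi> x \<in> \<int>"
proof -
  have "\<forall>\<phi>\<in>V_functionals ends. \<phi> x \<in> \<int>"
    unfolding V_functionals_def V_star_functionals_def ball_Un ball_Collect3 ball_range
    by (intro conjI allI impI Ints_sum Ints_diff assms(2))
  then show ?thesis using assms(1) by blast
qed

lemma subspace_common_kernel:
  assumes lin: "\<And>\<phi>. \<phi> \<in> \<Phi> \<Longrightarrow> linear \<phi>"
  shows "subspace {x. \<forall>\<phi>\<in>\<Phi>. \<phi> x = 0}"
proof -
  have "{x. \<forall>\<phi>\<in>\<Phi>. \<phi> x = 0} = (\<Inter>\<phi>\<in>\<Phi>. {x. \<phi> x = 0})" by blast
  then show ?thesis using lin by (auto intro!: subspace_Inter linear_subspace_kernel)
qed

lemma subspace_V_set: "subspace (V_set ends)"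
  unfolding V_set_eq by (rule subspace_common_kernel) (rule linear_V_functionals)

lemma subspace_V_star: "subspace (V_star ends)"
  unfolding V_star_eq
  by (rule subspace_common_kernel) (rule linear_V_functionals, unfold V_functionals_def, rule UnI1)

text \<open>V is cut out by functionals that are integral at integer points. Hence a basis of the
  lattice is also a basis of V, and volume and determinant can be taken in the same basis.\<close>

lemma span_L2_lattice: "span (L2_lattice ends) = V_set ends"
proof -
  have "span {x \<in> V_set ends. \<forall>b\<in>Basis. x \<bullet> b \<in> \<int>} = V_set ends"
    unfolding V_set_eq
  proof (rule integer_solutions_span)
    fix \<phi> :: "real ^ 'a ^ 'a ^ 'b \<Rightarrow> real" and x :: "real ^ 'a ^ 'a ^ 'b"
    assume \<phi>: "\<phi> \<in> V_functionals ends"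
    then show "linear \<phi>" by (rule linear_V_functionals)
    assume "\<And>b. b \<in> Basis \<Longrightarrow> x \<bullet> b \<in> \<int>"
    then have "\<forall>b\<in>Basis. x \<bullet> b \<in> \<int>" by blast
    then have "\<And>i e f. x $ i $ e $ f \<in> \<int>" unfolding Ints_inner_Basis_iff by blast
    then show "\<phi> x \<in> \<int>" by (rule Ints_V_functionals[OF \<phi>])
  qed (rule finite_V_functionals)
  then show ?thesis by (simp add: L2_lattice_def Ints_inner_Basis_iff)
qed

lemma lattice_basis_L2: "\<exists>bs. lattice_basis (L2_lattice ends) bs"
proof (rule integer_lattice_basis)
  show "0 \<in> L2_lattice ends" using subspace_0[OF subspace_V_set] by (simp add: L2_lattice_def)
  show "x - y \<in> L2_lattice ends" if "x \<in> L2_lattice ends" "y \<in> L2_lattice ends" for x y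
    using that subspace_diff[OF subspace_V_set] by (auto simp: L2_lattice_def)
  show "x \<bullet> b \<in> \<int>" if "x \<in> L2_lattice ends" "b \<in> Basis" for x b
    using that Ints_inner_Basis_iff[of x] by (auto simp: L2_lattice_def)
qed

section \<open>Determinants in a lattice basis\<close>

lemma lattice_basisD:
  assumes "lattice_basis L bs"
  shows "distinct bs" "independent (set bs)" "L = lattice_span bs" "span (set bs) = span L"
proof -
  show b: "distinct bs" "independent (set bs)" "L = lattice_span bs"
    using assms by (auto simp: lattice_basis_def lattice_span_eq)
  have "set bs \<subseteq> L" unfolding b(3) by (rule set_subset_lattice_span)
  then show "span (set bs) = span L"
    using lattice_span_subset_span[of bs] b(3) by (intro equalityI span_mono span_minimal) auto
qed

lemma form_det_pos:
  fixes B :: "'a::real_vector \<Rightarrow> 'a \<Rightarrow> real"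
  assumes "bilinear B" "\<And>x y. B x y = B y x" "distinct bs" "independent (set bs)"
    and "\<forall>x\<in>span (set bs). x \<noteq> 0 \<longrightarrow> B x x > 0"
  shows "form_det B bs > 0"
  by (rule gaussian_lattice_sum_tendsto(2)[OF assms order_refl, of "\<lambda>_. 0"]) (simp add: span_zero)

lemma bilinear_inner: "bilinear (\<bullet>)"
  unfolding bilinear_def by (auto intro!: linearI simp: inner_add)

text \<open>Both determinants change by the same non-zero square, so the basis picked by the choice
  operator may be exchanged for a lattice basis.\<close>

lemma det_on_eq:
  fixes B :: "'a::euclidean_space \<Rightarrow> 'a \<Rightarrow> real"
  assumes B: "bilinear B" and bs: "distinct bs" "independent (set bs)" "span (set bs) = V"
  shows "det_on B V = form_det B bs / form_det (\<bullet>) bs"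
proof -
  define zs where "zs = (SOME zs. subspace_basis V zs)"
  have "subspace_basis V bs" using bs by (simp add: subspace_basis_def)
  then have "subspace_basis V zs" unfolding zs_def by (rule someI)
  then have zs: "distinct zs" "independent (set zs)" "span (set zs) = V" by (simp_all add: subspace_basis_def)
  have "card (set zs) = card (set bs)"
    using dim_span_eq_card_independent[OF zs(2)] dim_span_eq_card_independent[OF bs(2)] zs(3) bs(3) by simp
  then have len: "length zs = length bs" using zs(1) bs(1) by (simp add: distinct_card)
  have "\<exists>c. zs ! k = (\<Sum>l<length bs. c l *\<^sub>R bs ! l)" if "k < length bs" for k
  proof -
    have "zs ! k \<in> set zs" using that len by simp
    then have "zs ! k \<in> span (set bs)" unfolding bs(3) zs(3)[symmetric] by (rule span_base)
    then show ?thesis by (rule span_set_sum) blast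
  qed
  then have "\<forall>k. \<exists>c. k < length bs \<longrightarrow> zs ! k = (\<Sum>l<length bs. c l *\<^sub>R bs ! l)" by blast
  from choice[OF this] obtain P where "\<forall>k. k < length bs \<longrightarrow> zs ! k = (\<Sum>l<length bs. P k l *\<^sub>R bs ! l)" ..
  then have P: "zs ! k = (\<Sum>l<length bs. P k l *\<^sub>R bs ! l)" if "k < length bs" for k using that by blast
  define p where "p = (Determinant.det (mat (length bs) (length bs) (\<lambda>(k, l). P k l)))\<^sup>2"
  have e: "form_det C zs = p * form_det C bs" if "bilinear C" for C :: "'a \<Rightarrow> 'a \<Rightarrow> real"
    unfolding p_def by (rule form_det_change_basis[OF that len refl P])
  have "form_det (\<bullet>) zs > 0"
    by (rule form_det_pos[OF bilinear_inner _ zs(1,2)]) (auto simp: inner_commute)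
  then have "p \<noteq> 0" using e[OF bilinear_inner] by auto
  then show ?thesis unfolding det_on_def zs_def[symmetric] Let_def e[OF B] e[OF bilinear_inner] by (rule mult_divide_mult_cancel_left)
qed

section \<open>Count vectors and feasible points as translates\<close>

lemma V_set_diff:
  assumes "x \<in> V_star ends" "y \<in> V_star ends"
    and "\<And>i. (\<Sum>e\<in>incident ends i. \<Sum>f\<in>incident ends i. x $ i $ e $ f) = (\<Sum>e\<in>incident ends i. \<Sum>f\<in>incident ends i. y $ i $ e $ f)"
  shows "x - y \<in> V_set ends"
  using subspace_diff[OF subspace_V_star assms(1,2)] assms(3) by (simp add: V_set_def sum_subtractf)

lemma V_set_add:
  assumes "x - y \<in> V_set ends" "y \<in> V_star ends"
  shows "x \<in> V_star ends"
    and "(\<Sum>e\<in>incident ends i. \<Sum>f\<in>incident ends i. x $ i $ e $ f) = (\<Sum>e\<in>incident ends i. \<Sum>f\<in>incident ends i. y $ i $ e $ f)"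
proof -
  have "(x - y) + y \<in> V_star ends" using assms by (intro subspace_add[OF subspace_V_star]) (auto simp: V_set_def)
  then show "x \<in> V_star ends" by simp
  show "(\<Sum>e\<in>incident ends i. \<Sum>f\<in>incident ends i. x $ i $ e $ f) = (\<Sum>e\<in>incident ends i. \<Sum>f\<in>incident ends i. y $ i $ e $ f)"
    using assms(1) by (simp add: V_set_def sum_subtractf)
qed

lemma forms_nonneg_iff:
  assumes "x \<in> var_space ends"
  shows "(\<forall>t\<in>form_index ends. 0 \<le> form ends t x) \<longleftrightarrow> (\<forall>i e f. 0 \<le> x $ i $ e $ f)"
proof
  assume *: "\<forall>t\<in>form_index ends. 0 \<le> form ends t x"
  show "\<forall>i e f. 0 \<le> x $ i $ e $ f"
  proof (intro allI)
    fix i e f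
    show "0 \<le> x $ i $ e $ f"
    proof (cases "e \<in> incident ends i \<and> f \<in> incident ends i")
      case True
      then have "(i, e, Inl f) \<in> form_index ends" by (auto simp: form_index_def)
      from bspec[OF * this] show ?thesis by simp
    qed (use assms in \<open>auto simp: var_space_def\<close>)
  qed
next
  assume "\<forall>i e f. 0 \<le> x $ i $ e $ f"
  then show "\<forall>t\<in>form_index ends. 0 \<le> form ends t x"
    by (auto elim!: form_index_cases simp: sigma_var_def tau_var_def gamma_var_def intro!: sum_nonneg simp del: One_nat_def)
qed

text \<open>Two count vectors have the same totals, so their difference is an integer vector of V.
  Conversely, adding such a vector preserves the equations and integrality, and nonnegativity of the
  forms makes the entries natural numbers.\<close>

lemma count_vectors_eq_translate:
  assumes y: "y \<in> count_vectors ends n"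
  shows "count_vectors ends n = {x. x - y \<in> L2_lattice ends \<and> (\<forall>t\<in>form_index ends. 0 \<le> form ends t x)}"
proof (intro equalityI subsetI CollectI)
  have yN: "y $ i $ e $ f \<in> \<int>" for i e f using y Nats_subset_Ints by (auto simp: count_vectors_def)
  have yV: "y \<in> V_star ends" using y by (simp add: count_vectors_def)
  {
    fix x assume x: "x \<in> count_vectors ends n"
    have "x $ i $ e $ f \<in> \<int>" for i e f using x Nats_subset_Ints by (auto simp: count_vectors_def)
    moreover have "x - y \<in> V_set ends" using x y by (intro V_set_diff) (auto simp: count_vectors_def)
    ultimately show "x - y \<in> L2_lattice ends \<and> (\<forall>t\<in>form_index ends. 0 \<le> form ends t x)"
      using yN count_vectors_form_Nats[OF x] by (auto simp: L2_lattice_def Nats_altdef2)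
  }
  fix x assume "x \<in> {x. x - y \<in> L2_lattice ends \<and> (\<forall>t\<in>form_index ends. 0 \<le> form ends t x)}"
  then have x: "x - y \<in> V_set ends" "\<And>i e f. (x - y) $ i $ e $ f \<in> \<int>" "\<forall>t\<in>form_index ends. 0 \<le> form ends t x"
    by (auto simp: L2_lattice_def)
  note xV = V_set_add[OF x(1) yV]
  have "x $ i $ e $ f \<in> \<nat>" for i e f
  proof -
    have "(x - y) $ i $ e $ f + y $ i $ e $ f \<in> \<int>" using x(2) yN by (rule Ints_add)
    moreover have "0 \<le> x $ i $ e $ f" using x(3) forms_nonneg_iff[of x] xV(1) by (simp add: V_star_def)
    ultimately show ?thesis by (simp add: Nats_altdef2)
  qed
  then show "x \<in> count_vectors ends n" using xV y by (simp add: count_vectors_def)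
qed

lemma count_vectors_nonempty:
  assumes ll: "loopless ends" and n: "n \<in> admissible ends"
  shows "count_vectors ends n \<noteq> {}"
proof -
  obtain f where f: "fractional_pm ends f" "\<And>e. real n * f e \<in> \<int>" using n by (auto simp: admissible_def)
  \<comment> \<open>the count vector of two equal matchings with \<open>n f(e)\<close> edges over each \<open>e\<close>\<close>
  define y :: "real ^ 'a ^ 'a ^ 'b" where "y = (\<chi> i e e'. if e = e' \<and> e \<in> incident ends i then real n * f e else 0)"
  have row: "(\<Sum>e'\<in>incident ends i. y $ i $ e $ e') = (if e \<in> incident ends i then real n * f e else 0)"
    "(\<Sum>e'\<in>incident ends i. y $ i $ e' $ e) = (if e \<in> incident ends i then real n * f e else 0)" for i e
    by (auto simp: y_def if_distrib cong: if_cong sum.cong)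
  have "y \<in> V_star ends" unfolding V_star_def
    using row by (auto simp: var_space_def) (auto simp: y_def incident_def)
  moreover have "y $ i $ e $ e' \<in> \<nat>" for i e e'
    using f by (auto simp: y_def Nats_altdef2 fractional_pm_def)
  moreover have "(\<Sum>e\<in>incident ends i. \<Sum>e'\<in>incident ends i. y $ i $ e $ e') = real n" for i
    using f(1) by (simp add: row fractional_pm_def flip: sum_distrib_left)
  ultimately have "y \<in> count_vectors ends n" by (simp add: count_vectors_def)
  then show ?thesis by blast
qed

lemma x0_V_star:
  fixes ends :: "'e::finite \<Rightarrow> 'v::finite set"
  assumes reg: "regular ends d" and d: "d \<ge> 1"
  shows "x0 ends d \<in> V_star ends"
    and "(\<Sum>e\<in>incident ends i. \<Sum>f\<in>incident ends i. x0 ends d $ i $ e $ f) = 1"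
proof -
  have card: "card (incident ends i) = d" for i using reg by (simp add: regular_def)
  have val: "(\<Sum>f\<in>incident ends i. x0 ends d $ i $ e $ f) = real d * (1 / (real d)\<^sup>2)"
    "(\<Sum>f\<in>incident ends i. x0 ends d $ i $ f $ e) = real d * (1 / (real d)\<^sup>2)" if "e \<in> incident ends i" for i e
    using that by (simp_all add: x0_def card)
  show "x0 ends d \<in> V_star ends"
    unfolding V_star_def using val by (auto simp: var_space_def incident_def) (auto simp: x0_def incident_def)
  show "(\<Sum>e\<in>incident ends i. \<Sum>f\<in>incident ends i. x0 ends d $ i $ e $ f) = 1"
    using d by (simp add: val card power2_eq_square)
qed

text \<open>Nonnegative entries with sum 1 at each vertex are at most 1, so the half-spaces l_t >= 0
  inside x0 + V describe the whole feasible set.\<close>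

lemma feasible_eq:
  assumes reg: "regular ends d" and d: "d \<ge> 1"
  shows "{x. x - x0 ends d \<in> V_set ends \<and> (\<forall>t\<in>form_index ends. 0 \<le> form ends t x)} = K_set ends \<inter> W_set ends"
proof -
  note x0 = x0_V_star[OF reg d]
  have "x \<in> K_set ends \<inter> W_set ends" if x: "x - x0 ends d \<in> V_set ends" "\<forall>t\<in>form_index ends. 0 \<le> form ends t x" for x
  proof -
    note xV = V_set_add[OF x(1) x0(1)]
    have vs: "x \<in> var_space ends" using xV(1) by (simp add: V_star_def)
    have nn: "0 \<le> x $ i $ e $ f" for i e f using x(2) forms_nonneg_iff[OF vs] by blast
    have "x $ i $ e $ f \<le> 1" for i e f
    proof (cases "e \<in> incident ends i \<and> f \<in> incident ends i")
      case True
      have "x $ i $ e $ f \<le> (\<Sum>f\<in>incident ends i. x $ i $ e $ f)"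
        using True nn by (intro member_le_sum) auto
      also have "\<dots> \<le> (\<Sum>e\<in>incident ends i. \<Sum>f\<in>incident ends i. x $ i $ e $ f)"
        using True nn by (intro member_le_sum[of e _ "\<lambda>e. \<Sum>f\<in>incident ends i. x $ i $ e $ f"] sum_nonneg) auto
      also have "\<dots> = 1" using xV(2) x0(2) by simp
      finally show ?thesis .
    qed (use vs in \<open>auto simp: var_space_def\<close>)
    then show ?thesis using xV x0(2) vs nn by (simp add: K_set_def W_set_def)
  qed
  moreover have "x - x0 ends d \<in> V_set ends" "\<forall>t\<in>form_index ends. 0 \<le> form ends t x" if "x \<in> K_set ends \<inter> W_set ends" for x
  proof -
    show "x - x0 ends d \<in> V_set ends" using that x0 by (intro V_set_diff) (auto simp: W_set_def)
    show "\<forall>t\<in>form_index ends. 0 \<le> form ends t x" using that forms_nonneg_iff[of x ends] by (auto simp: K_set_def)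
  qed
  ultimately show ?thesis by blast
qed

lemma compact_feasible:
  assumes reg: "regular ends d" and d: "d \<ge> 1"
  shows "compact (K_set ends \<inter> W_set ends :: (real ^ 'e::finite ^ 'e ^ 'v::finite) set)"
proof -
  have "K_set ends \<subseteq> (cbox 0 One :: (real ^ 'e ^ 'e ^ 'v) set)"
  proof
    fix x :: "real ^ 'e ^ 'e ^ 'v" assume x: "x \<in> K_set ends"
    show "x \<in> cbox 0 One"
      unfolding mem_box
    proof
      fix b :: "real ^ 'e ^ 'e ^ 'v" assume b: "b \<in> Basis"
      then obtain i e f where "b = axis i (axis e (axis f 1))" by (auto simp: Basis_vec_def)
      then have "x \<bullet> b = x $ i $ e $ f" by (simp add: inner_axis)
      moreover have "One \<bullet> b = 1" using b by (simp add: inner_sum_left inner_Basis)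
      ultimately show "0 \<bullet> b \<le> x \<bullet> b \<and> x \<bullet> b \<le> One \<bullet> b" using x by (simp add: K_set_def)
    qed
  qed
  then have "bounded (K_set ends \<inter> W_set ends :: (real ^ 'e ^ 'e ^ 'v) set)"
    by (meson bounded_cbox bounded_subset le_infI1)
  moreover have "closed (K_set ends \<inter> W_set ends :: (real ^ 'e ^ 'e ^ 'v) set)"
  proof -
    define S where "S = {x. x - x0 ends d \<in> V_set ends} \<inter> (\<Inter>t\<in>form_index ends. {x. 0 \<le> form ends t x})"
    have cont: "continuous_on UNIV (form ends t)" for t
      using linear_form by (rule linear_continuous_on[OF linear_conv_bounded_linear[THEN iffD1]])
    have "closed {x. 0 \<le> form ends t x}" for t
      by (intro closed_Collect_le cont continuous_on_const)
    moreover have "closed {x. x - x0 ends d \<in> V_set ends}"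
      using continuous_closed_vimage[OF closed_subspace[OF subspace_V_set], of "\<lambda>x. x - x0 ends d"]
      by (auto simp: vimage_def intro!: continuous_intros)
    ultimately have "closed S" unfolding S_def by (intro closed_Int closed_INT) auto
    also have "S = K_set ends \<inter> W_set ends" unfolding feasible_eq[OF reg d, symmetric] S_def by auto
    finally show ?thesis .
  qed
  ultimately show ?thesis by (simp add: compact_eq_bounded_closed)
qed

section \<open>Asymptotics of the second moment\<close>

definition vertex_phi :: "('e::finite \<Rightarrow> 'v::finite set) \<Rightarrow> 'v \<Rightarrow> real ^ 'e ^ 'e ^ 'v \<Rightarrow> real" where
  "vertex_phi ends i x = 1/2 * (\<Sum>e\<in>incident ends i.
     xlnx (sigma_var ends x i e) + xlnx (tau_var ends x i e) + xlnx (gamma_var ends x i e)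
     - xlnx (x $ i $ e $ e) - 2 * (\<Sum>f\<in>incident ends i - {e}. xlnx (x $ i $ e $ f)))"

lemma phi_eq_sum_vertex_phi: "phi ends x = (\<Sum>i\<in>UNIV. vertex_phi ends i x)"
  by (simp only: phi_def vertex_phi_def sum_distrib_left)

text \<open>Numbering the three incident edges, which are distinct objects even if parallel, turns
  the contribution of the vertex into the function F of \<open>pair_entropy_bound_3\<close>. The
  value 4/3 is (d - 1)^(d - 1) / d^(d - 2) at d = 3.\<close>

lemma vertex_phi_le:
  fixes ends :: "'e::finite \<Rightarrow> 'v::finite set"
  assumes card: "card (incident ends i) = 3" and nn: "\<And>e f. 0 \<le> x $ i $ e $ f"
    and tot: "(\<Sum>e\<in>incident ends i. \<Sum>f\<in>incident ends i. x $ i $ e $ f) = 1"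
  shows "vertex_phi ends i x \<le> ln (4/3)"
    and "vertex_phi ends i x = ln (4/3) \<Longrightarrow> e \<in> incident ends i \<Longrightarrow> f \<in> incident ends i \<Longrightarrow> x $ i $ e $ f = 1/9"
proof -
  obtain a b c where abc: "incident ends i = {a, b, c}" "a \<noteq> b" "b \<noteq> c" "a \<noteq> c"
    using card unfolding card_3_iff by blast
  define ed where "ed k = (if k = 1 then a else if k = 2 then b else c)" for k :: nat
  define y where "y k l = x $ i $ ed k $ ed l" for k l
  have ed: "ed 1 = a" "ed (Suc 0) = a" "ed 2 = b" "ed 3 = c" by (simp_all add: ed_def)
  have y: "y 1 1 = x $ i $ a $ a" "y 1 2 = x $ i $ a $ b" "y 1 3 = x $ i $ a $ c"
     "y 2 1 = x $ i $ b $ a" "y 2 2 = x $ i $ b $ b" "y 2 3 = x $ i $ b $ c"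
     "y 3 1 = x $ i $ c $ a" "y 3 2 = x $ i $ c $ b" "y 3 3 = x $ i $ c $ c"
    by (simp_all only: y_def ed)
  have d: "{a, b, c} - {a} = {b, c}" "{a, b, c} - {b} = {a, c}" "{a, b, c} - {c} = {a, b}" using abc by auto
  have nny: "y k l \<ge> 0" for k l using nn by (simp add: y_def)
  have toty: "y 1 1 + y 1 2 + y 1 3 + y 2 1 + y 2 2 + y 2 3 + y 3 1 + y 3 2 + y 3 3 = 1"
    unfolding y using tot abc by (simp add: add.assoc)
  define F where "F = 1/2 * (xlnx (y 1 2 + y 1 3) + xlnx (y 2 1 + y 3 1) + xlnx (y 2 2 + y 2 3 + y 3 2 + y 3 3) - xlnx (y 1 1)
      + xlnx (y 2 1 + y 2 3) + xlnx (y 1 2 + y 3 2) + xlnx (y 1 1 + y 1 3 + y 3 1 + y 3 3) - xlnx (y 2 2)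
      + xlnx (y 3 1 + y 3 2) + xlnx (y 1 3 + y 2 3) + xlnx (y 1 1 + y 1 2 + y 2 1 + y 2 2) - xlnx (y 3 3))
      - (xlnx (y 1 2) + xlnx (y 1 3) + xlnx (y 2 1) + xlnx (y 2 3) + xlnx (y 3 1) + xlnx (y 3 2))"
  have v: "vertex_phi ends i x = F"
    unfolding vertex_phi_def sigma_var_def tau_var_def gamma_var_def abc(1) F_def y
    using abc(2-4) by (simp add: d) (simp add: algebra_simps)
  have "F \<le> ln (4/3)"
    using pair_entropy_bound_3(1)[of y, OF nny toty] unfolding F_def by simp
  then show "vertex_phi ends i x \<le> ln (4/3)" by (simp only: v)
  have bound: "y k l = 1/9" if "F = ln (4/3)" "k \<in> {1,2,3}" "l \<in> {1,2,3}" for k l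
    using pair_entropy_bound_3(2)[of y, OF nny toty _ that(2,3)] that(1) unfolding F_def by simp
  assume e: "vertex_phi ends i x = ln (4/3)" "e \<in> incident ends i" "f \<in> incident ends i"
  obtain k l where kl: "k \<in> {1,2,3}" "l \<in> {1,2,3}" "e = ed k" "f = ed l"
    using e(2,3) unfolding abc(1) by (auto simp flip: ed(2-4))
  show "x $ i $ e $ f = 1/9" using bound[OF e(1)[unfolded v] kl(1,2)] by (simp add: y_def kl)
qed

text \<open>Each vertex is bounded on its own, with equality only if all its entries are 1/9. The
  point x0 attains all these bounds at once and is feasible, while any other feasible point is
  strictly below at a vertex where it differs from x0.\<close>

lemma unique_max_3:
  fixes ends :: "'e::finite \<Rightarrow> 'v::finite set"
  assumes reg: "regular ends 3"
  shows "unique_max_on (phi ends) (K_set ends \<inter> W_set ends) (x0 ends 3)"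
  unfolding unique_max_on_def
proof (intro conjI ballI impI)
  have card: "card (incident ends i) = 3" for i using reg by (simp add: regular_def)
  have "x0 ends 3 \<in> {x. x - x0 ends 3 \<in> V_set ends \<and> (\<forall>t\<in>form_index ends. 0 \<le> form ends t x)}"
    using subspace_0[OF subspace_V_set] form_x0_pos[OF reg] by (simp add: less_imp_le)
  then show "x0 ends 3 \<in> K_set ends \<inter> W_set ends" unfolding feasible_eq[OF reg one_le_numeral] .
  fix x assume x: "x \<in> K_set ends \<inter> W_set ends" "x \<noteq> x0 ends 3"
  have nn: "0 \<le> x $ i $ e $ f" for i e f using x(1) by (simp add: K_set_def)
  have tot: "(\<Sum>e\<in>incident ends i. \<Sum>f\<in>incident ends i. x $ i $ e $ f) = 1" for i using x(1) by (simp add: W_set_def)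
  have vs: "x \<in> var_space ends" using x(1) by (simp add: K_set_def)
  obtain i e f where ief: "x $ i $ e $ f \<noteq> x0 ends 3 $ i $ e $ f"
    using x(2) by (auto simp: Finite_Cartesian_Product.vec_eq_iff)
  have inc: "e \<in> incident ends i" "f \<in> incident ends i"
    using ief vs by (auto simp: var_space_def x0_def split: if_splits)
  have "vertex_phi ends i x \<noteq> ln (4/3)"
    using vertex_phi_le(2)[OF card nn tot _ inc] ief inc by (auto simp: x0_def)
  then have lt: "vertex_phi ends i x < ln (4/3)" using vertex_phi_le(1)[OF card nn tot, of i] by simp
  have "phi ends x < (\<Sum>i\<in>(UNIV :: 'v set). ln (4/3))"
    unfolding phi_eq_sum_vertex_phi
    by (rule sum_strict_mono_ex1) (use lt vertex_phi_le(1)[OF card nn tot] in auto)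
  also have "\<dots> = phi ends (x0 ends 3)"
  proof -
    have "ln (4/3) = 2 * ln 2 - ln (3::real)" using ln_realpow[of 2 2] by (simp add: ln_div)
    then show ?thesis using phi_x0[OF reg] by simp
  qed
  finally show "phi ends x < phi ends (x0 ends 3)" .
qed

section \<open>The asymptotic formula\<close>

lemma form_Ints:
  assumes "\<And>i e f. x $ i $ e $ f \<in> \<int>"
  shows "form ends t x \<in> \<int>"
proof -
  have sums: "sigma_var ends x i e \<in> \<int>" "tau_var ends x i e \<in> \<int>" "gamma_var ends x i e \<in> \<int>" for i e
    unfolding sigma_var_def tau_var_def gamma_var_def by (intro Ints_sum assms)+
  obtain i e s where t: "t = (i, e, s)" by (cases t)
  show ?thesis unfolding t form_def using sums[of i e] assms by (cases s) simp_all
qed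

text \<open>In one lattice basis the squared volume is I and det(-H|V) is H / I, so the denominator
  Vol(L2) det(-H|V)^(1/2) is sqrt H. The same sqrt H appears as the constant of the Laplace
  sum.\<close>

lemma second_moment_asymp_equiv:
  fixes ends :: "'e::finite \<Rightarrow> 'v::finite set"
  assumes ll: "loopless ends" and reg: "regular ends d" and d: "d \<ge> 2"
    and det: "neg_hessian_det ends d \<noteq> 0"
    and max: "unique_max_on (phi ends) (K_set ends \<inter> W_set ends) (x0 ends d)"
  defines "g \<equiv> CARD('v)" and "r \<equiv> lattice_rank (L2_lattice ends)"
  shows "second_moment ends \<sim>[inf sequentially (principal (admissible ends))]
      (\<lambda>n. ((real d - 1) * real d ^ (d - 2)) ^ (d * g)
            / (lattice_vol (L2_lattice ends) * sqrt (neg_hessian_det ends d))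
            * (2 * pi * real n) powr (real r / 2 + real g / 2 + 3 * real d * real g / 4 - (real d)\<^sup>2 * real g / 2)
            * ((real d - 1) ^ (d - 1) / real d ^ (d - 2)) ^ (g * n))"
proof -
  interpret E: entropy_sum "form_index ends" form_coeff "form ends" "x0 ends d"
    by (rule entropy_sum_phi[OF reg d])
  have d1: "d \<ge> 1" using d by simp
  have Phi: "E.Phi = phi ends" by (rule ext) (simp only: E.Phi_def phi_eq)
  define V where "V = V_set ends"
  define bs where "bs = (SOME bs. lattice_basis (L2_lattice ends) bs)"
  have bs: "lattice_basis (L2_lattice ends) bs" unfolding bs_def by (rule someI_ex[OF lattice_basis_L2])
  note lb = lattice_basisD[OF bs]
  have V: "span (set bs) = V" using lb(4) by (simp add: span_L2_lattice V_def)
  have r: "r = length bs" by (simp add: r_def lattice_rank_def bs_def)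
  define I where "I = form_det (\<bullet>) bs"
  define H where "H = form_det E.Q bs"
  have vol: "lattice_vol (L2_lattice ends) = sqrt I" by (simp add: lattice_vol_def bs_def I_def)
  have I: "I > 0" unfolding I_def
    by (rule form_det_pos[OF bilinear_inner _ lb(1,2)]) (auto simp: inner_commute)
  have "(\<lambda>z w. - hessian (phi ends) (x0 ends d) z w) = E.Q"
    using E.hessian_Phi by (intro ext) (simp add: Phi)
  then have nhd: "neg_hessian_det ends d = H / I"
    unfolding neg_hessian_det_def H_def I_def by (simp only: det_on_eq[OF E.bilinear_Q lb(1,2) V[unfolded V_def]])
  then have H0: "H \<noteq> 0" using det by auto
  have maxV: "phi ends x < phi ends (x0 ends d)"
    if "x - x0 ends d \<in> V" "\<And>t. t \<in> form_index ends \<Longrightarrow> 0 \<le> form ends t x" "x \<noteq> x0 ends d" for x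
  proof -
    have "x \<in> K_set ends \<inter> W_set ends" using that feasible_eq[OF reg d1] by (auto simp: V_def)
    then show ?thesis using max that(3) by (auto simp: unique_max_on_def)
  qed
  have psd: "E.Q h h \<ge> 0" if "h \<in> span (set bs)" for h
  proof (rule E.max_necessary(2)[where V = V])
    show "subspace V" by (simp add: V_def subspace_V_set)
    show "h \<in> V" using that V by simp
    fix x assume x: "x - x0 ends d \<in> V" "\<And>t. t \<in> form_index ends \<Longrightarrow> 0 \<le> form ends t x"
    show "E.Phi x \<le> E.Phi (x0 ends d)" unfolding Phi using maxV[OF x] by (cases "x = x0 ends d") auto
  qed
  have pd: "E.Q h h > 0" if "h \<in> span (set bs)" "h \<noteq> 0" for h
    by (rule psd_form_det_pos_def[OF E.bilinear_Q E.Q_sym psd H0[unfolded H_def] that])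
  have H: "H > 0" unfolding H_def by (rule form_det_pos[OF E.bilinear_Q E.Q_sym lb(1,2)]) (use pd in auto)
  define F where "F = inf sequentially (principal (admissible ends))"
  have Fseq: "F \<le> sequentially" by (simp add: F_def)
  define y where "y n = (SOME y. y \<in> count_vectors ends n)" for n
  have adm: "\<forall>\<^sub>F n in F. n \<in> admissible ends" by (simp add: F_def eventually_inf_principal)
  have y: "\<forall>\<^sub>F n in F. y n \<in> count_vectors ends n"
    using adm
  proof eventually_elim
    case (elim n)
    then show ?case unfolding y_def some_in_eq by (rule count_vectors_nonempty[OF ll])
  qed
  \<comment> \<open>\<open>y n\<close> is an arbitrary point of the coset, so nothing is known about
    \<open>v n\<close> beyond its lying in V; the Laplace sum is uniform in this shift.\<close>
  define v where "v n = y n - real n *\<^sub>R x0 ends d" for n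
  have npos: "\<forall>\<^sub>F n in F. n > 0" using Fseq eventually_gt_at_top[of "0::nat"] by (rule filter_leD)
  note x0V = x0_V_star[OF reg d1]
  have v: "\<forall>\<^sub>F n in F. v n \<in> span (set bs)"
    using y
  proof eventually_elim
    case (elim n)
    show ?case unfolding V V_def v_def
    proof (rule V_set_diff)
      show "y n \<in> V_star ends" using elim by (simp add: count_vectors_def)
      show "real n *\<^sub>R x0 ends d \<in> V_star ends" using x0V(1) by (rule subspace_scale[OF subspace_V_star])
      show "(\<Sum>e\<in>incident ends i. \<Sum>f\<in>incident ends i. y n $ i $ e $ f)
          = (\<Sum>e\<in>incident ends i. \<Sum>f\<in>incident ends i. (real n *\<^sub>R x0 ends d) $ i $ e $ f)" for i
        using elim x0V(2)[of i] by (simp add: count_vectors_def flip: sum_distrib_left)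
    qed
  qed
  have int: "\<forall>\<^sub>F n in F. \<forall>u\<in>lattice_span bs. \<forall>t\<in>form_index ends. form ends t (real n *\<^sub>R x0 ends d + (v n + u)) \<in> \<int>"
    using y
  proof eventually_elim
    case (elim n)
    show ?case
    proof (intro ballI)
      fix u t assume u: "u \<in> lattice_span bs"
      have "(y n + u) $ i $ e $ f \<in> \<int>" for i e f
        using elim u Nats_subset_Ints by (auto simp: count_vectors_def L2_lattice_def simp flip: lb(3) intro!: Ints_add)
      then have "form ends t (y n + u) \<in> \<int>" by (rule form_Ints)
      then show "form ends t (real n *\<^sub>R x0 ends d + (v n + u)) \<in> \<int>" by (simp add: v_def)
    qed
  qed
  have X: "\<forall>\<^sub>F n in F. count_vectors ends n
      = {x. x - real n *\<^sub>R x0 ends d - v n \<in> lattice_span bs \<and> (\<forall>t\<in>form_index ends. 0 \<le> form ends t x)}"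
    using y
  proof eventually_elim
    case (elim n)
    have "x - real n *\<^sub>R x0 ends d - v n = x - y n" for x by (simp add: v_def)
    then show ?case unfolding lb(3)[symmetric] by (simp only: count_vectors_eq_translate[OF elim])
  qed
  have comp: "compact {x. x - x0 ends d \<in> span (set bs) \<and> (\<forall>t\<in>form_index ends. 0 \<le> form ends t x)}"
    unfolding V V_def feasible_eq[OF reg d1] by (rule compact_feasible[OF reg d1])
  define T where "T n = (\<Sum>x\<in>count_vectors ends n. exp (real n * (phi ends (x /\<^sub>R real n) - phi ends (x0 ends d))) * E.stirling_weight n x)"
    for n
  have "((\<lambda>n. infsum (\<lambda>x. exp (real n * (E.Phi (x /\<^sub>R real n) - E.Phi (x0 ends d))) * E.stirling_weight n x) (count_vectors ends n)
      / (2 * pi * real n) powr (real (length bs) / 2)) \<longlongrightarrow> 1 / sqrt (form_det E.Q bs)) F"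
    by (rule E.entropy_laplace[OF lb(1,2) comp _ pd Fseq v int X]) (use maxV V in \<open>auto simp: Phi\<close>)
  then have T: "((\<lambda>n. T n / (2 * pi * real n) powr (real r / 2)) \<longlongrightarrow> 1 / sqrt H) F"
    by (simp add: Phi infsum_finite second_moment_eq(1)[OF ll] T_def r H_def)
  define a where "a = real g * (1 - real d / 2)"
  define b where "b = real g * (2 * real d - (real d)\<^sup>2) / 2"
  define e where "e = real r / 2 + real g / 2 + 3 * real d * real g / 4 - (real d)\<^sup>2 * real g / 2"
  define A where "A = ((real d - 1) * real d ^ (d - 2)) ^ (d * g)"
  define C where "C n = ((real d - 1) ^ (d - 1) / real d ^ (d - 2)) ^ (g * n)" for n
  have "((\<lambda>n. stirling_quot n / sqrt (2 * pi * real n)) \<longlongrightarrow> 1) F"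
    using stirling by (rule tendsto_mono[OF Fseq])
  then have "((\<lambda>n. (stirling_quot n / sqrt (2 * pi * real n)) powr a) \<longlongrightarrow> 1 powr a) F"
    by (intro tendsto_powr tendsto_const) auto
  then have "((\<lambda>n. (stirling_quot n / sqrt (2 * pi * real n)) powr a * (T n / (2 * pi * real n) powr (real r / 2)) * sqrt H)
      \<longlongrightarrow> 1 powr a * (1 / sqrt H) * sqrt H) F"
    by (intro tendsto_mult T tendsto_const)
  then have lim: "((\<lambda>n. (stirling_quot n / sqrt (2 * pi * real n)) powr a * (T n / (2 * pi * real n) powr (real r / 2)) * sqrt H)
      \<longlongrightarrow> 1) F" using H by simp
  have vd: "lattice_vol (L2_lattice ends) * sqrt (neg_hessian_det ends d) = sqrt H"
    using I by (simp add: vol nhd flip: real_sqrt_mult)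
  have "((\<lambda>n. second_moment ends n / (A / sqrt H * (2 * pi * real n) powr e * C n)) \<longlongrightarrow> 1) F"
  proof (rule Lim_transform_eventually[OF lim])
    show "\<forall>\<^sub>F n in F. (stirling_quot n / sqrt (2 * pi * real n)) powr a * (T n / (2 * pi * real n) powr (real r / 2)) * sqrt H
      = second_moment ends n / (A / sqrt H * (2 * pi * real n) powr e * C n)"
      using npos
    proof eventually_elim
      case (elim n)
      define w where "w = 2 * pi * real n"
      have w: "w > 0" using elim by (simp add: w_def)
      have pos: "A > 0" "C n > 0" using d by (auto simp: A_def C_def)
      have "second_moment ends n = A * C n * stirling_quot n powr a * w powr b * T n"
        unfolding second_moment_eq(2)[OF ll] T_def sum_distrib_left
        by (intro sum.cong refl) (simp only: count_term_eq[OF reg d elim] A_def C_def a_def b_def w_def g_def)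
      moreover have "(stirling_quot n / sqrt w) powr a = stirling_quot n powr a / w powr (a / 2)"
        using w by (simp add: powr_divide less_imp_le powr_half_sqrt[symmetric] powr_powr)
      moreover have "w powr e = w powr (real r / 2) * w powr (a / 2) * w powr b"
      proof -
        \<comment> \<open>The three sources of the exponent: r/2 from the lattice sum, a/2 = g/2 - d
          g/4 from the square roots in the powers of n!, and b = d g - d^2 g/2 from the normalised
          factorials of the counts.\<close>
        have "e = real r / 2 + a / 2 + b" by (simp add: e_def a_def b_def field_simps)
        then show ?thesis by (simp only: powr_add)
      qed
      moreover have "w powr (real r / 2) > 0" "w powr (a / 2) > 0" "w powr b > 0" using w by simp_all
      ultimately show ?case using pos H w unfolding w_def[symmetric] by (simp add: field_simps)
    qed
  qed
  then show ?thesis unfolding F_def[symmetric] vd by (intro asymp_equivI') (simp add: A_def C_def e_def)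
qed

theorem theorem4p2:
  fixes ends :: "'e::finite \<Rightarrow> 'v::finite set" and d :: nat
  assumes "loopless ends" and "connected_multigraph ends" and "regular ends d" and "d \<ge> 3"
    and "neg_hessian_det ends d \<noteq> 0"
  defines "g \<equiv> CARD('v)"
    and "r \<equiv> lattice_rank (L2_lattice ends)"
  defines "asymptotics \<equiv>
    (second_moment ends \<sim>[sequentially \<sqinter> principal (admissible ends)]
      (\<lambda>n. ((real d - 1) * real d ^ (d - 2)) ^ (d * g)
            / (lattice_vol (L2_lattice ends) * sqrt (neg_hessian_det ends d))
            * (2 * pi * real n) powr (real r / 2 + real g / 2 + 3 * real d * real g / 4
                                       - (real d)\<^sup>2 * real g / 2)
            * ((real d - 1) ^ (d - 1) / real d ^ (d - 2)) ^ (g * n)))"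
  shows "(unique_max_on (phi ends) (K_set ends \<inter> W_set ends) (x0 ends d) \<longrightarrow> asymptotics)
       \<and> (d = 3 \<longrightarrow> asymptotics)"
proof -
  have *: asymptotics if "unique_max_on (phi ends) (K_set ends \<inter> W_set ends) (x0 ends d)"
    unfolding asymptotics_def g_def r_def
    by (rule second_moment_asymp_equiv) (use assms(1,3,4,5) that in auto)
  moreover have "unique_max_on (phi ends) (K_set ends \<inter> W_set ends) (x0 ends d)" if "d = 3"
    using unique_max_3 assms(3) that by blast
  ultimately show ?thesis by blast
qed

end
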